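(* Assume $n^t\ge4$ and let $\{N_l : l=1,\dots,n\}$, $n=n^s(n^t-4)+6$, be the double-pole polar spline functions on $\Omega$ defined in the context. Then these functions are linearly independent, locally supported, and form a convex partition of unity on $\Omega$. Moreover, for every $d\ge3$ and all control points $\mathbf{f}_1,\dots,\mathbf{f}_n\in\mathbb{R}^d$ such that $\mathbf{f}_1,\mathbf{f}_2,\mathbf{f}_3$ are non-collinear and $\mathbf{f}_{n-2},\mathbf{f}_{n-1},\mathbf{f}_n$ are non-collinear, the polar surface $\mathbf{f}(s,t)=\sum_{l=1}^n\mathbf{f}_lN_l(s,t)$ has a well-defined tangent plane at both poles.
   Context: **Univariate $C^1$ rational splines.** An open knot vector of degree $p\ge2$ on $[x_1,x_2]$ ($x_1<x_2$) is $[\xi_1,\dots,\xi_{k+p+1}]$, non-decreasing, with $\xi_1=\dots=\xi_{p+1}=x_1<\xi_{p+2}$, $\xi_k<\xi_{k+1}=\dots=\xi_{k+p+1}=x_2$, and interior knots of multiplicity between $1$ and $p-1$. With the associated B-splines $b_{j,p}$ (Cox–de Boor recursion, left continuous at $x_2$) and positive weights $w_1,\dots,w_k$, the NURBS are $b^w_{j,p}=w_jb_{j,p}/\sum_i w_ib_{i,p}$. Given $m$ such knot vectors (degrees $p^{(i)}$, numbers of B-splines $k^{(i)}$, intervals $[x^{(i)}_1,x^{(i)}_2]$) and weight vectors $\mathbf{w}^{(i)}$, translate the intervals so that they are placed consecutively and form a single interval, translate the NURBS accordingly, and extend each by zero outside its segment (segments taken half-open on the right, except the last one which is closed). List all of them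 as $b_1,\dots,b_{\mu_m}$, where $\mu_0=0$, $\mu_i=\sum_{\ell\le i}k^{(\ell)}$; put $\eta_i=\mu_i-2i$ and $$\alpha^{(i)}=\frac{p^{(i)}}{x_2^{(i)}-\xi^{(i)}_{k^{(i)}}}\frac{w^{(i)}_{k^{(i)}-1}}{w^{(i)}_{k^{(i)}}},\qquad \beta^{(i)}=\frac{p^{(i+1)}}{\xi^{(i+1)}_{p^{(i+1)}+2}-x_1^{(i+1)}}\frac{w^{(i+1)}_2}{w^{(i+1)}_1}$$ ($i=1,\dots,m$, with $i+1$ identified with $1$ when $i=m$). Let $\mathbf{H}^c$ be the $\eta_m\times(\mu_m-2)$ matrix with only non-zero entries $H^c_{\eta_{i-1}+j,\mu_{i-1}+j}=1$ ($1\le i\le m$, $1\le j\le k^{(i)}-2$) and, for $1\le i\le m-1$, $H^c_{\eta_i,\mu_i-1}=H^c_{\eta_i,\mu_i}=\alpha^{(i)}/(\alpha^{(i)}+\beta^{(i)})$, $H^c_{\eta_i+1,\mu_i-1}=H^c_{\eta_i+1,\mu_i}=\beta^{(i)}/(\alpha^{(i)}+\beta^{(i)})$. The non-periodic basis is $\mathrm{diag}(1,\mathbf{H}^c,1)\,\mathbf{b}$ and the periodic basis is $[\mathbf{h}|\mathbf{H}^c|\mathbf{h}]\,\mathbf{b}$, where $\mathbf{h}$ has top entry $\beta^{(m)}/(\alpha^{(m)}+\beta^{(m)})$, bottom entry $\alpha^{(m)}/(\alpha^{(m)}+\beta^{(m)})$ and zeros elsewhere. **Tensor product.** Let $\Omega^s=[0,s_2]$,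 $\Omega^t=[0,t_2]$, $\Omega=\Omega^s\times\Omega^t$. Choose one collection of open knot vectors and weight vectors whose translated intervals form $\Omega^s$, and another (possibly with a different number of segments, degrees and weights) whose translated intervals form $\Omega^t$. Let $B^s_i$, $i=1,\dots,n^s$, $n^s\ge3$, be the entries of the periodic basis $[\mathbf{h}|\mathbf{H}^c|\mathbf{h}]\,\mathbf{b}$ built from the first collection on $\Omega^s$, and $B^t_j$, $j=1,\dots,n^t$, the entries of the non-periodic basis $\mathrm{diag}(1,\mathbf{H}^c,1)\,\mathbf{b}$ built from the second collection on $\Omega^t$. Put $B_{ij}(s,t)=B^s_i(s)B^t_j(t)$. **Polar maps.** Let $\rho_j=\frac{j-1}{n^t-1}$, $\theta_i=2\pi+\frac{(1-2i)\pi}{n^s}$, $\hat\rho_j=1-\rho_j$, $\hat\theta_i=2\pi-\theta_i$, and $$\mathbf{F}(s,t)=\sum_{i,j}(\rho_j\cos\theta_i,\rho_j\sin\theta_i)B_{ij}(s,t),\qquad \hat{\mathbf{F}}(s,t)=\sum_{i,j}(\hat\rho_j\cos\hat\theta_i,\hat\rho_j\sin\hat\theta_i)B_{ij}(s,t).$$ $\mathbf{F}$ collapses the edge $t=0$ to $(0,0)$ (first pole) and $\hat{\mathbf{F}}$ collapses the edge $t=t_2$ to $(0,0)$ (second pole). Standing assumption: $\mathbf{F}$ on $\Omega^s\times(0,t_2]$ and $\hat{\mathbf{F}}$ on $\Omega^s\times[0,t_2)$ are injective up to the identification of $(0,t)$ with $(s_2,t)$, do not take the value $(0,0)$, and have non-vanishing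 Jacobian determinant. **Polar splines.** Arrange the $B_{ij}$ in a vector $\mathbf{B}$ with $B_{ij}$ in position $i+(j-1)n^s$. Let $\bar{\mathbf{E}}$ be the $3\times 2n^s$ matrix whose columns $1,\dots,n^s$ all equal $(\frac13,\frac13,\frac13)^T$ and whose column $n^s+i$, $i=1,\dots,n^s$, is $$\begin{bmatrix}\frac13&0&\frac13\\-\frac16&\frac{\sqrt3}{6}&\frac13\\-\frac16&-\frac{\sqrt3}{6}&\frac13\end{bmatrix}\begin{bmatrix}\cos\theta_i\\ \sin\theta_i\\1\end{bmatrix}.$$ Let $\mathbf{J}_k$ be the $k\times k$ exchange matrix (ones on the anti-diagonal, zeros elsewhere) and let $\mathbf{E}$ be the block-diagonal matrix $\mathrm{diag}(\bar{\mathbf{E}},\ \mathbf{I},\ \mathbf{J}_3\bar{\mathbf{E}}\mathbf{J}_{2n^s})$ with $\mathbf{I}$ the identity of size $n^s(n^t-4)$. Define $(N_1,\dots,N_n)^T=\mathbf{E}\mathbf{B}$ on $\Omega$. **Terminology.** "Convex partition of unity" means non-negative functions summing to $1$. "Locally supported" means that $N_l$ vanishes outside the union of the supports of those $B_{ij}$ whose coefficient in row $l$ of the (sparse) matrix $\mathbf{E}$ is non-zero. The surface $\mathbf{f}$ "has a well-defined tangent plane" at the first pole if $\mathbf{f}$ is constant on the edge $t=0$ and the reparameterized surface $\mathbf{f}^{pol}$, given by $\mathbf{f}^{pol}(\mathbf{F}(s,t))=\mathbf{f}(s,t)$ for $(s,t)$ near the edge $t=0$, is such that $\mathbf{f}^{pol}$,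 $\partial\mathbf{f}^{pol}/\partial u$ and $\partial\mathbf{f}^{pol}/\partial v$ have limits as $(u,v)\to(0,0)$, with the limits of the two first derivatives being linearly independent vectors of $\mathbb{R}^d$; likewise at the second pole, with $\hat{\mathbf{F}}$ and the edge $t=t_2$ in place of $\mathbf{F}$ and $t=0$. *)

theory Defs
  imports "HOL-Analysis.Analysis" "Jordan_Normal_Form.Matrix"
begin

(* Conventions.  Knots, weights, segments and basis functions are indexed from 1.
   The matrices and vectors of Jordan_Normal_Form.Matrix are indexed from 0, so entry (r,c) in
   one-based indexing is entry (r-1,c-1) of the matrix. *)

(* Data of one rational segment: degree p, number k of B-splines, interval [lo,hi],
   knots xi_1,...,xi_(k+p+1), weights w_1,...,w_k.
   Values of knot and weight at other indices are never used. *)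
record segment =
  deg :: nat
  num :: nat
  lo :: real
  hi :: real
  knot :: "nat \<Rightarrow> real"
  weight :: "nat \<Rightarrow> real"

definition open_knot_vector :: "nat \<Rightarrow> nat \<Rightarrow> real \<Rightarrow> real \<Rightarrow> (nat \<Rightarrow> real) \<Rightarrow> bool" where
  "open_knot_vector p k x1 x2 \<xi> \<longleftrightarrow>
     2 \<le> p \<and> x1 < x2 \<and>
     mono_on {1..k+p+1} \<xi> \<and>
     (\<forall>j\<in>{1..p+1}. \<xi> j = x1) \<and> x1 < \<xi> (p+2) \<and>
     \<xi> k < x2 \<and> (\<forall>j\<in>{k+1..k+p+1}. \<xi> j = x2) \<and>
     (\<forall>j\<in>{p+2..k}. card {l\<in>{1..k+p+1}. \<xi> l = \<xi> j} \<le> p - 1)"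

definition valid_segment :: "segment \<Rightarrow> bool" where
  "valid_segment \<sigma> \<longleftrightarrow>
     open_knot_vector (deg \<sigma>) (num \<sigma>) (lo \<sigma>) (hi \<sigma>) (knot \<sigma>) \<and>
     (\<forall>j\<in>{1..num \<sigma>}. 0 < weight \<sigma> j)"

(* Cox-de Boor recursion; quotients with zero denominator are 0 (as x / 0 = 0 in HOL).
   The last nonempty knot span is closed at the right end x2: left continuity at x2. *)
fun bspline :: "(nat \<Rightarrow> real) \<Rightarrow> real \<Rightarrow> nat \<Rightarrow> nat \<Rightarrow> real \<Rightarrow> real" where
  "bspline \<xi> x2 0 j x =
     (if \<xi> j \<le> x \<and> x < \<xi> (j+1) \<or> x = x2 \<and> \<xi> j < x2 \<and> \<xi> (j+1) = x2 then 1 else 0)"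
| "bspline \<xi> x2 (Suc q) j x =
     (x - \<xi> j) / (\<xi> (j+q+1) - \<xi> j) * bspline \<xi> x2 q j x +
     (\<xi> (j+q+2) - x) / (\<xi> (j+q+2) - \<xi> (j+1)) * bspline \<xi> x2 q (j+1) x"

definition nurbs :: "segment \<Rightarrow> nat \<Rightarrow> real \<Rightarrow> real" where
  "nurbs \<sigma> j x =
     weight \<sigma> j * bspline (knot \<sigma>) (hi \<sigma>) (deg \<sigma>) j x /
     (\<Sum>i=1..num \<sigma>. weight \<sigma> i * bspline (knot \<sigma>) (hi \<sigma>) (deg \<sigma>) i x)"

(* offset S i and offset S (i+1) are the end points of the i-th translated interval;
   offset S (m+1) is the total length. *)
definition offset :: "(nat \<Rightarrow> segment) \<Rightarrow> nat \<Rightarrow> real" where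
  "offset S i = (\<Sum>l=1..<i. hi (S l) - lo (S l))"

definition segment_fun :: "nat \<Rightarrow> (nat \<Rightarrow> segment) \<Rightarrow> nat \<Rightarrow> nat \<Rightarrow> real \<Rightarrow> real" where
  "segment_fun m S i j x =
     (if offset S i \<le> x \<and> (x < offset S (i+1) \<or> i = m \<and> x = offset S (i+1))
      then nurbs (S i) j (x - offset S i + lo (S i)) else 0)"

definition b_vec :: "nat \<Rightarrow> (nat \<Rightarrow> segment) \<Rightarrow> real \<Rightarrow> real Matrix.vec" where
  "b_vec m S x =
     vec_of_list (concat (map (\<lambda>i. map (\<lambda>j. segment_fun m S i j x) [1..<num (S i)+1]) [1..<m+1]))"

definition mu :: "(nat \<Rightarrow> segment) \<Rightarrow> nat \<Rightarrow> nat" where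
  "mu S i = (\<Sum>l=1..i. num (S l))"

definition eta :: "(nat \<Rightarrow> segment) \<Rightarrow> nat \<Rightarrow> nat" where
  "eta S i = mu S i - 2 * i"

definition alpha :: "(nat \<Rightarrow> segment) \<Rightarrow> nat \<Rightarrow> real" where
  "alpha S i =
     (let \<sigma> = S i; k = num \<sigma> in
       deg \<sigma> / (hi \<sigma> - knot \<sigma> k) * (weight \<sigma> (k-1) / weight \<sigma> k))"

definition beta :: "nat \<Rightarrow> (nat \<Rightarrow> segment) \<Rightarrow> nat \<Rightarrow> real" where
  "beta m S i =
     (let \<sigma> = S (if i = m then 1 else i+1) in
       deg \<sigma> / (knot \<sigma> (deg \<sigma> + 2) - lo \<sigma>) * (weight \<sigma> 2 / weight \<sigma> 1))"

(* One-based entries of H^c.  The listed positions are pairwise different, so at most one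
   summand is nonzero. *)
definition Hc_entry :: "nat \<Rightarrow> (nat \<Rightarrow> segment) \<Rightarrow> nat \<Rightarrow> nat \<Rightarrow> real" where
  "Hc_entry m S r c =
     (\<Sum>i=1..m. \<Sum>j=1..num (S i) - 2.
        if r = eta S (i-1) + j \<and> c = mu S (i-1) + j then 1 else 0) +
     (\<Sum>i=1..<m. if c = mu S i - 1 \<or> c = mu S i then
          if r = eta S i then alpha S i / (alpha S i + beta m S i)
          else if r = eta S i + 1 then beta m S i / (alpha S i + beta m S i)
          else 0
        else 0)"

definition Hc :: "nat \<Rightarrow> (nat \<Rightarrow> segment) \<Rightarrow> real mat" where
  "Hc m S = Matrix.mat (eta S m) (mu S m - 2) (\<lambda>(r,c). Hc_entry m S (r+1) (c+1))"

definition h_vec :: "nat \<Rightarrow> (nat \<Rightarrow> segment) \<Rightarrow> real Matrix.vec" where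
  "h_vec m S = Matrix.vec (eta S m) (\<lambda>r.
     if r = 0 then beta m S m / (alpha S m + beta m S m)
     else if r = eta S m - 1 then alpha S m / (alpha S m + beta m S m)
     else 0)"

definition nonperiodic_basis :: "nat \<Rightarrow> (nat \<Rightarrow> segment) \<Rightarrow> nat \<Rightarrow> real \<Rightarrow> real" where
  "nonperiodic_basis m S j x =
     vec_index (diag_block_mat [1\<^sub>m 1, Hc m S, 1\<^sub>m 1] *\<^sub>v b_vec m S x) (j-1)"

definition periodic_basis :: "nat \<Rightarrow> (nat \<Rightarrow> segment) \<Rightarrow> nat \<Rightarrow> real \<Rightarrow> real" where
  "periodic_basis m S i x =
     vec_index (mat_of_cols (eta S m) ([h_vec m S] @ cols (Hc m S) @ [h_vec m S])
                 *\<^sub>v b_vec m S x) (i-1)"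

definition tensor :: "(nat \<Rightarrow> real \<Rightarrow> real) \<Rightarrow> (nat \<Rightarrow> real \<Rightarrow> real) \<Rightarrow> nat \<Rightarrow> nat \<Rightarrow> real \<times> real \<Rightarrow> real" where
  "tensor Bs Bt i j = (\<lambda>(s,t). Bs i s * Bt j t)"

definition rho :: "nat \<Rightarrow> nat \<Rightarrow> real" where
  "rho nt j = (real j - 1) / (real nt - 1)"

definition theta :: "nat \<Rightarrow> nat \<Rightarrow> real" where
  "theta ns i = 2 * pi + (1 - 2 * real i) * pi / real ns"

definition rho_hat :: "nat \<Rightarrow> nat \<Rightarrow> real" where
  "rho_hat nt j = 1 - rho nt j"

definition theta_hat :: "nat \<Rightarrow> nat \<Rightarrow> real" where
  "theta_hat ns i = 2 * pi - theta ns i"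

definition polar_map ::
  "nat \<Rightarrow> nat \<Rightarrow> (nat \<Rightarrow> real) \<Rightarrow> (nat \<Rightarrow> real) \<Rightarrow> (nat \<Rightarrow> nat \<Rightarrow> real \<times> real \<Rightarrow> real)
     \<Rightarrow> real \<times> real \<Rightarrow> real \<times> real" where
  "polar_map ns nt \<rho> \<theta> B z =
     (\<Sum>i=1..ns. \<Sum>j=1..nt. B i j z *\<^sub>R (\<rho> j * cos (\<theta> i), \<rho> j * sin (\<theta> i)))"

(* Jacobian determinant on the closed rectangle [0,s2] x [0,t2]; on its boundary the partial
   derivatives are one-sided. *)
definition jacobian_det :: "real \<Rightarrow> real \<Rightarrow> (real \<times> real \<Rightarrow> real \<times> real) \<Rightarrow> real \<Rightarrow> real \<Rightarrow> real" where
  "jacobian_det s2 t2 F s t =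
     (let Fs = vector_derivative (\<lambda>x. F (x, t)) (at s within {0..s2});
          Ft = vector_derivative (\<lambda>y. F (s, y)) (at t within {0..t2})
      in fst Fs * snd Ft - snd Fs * fst Ft)"

(* A is the interval [0,t2] without the parameter value of the pole. *)
definition regular_off_pole ::
  "real \<Rightarrow> real \<Rightarrow> real set \<Rightarrow> (real \<times> real \<Rightarrow> real \<times> real) \<Rightarrow> bool" where
  "regular_off_pole s2 t2 A F \<longleftrightarrow>
     (\<forall>s\<in>{0..s2}. \<forall>t\<in>A. \<forall>s'\<in>{0..s2}. \<forall>t'\<in>A.
        F (s,t) = F (s',t') \<longrightarrow> t = t' \<and> (s = s' \<or> {s,s'} = {0,s2})) \<and>
     (\<forall>s\<in>{0..s2}. \<forall>t\<in>A. F (s,t) \<noteq> (0,0)) \<and>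
     (\<forall>s\<in>{0..s2}. \<forall>t\<in>A. jacobian_det s2 t2 F s t \<noteq> 0)"

definition exchange_mat :: "nat \<Rightarrow> real mat" where
  "exchange_mat k = Matrix.mat k k (\<lambda>(r,c). if r + c + 1 = k then 1 else 0)"

definition E_bar :: "nat \<Rightarrow> real mat" where
  "E_bar ns = mat_of_cols 3
     (replicate ns (vec_of_list [1/3, 1/3, 1/3]) @
      map (\<lambda>i. mat_of_rows_list 3 [[ 1/3,           0, 1/3],
                                  [-1/6,  sqrt 3 / 6, 1/3],
                                  [-1/6, -sqrt 3 / 6, 1/3]]
                *\<^sub>v vec_of_list [cos (theta ns i), sin (theta ns i), 1]) [1..<ns+1])"

definition E_mat :: "nat \<Rightarrow> nat \<Rightarrow> real mat" where
  "E_mat ns nt = diag_block_mat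
     [E_bar ns, 1\<^sub>m (ns * (nt - 4)), exchange_mat 3 * E_bar ns * exchange_mat (2 * ns)]"

(* B_ij has one-based position i + (j-1) ns, hence zero-based position (i-1) + (j-1) ns. *)
definition tensor_vec ::
  "nat \<Rightarrow> nat \<Rightarrow> (nat \<Rightarrow> nat \<Rightarrow> real \<times> real \<Rightarrow> real) \<Rightarrow> real \<times> real \<Rightarrow> real Matrix.vec" where
  "tensor_vec ns nt B z = Matrix.vec (ns * nt) (\<lambda>q. B (q mod ns + 1) (q div ns + 1) z)"

definition polar_spline ::
  "nat \<Rightarrow> nat \<Rightarrow> (nat \<Rightarrow> nat \<Rightarrow> real \<times> real \<Rightarrow> real) \<Rightarrow> nat \<Rightarrow> real \<times> real \<Rightarrow> real" where
  "polar_spline ns nt B l z = vec_index (E_mat ns nt *\<^sub>v tensor_vec ns nt B z) (l-1)"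

definition lin_indep_funs :: "'a set \<Rightarrow> nat \<Rightarrow> (nat \<Rightarrow> 'a \<Rightarrow> real) \<Rightarrow> bool" where
  "lin_indep_funs \<Omega> n N \<longleftrightarrow>
     (\<forall>c. (\<forall>z\<in>\<Omega>. (\<Sum>l=1..n. c l * N l z) = 0) \<longrightarrow> (\<forall>l\<in>{1..n}. c l = 0))"

definition convex_partition_of_unity :: "'a set \<Rightarrow> nat \<Rightarrow> (nat \<Rightarrow> 'a \<Rightarrow> real) \<Rightarrow> bool" where
  "convex_partition_of_unity \<Omega> n N \<longleftrightarrow>
     (\<forall>z\<in>\<Omega>. (\<forall>l\<in>{1..n}. 0 \<le> N l z) \<and> (\<Sum>l=1..n. N l z) = 1)"

definition locally_supported ::
  "(real \<times> real) set \<Rightarrow> nat \<Rightarrow> nat \<Rightarrow> nat \<Rightarrow> (nat \<Rightarrow> nat \<Rightarrow> real \<times> real \<Rightarrow> real)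
     \<Rightarrow> (nat \<Rightarrow> real \<times> real \<Rightarrow> real) \<Rightarrow> bool" where
  "locally_supported \<Omega> ns nt n B N \<longleftrightarrow>
     (\<forall>l\<in>{1..n}. \<forall>z\<in>\<Omega>.
        z \<notin> \<Union> {closure (support_on \<Omega> (B i j)) | i j. i \<in> {1..ns} \<and> j \<in> {1..nt} \<and>
                  E_mat ns nt $$ (l-1, (i-1) + (j-1) * ns) \<noteq> 0} \<longrightarrow>
        N l z = 0)"

(* Tangent plane at the pole F(s,t0) = (0,0), t0 \<in> {0,t2}.  The F-image of the strip near the
   edge t = t0 is required to be a neighbourhood of the origin, so that the equation
   fpol (F (s,t)) = f (s,t) determines fpol near the origin and the limits below do not
   depend on a choice of fpol. *)
definition well_defined_tangent_plane ::
  "real \<Rightarrow> real \<Rightarrow> real \<Rightarrow> (real \<times> real \<Rightarrow> real \<times> real) \<Rightarrow> (real \<times> real \<Rightarrow> real ^ 'd) \<Rightarrow> bool" where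
  "well_defined_tangent_plane s2 t2 t0 F f \<longleftrightarrow>
     (\<exists>q. \<forall>s\<in>{0..s2}. f (s,t0) = q) \<and>
     (\<exists>\<epsilon>>0. \<exists>fpol :: real \<times> real \<Rightarrow> real ^ 'd.
        (let R = {0..s2} \<times> {t\<in>{0..t2}. \<bar>t - t0\<bar> < \<epsilon>} in
          (\<forall>\<^sub>F w in nhds (0,0). w \<in> F ` R) \<and>
          (\<forall>z\<in>R. fpol (F z) = f z)) \<and>
        (\<forall>\<^sub>F (u,v) in at (0,0).
           (\<lambda>x. fpol (x,v)) differentiable at u \<and> (\<lambda>y. fpol (u,y)) differentiable at v) \<and>
        (\<exists>L Du Dv.
           (fpol \<longlongrightarrow> L) (at (0,0)) \<and>
           ((\<lambda>(u,v). vector_derivative (\<lambda>x. fpol (x,v)) (at u)) \<longlongrightarrow> Du) (at (0,0)) \<and>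
           ((\<lambda>(u,v). vector_derivative (\<lambda>y. fpol (u,y)) (at v)) \<longlongrightarrow> Dv) (at (0,0)) \<and>
           Du \<noteq> Dv \<and> independent {Du, Dv}))"

end

theory Submission
  imports Defs
begin

text \<open>
The control point of index \<open>(i, j)\<close> of a polar map is \<open>\<rho> j\<close> times a unit vector that depends on
\<open>i\<close> only. Hence the map factors as \<open>F(s, t) = r(t) \<gamma>(s)\<close> with \<open>r = (\<Sum>j. \<rho> j * Bt j)\<close> and a closed
\<open>C\<^sup>1\<close> curve \<open>\<gamma>\<close>. Let \<open>q\<close> be the centroid of the three control points at the first pole. The first two
rows of control points of the polar surface in the tensor product basis are \<open>q\<close> and
\<open>q + L (cos (\<theta> i), sin (\<theta> i))\<close> with one linear map \<open>L\<close> (\<open>control_point_first_pole\<close>). As the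
\<open>Bs i\<close> and the \<open>Bt j\<close> each sum to 1, the surface is
\<open>f = q + (nt - 1) * L (F) + h\<close>, where \<open>h(s, t) = (\<Sum>j=3..nt. Bt j t * g j s)\<close> only uses functions
\<open>Bt j\<close> that vanish at \<open>t = 0\<close> together with their derivatives, while \<open>r\<close> vanishes with
\<open>r'(0) > 0\<close>. The partial derivatives of \<open>h\<close> in the coordinates of the plane are, by Cramer's rule,
bounded combinations of \<open>Bt j / r\<close> and \<open>Bt' j / r'\<close>, so they tend to 0 at the pole
(\<open>uniform_limit_Dh\<close>). Therefore the value and the first derivatives of the reparameterized surface
tend to \<open>q\<close> and to those of \<open>(nt - 1) * L\<close>, and \<open>L\<close> is injective because the three control points
are not collinear (\<open>pole_map_injective\<close>). The second pole is the first one after the substitution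
of \<open>t2 - t\<close> for \<open>t\<close>.

The reparameterization needs a local inverse of \<open>F\<close> and a neighbourhood of the pole in the image of
\<open>F\<close>. Injectivity and invariance of domain give the first. For the second, the cone of all positive
multiples of points of \<open>\<gamma>\<close> is both open and closed in the punctured plane, hence equal to it
(\<open>cone_eq_punctured_plane\<close>).

The univariate properties come from the Cox--de Boor recursion. The derivative formula is an
algebraic identity away from the knots. The jump of a B-spline of degree \<open>q\<close> at a knot has a closed
form that vanishes unless \<open>q + 1\<close> consecutive knots coincide (\<open>bspline_left_limit\<close>); with
multiplicities at most \<open>p - 1\<close> this makes the functions of degree \<open>p - 1\<close> continuous and those of
degree \<open>p\<close> continuously differentiable. Linear independence holds on a single knot span, by
induction on the degree via differentiation. Across a joint of two segments, the two functions that
do not vanish there get a common coefficient, namely the one for which the one-sided derivatives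
agree (\<open>joint_weight\<close>).

Linear independence, non-negativity and the partition of unity for the polar splines reduce to the
extraction matrix: its rows are independent, its entries non-negative, its column sums 1. For the
three rows at a pole this is elementary geometry, because their entries are the barycentric
coordinates of the centre and of points of the incircle of an equilateral triangle.
\<close>

section \<open>B-splines on an open knot vector\<close>

locale knot_vector =
  fixes p k :: nat and x1 x2 :: real and \<xi> :: "nat \<Rightarrow> real"
  assumes knots: "open_knot_vector p k x1 x2 \<xi>"
begin

abbreviation b :: "nat \<Rightarrow> nat \<Rightarrow> real \<Rightarrow> real" where
  "b q j \<equiv> bspline \<xi> x2 q j"

lemma degree_ge_2: "2 \<le> p" and ends_less: "x1 < x2"
  and knots_start: "1 \<le> j \<Longrightarrow> j \<le> p + 1 \<Longrightarrow> \<xi> j = x1"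
  and knots_start_less: "x1 < \<xi> (p + 2)"
  and knots_end: "k + 1 \<le> j \<Longrightarrow> j \<le> k + p + 1 \<Longrightarrow> \<xi> j = x2"
  and knots_end_less: "\<xi> k < x2"
  using knots by (auto simp: open_knot_vector_def)

lemma knots_mono: "1 \<le> i \<Longrightarrow> i \<le> j \<Longrightarrow> j \<le> k + p + 1 \<Longrightarrow> \<xi> i \<le> \<xi> j"
  using knots by (auto simp: open_knot_vector_def mono_on_def)

lemma num_ge: "p + 1 \<le> k"
proof (rule ccontr)
  assume "\<not> ?thesis"
  then have "\<xi> (k + 1) = x1" "\<xi> (k + 1) = x2"
    using knots_start[of "k + 1"] knots_end[of "k + 1"] by auto
  then show False using ends_less by simp
qed

lemma knots_in_range: "1 \<le> j \<Longrightarrow> j \<le> k + p + 1 \<Longrightarrow> x1 \<le> \<xi> j \<and> \<xi> j \<le> x2"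
  using knots_mono[of 1 j] knots_mono[of j "k+p+1"] knots_start[of 1] knots_end[of "k+p+1"] by auto

text \<open>The bound on the multiplicities in the form used below: \<open>p\<close> consecutive knots in the open interval
cannot all coincide.\<close>
lemma knots_multiplicity:
  assumes "1 \<le> j" "j + p \<le> k + p + 1" "x1 < \<xi> j" "\<xi> (j + p - 1) < x2"
  shows "\<xi> j < \<xi> (j + p - 1)"
proof (rule ccontr)
  assume "\<not> ?thesis"
  moreover have "\<xi> j \<le> \<xi> (j + p - 1)"
    using assms degree_ge_2 by (intro knots_mono) auto
  ultimately have eq: "\<xi> j = \<xi> (j + p - 1)" by simp
  have "{j..j + p - 1} \<subseteq> {l\<in>{1..k+p+1}. \<xi> l = \<xi> j}"
  proof
    fix l assume l: "l \<in> {j..j + p - 1}"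
    then have "\<xi> j \<le> \<xi> l" "\<xi> l \<le> \<xi> (j + p - 1)"
      using assms degree_ge_2 by (auto intro!: knots_mono)
    with eq l assms show "l \<in> {l\<in>{1..k+p+1}. \<xi> l = \<xi> j}" by auto
  qed
  from card_mono[OF _ this] have "p \<le> card {l\<in>{1..k+p+1}. \<xi> l = \<xi> j}"
    using degree_ge_2 by simp
  moreover have "j \<in> {p+2..k}"
  proof -
    have "p + 2 \<le> j" using knots_start[of j] assms by force
    moreover have "j \<le> k"
    proof (rule ccontr)
      assume "\<not> j \<le> k"
      then show False using knots_end[of "j + p - 1"] assms degree_ge_2 by force
    qed
    ultimately show ?thesis by simp
  qed
  then have "card {l\<in>{1..k+p+1}. \<xi> l = \<xi> j} \<le> p - 1"
    using knots by (auto simp: open_knot_vector_def)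
  ultimately show False using degree_ge_2 by linarith
qed

text \<open>Sign and support are proved together, because the sign of a summand of the recursion is known only
on the support of its factor of lower degree.\<close>
lemma bspline_support:
  assumes "1 \<le> j" "j + q \<le> k + p"
  shows "0 \<le> b q j x \<and> (b q j x \<noteq> 0 \<longrightarrow> \<xi> j \<le> x \<and> x \<le> \<xi> (j + q + 1) \<and> \<xi> j < \<xi> (j + q + 1))"
  using assms
proof (induction q arbitrary: j)
  case 0
  then show ?case by auto
next
  case (Suc q)
  have 1: "0 \<le> b q j x \<and> (b q j x \<noteq> 0 \<longrightarrow> \<xi> j \<le> x \<and> x \<le> \<xi> (j + q + 1) \<and> \<xi> j < \<xi> (j + q + 1))"
    using Suc by auto
  have 2: "0 \<le> b q (j+1) x \<and> (b q (j+1) x \<noteq> 0 \<longrightarrow>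
      \<xi> (j+1) \<le> x \<and> x \<le> \<xi> (j + q + 2) \<and> \<xi> (j+1) < \<xi> (j + q + 2))"
    using Suc.IH[of "j+1"] Suc.prems by (auto simp: numeral_2_eq_2)
  have m: "\<xi> j \<le> \<xi> (j+1)" "\<xi> (j+q+1) \<le> \<xi> (j+q+2)"
    using Suc.prems by (auto intro!: knots_mono)
  have nn1: "0 \<le> (x - \<xi> j) / (\<xi> (j+q+1) - \<xi> j) * b q j x"
    using 1 by (cases "b q j x = 0") (auto intro!: mult_nonneg_nonneg)
  have nn2: "0 \<le> (\<xi> (j+q+2) - x) / (\<xi> (j+q+2) - \<xi> (j+1)) * b q (j+1) x"
    using 2 by (cases "b q (j+1) x = 0") (auto intro!: mult_nonneg_nonneg)
  have nz: "\<xi> j \<le> x \<and> x \<le> \<xi> (j + q + 2) \<and> \<xi> j < \<xi> (j + q + 2)" if "b (Suc q) j x \<noteq> 0"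
  proof -
    from that have "b q j x \<noteq> 0 \<or> b q (j+1) x \<noteq> 0" by auto
    then show ?thesis using 1 2 m by auto
  qed
  show ?case
    using nn1 nn2 nz by (simp add: numeral_2_eq_2)
qed

lemma bspline_nonneg: "1 \<le> j \<Longrightarrow> j + q \<le> k + p \<Longrightarrow> 0 \<le> b q j x"
  using bspline_support by blast

lemma bspline_eq_0: "1 \<le> j \<Longrightarrow> j + q \<le> k + p \<Longrightarrow> x < \<xi> j \<or> \<xi> (j+q+1) < x \<or> \<xi> (j+q+1) \<le> \<xi> j \<Longrightarrow> b q j x = 0"
  using bspline_support[of j q x] by force

text \<open>The algebra of the derivative formula. With the expressions for \<open>D0\<close>, \<open>D1\<close>, \<open>B0\<close>, \<open>B1\<close> inserted, the
two sides differ only in the coefficient of \<open>a1\<close>, which is \<open>n * e1\<close> times the difference of two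
numbers that are both 1 unless \<open>e1\<close> vanishes.\<close>
lemma derivative_step:
  fixes x xj xj1 xq1 xq2 xq a0 a1 a2 D0 D1 e0 e1 e2 B0 B1 n :: real
  assumes D0: "D0 = n * (a0 * e0 - a1 * e1)"
    and D1: "D1 = n * (a1 * e1 - a2 * e2)"
    and B0: "B0 = (x - xj) * e0 * a0 + (xq1 - x) * e1 * a1"
    and B1: "B1 = (x - xj1) * e1 * a1 + (xq2 - x) * e2 * a2"
    and c: "e1 = 0 \<or> (c0 * (xq1 - xj) = 1 \<and> c1 * (xq2 - xj1) = 1)"
  shows "(x - xj) * c0 * D0 + (xq2 - x) * c1 * D1 = n * (c0 * B0 - c1 * B1)"
proof -
  have "n * (c0 * B0 - c1 * B1) - ((x - xj) * c0 * D0 + (xq2 - x) * c1 * D1)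
    = n * e1 * a1 * (c0 * (xq1 - xj) - c1 * (xq2 - xj1))"
    unfolding assms by (simp add: algebra_simps)
  also have "\<dots> = 0" using c by auto
  finally show ?thesis by simp
qed

lemma bspline_Suc:
  "b (Suc q) j y = (y - \<xi> j) * (1 / (\<xi> (j+q+1) - \<xi> j)) * b q j y +
     (\<xi> (j+q+2) - y) * (1 / (\<xi> (j+q+2) - \<xi> (j+1))) * b q (j+1) y"
  by simp

declare bspline.simps(2) [simp del]

lemma has_derivative_recursion:
  fixes f g :: "real \<Rightarrow> real"
  assumes "(f has_real_derivative D) (at x)" "(g has_real_derivative E) (at x)"
  shows "((\<lambda>y. (y - a) * c * f y + (d - y) * e * g y) has_real_derivative
    (c * f x - e * g x) + ((x - a) * c * D + (d - x) * e * E)) (at x)"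
  by (auto intro!: derivative_eq_intros assms simp: algebra_simps)

text \<open>Off the knots the functions of degree 0 are locally constant, and the product rule reduces the
induction step to \<open>derivative_step\<close>. Coinciding knots cause no exception: a quotient with zero
denominator is 0 on both sides.\<close>
lemma bspline_derivative_off_knots:
  assumes "1 \<le> j" "j + Suc q \<le> k + p" "x \<notin> \<xi> ` {1..k+p+1}"
  shows "(b (Suc q) j has_real_derivative
     Suc q * (b q j x / (\<xi> (j+q+1) - \<xi> j) - b q (j+1) x / (\<xi> (j+q+2) - \<xi> (j+1)))) (at x)"
  using assms
proof (induction q arbitrary: j)
  case 0
  have ne: "x \<noteq> \<xi> i" if "1 \<le> i" "i \<le> k + p + 1" for i using 0 that by auto
  have x2: "x \<noteq> x2" using ne[of "k+p+1"] knots_end[of "k+p+1"] by auto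
  have d: "(b 0 i has_real_derivative 0) (at x)" if i: "1 \<le> i" "i \<le> k + p" for i
  proof -
    have ev: "\<forall>\<^sub>F y in nhds x. (y < \<xi> i \<longleftrightarrow> x < \<xi> i) \<and> (y < \<xi> (i+1) \<longleftrightarrow> x < \<xi> (i+1)) \<and> y \<noteq> x2 \<and> (\<xi> i < y \<longleftrightarrow> \<xi> i < x)  \<and> (\<xi> (i+1) < y \<longleftrightarrow> \<xi> (i+1) < x)"
    proof -
      have *: "\<forall>\<^sub>F y in nhds x. (y < a \<longleftrightarrow> x < a) \<and> (a < y \<longleftrightarrow> a < x)" if "x \<noteq> a" for a
      proof (cases "x < a")
        case True
        then have "\<forall>\<^sub>F y in nhds x. y < a" by (rule order_tendstoD[OF filterlim_ident])
        then show ?thesis by eventually_elim (use True in auto)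
      next
        case False
        then have "a < x" using that by auto
        then have "\<forall>\<^sub>F y in nhds x. a < y" by (rule order_tendstoD[OF filterlim_ident])
        then show ?thesis by eventually_elim (use \<open>a < x\<close> in auto)
      qed
      have "\<forall>\<^sub>F y in nhds x. y \<noteq> x2" using x2
        by (metis (mono_tags) t1_space_nhds)
      then show ?thesis
        using *[of "\<xi> i"] *[of "\<xi> (i+1)"] ne[of i] ne[of "i+1"] i
        by (auto elim: eventually_elim2 intro: eventually_conj)
    qed
    have "\<forall>\<^sub>F y in nhds x. b 0 i y = b 0 i x"
      using ev by eventually_elim (use x2 ne[of i] ne[of "i+1"] i in auto)
    then show ?thesis
      by (subst DERIV_cong_ev[OF refl _ refl, where g="\<lambda>_. b 0 i x"]) auto
  qed
  have "b (Suc 0) j = (\<lambda>y. (y - \<xi> j) * (1 / (\<xi> (j+0+1) - \<xi> j)) * b 0 j y +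
     (\<xi> (j+0+2) - y) * (1 / (\<xi> (j+0+2) - \<xi> (j+1))) * b 0 (j+1) y)"
    using bspline_Suc[of 0 j] by (rule ext)
  then show ?case
    using has_derivative_recursion[OF d[of j] d[of "j+1"], of "\<xi> j" "1 / (\<xi> (j+0+1) - \<xi> j)"
        "\<xi> (j+0+2)" "1 / (\<xi> (j+0+2) - \<xi> (j+1))"] 0
    by simp
next
  case (Suc q)
  let ?e = "\<lambda>i. 1 / (\<xi> (i+q+1) - \<xi> i)"
  let ?c = "\<lambda>i. 1 / (\<xi> (i+q+2) - \<xi> i)"
  define D where "D i = Suc q * (b q i x * ?e i - b q (i+1) x * ?e (i+1))" for i
  have dD: "(b (Suc q) i has_real_derivative D i) (at x)" if "i = j \<or> i = j + 1" for i
    using Suc.IH[of i] Suc.prems that by (auto simp: D_def numeral_2_eq_2)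
  let ?B = "\<lambda>i. b (Suc q) i x"
  have "(x - \<xi> j) * ?c j * D j + (\<xi> (j+q+3) - x) * ?c (j+1) * D (j+1)
     = Suc q * (?c j * ?B j - ?c (j+1) * ?B (j+1))"
  proof (rule derivative_step)
    show "D j = real (Suc q) * (b q j x * ?e j - b q (j+1) x * ?e (j+1))"
      "D (j+1) = real (Suc q) * (b q (j+1) x * ?e (j+1) - b q (j+2) x * ?e (j+2))"
      by (auto simp: D_def numeral_2_eq_2)
    show "?B j = (x - \<xi> j) * ?e j * b q j x + (\<xi> (j+q+2) - x) * ?e (j+1) * b q (j+1) x"
      "?B (j+1) = (x - \<xi> (j+1)) * ?e (j+1) * b q (j+1) x + (\<xi> (j+q+3) - x) * ?e (j+2) * b q (j+2) x"
      using bspline_Suc[of q j x] bspline_Suc[of q "j+1" x] by (simp_all add: numeral_2_eq_2 numeral_3_eq_3)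
    show "?e (j+1) = 0 \<or> ?c j * (\<xi> (j+q+2) - \<xi> j) = 1 \<and> ?c (j+1) * (\<xi> (j+q+3) - \<xi> (j+1)) = 1"
    proof (cases "\<xi> (j+q+2) = \<xi> (j+1)")
      case False
      moreover have "\<xi> j \<le> \<xi> (j+1)" "\<xi> (j+1) \<le> \<xi> (j+q+2)" "\<xi> (j+q+2) \<le> \<xi> (j+q+3)"
        using Suc.prems by (auto intro!: knots_mono)
      ultimately show ?thesis by (simp add: numeral_2_eq_2 numeral_3_eq_3)
    qed (simp add: numeral_2_eq_2)
  qed
  then have "(?c j * ?B j - ?c (j+1) * ?B (j+1)) +
      ((x - \<xi> j) * ?c j * D j + (\<xi> (j+q+3) - x) * ?c (j+1) * D (j+1))
    = real (Suc (Suc q)) * (?B j / (\<xi> (j + Suc q + 1) - \<xi> j)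
        - ?B (j+1) / (\<xi> (j + Suc q + 2) - \<xi> (j+1)))"
    by (simp add: distrib_right numeral_2_eq_2)
  moreover have "b (Suc (Suc q)) j = (\<lambda>y. (y - \<xi> j) * ?c j * b (Suc q) j y +
     (\<xi> (j+q+3) - y) * ?c (j+1) * b (Suc q) (j+1) y)"
    using bspline_Suc[of "Suc q" j] by (auto simp: numeral_2_eq_2 numeral_3_eq_3)
  moreover note has_derivative_recursion[OF dD[of j] dD[of "j+1"], of "\<xi> j" "?c j"
        "\<xi> (j+q+3)" "?c (j+1)"]
  ultimately show ?case by simp
qed

end

text \<open>The fundamental theorem of calculus tolerates finitely many exceptional points, so \<open>f\<close> is an
antiderivative of the continuous function \<open>g\<close>. This takes care of the knots, and later of the joints
between segments.\<close>
lemma C1_of_finite_exceptions: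
  fixes f g :: "real \<Rightarrow> real"
  assumes "finite S" and cf: "continuous_on {a..b} f" and cg: "continuous_on {a..b} g"
    and d: "\<And>x. x \<in> {a<..<b} - S \<Longrightarrow> (f has_real_derivative g x) (at x)"
    and x: "x \<in> {a..b}"
  shows "(f has_real_derivative g x) (at x within {a..b})"
proof -
  have int: "f u = f a + integral {a..u} g" if "u \<in> {a..b}" for u
  proof -
    have "(g has_integral (f u - f a)) {a..u}"
    proof (rule fundamental_theorem_of_calculus_interior_strong[OF \<open>finite S\<close>])
      show "continuous_on {a..u} f" using cf by (rule continuous_on_subset) (use that in auto)
      show "(f has_vector_derivative g y) (at y)" if "y \<in> {a<..<u} - S" for y
        using d[of y] that \<open>u \<in> {a..b}\<close> by (auto simp: has_real_derivative_iff_has_vector_derivative)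
    qed (use that in auto)
    then show ?thesis by (simp add: integral_unique)
  qed
  have "((\<lambda>u. integral {a..u} g) has_real_derivative g x) (at x within {a..b})"
    using integral_has_vector_derivative[OF cg x] by (simp add: has_real_derivative_iff_has_vector_derivative)
  then have "((\<lambda>u. f a + integral {a..u} g) has_real_derivative g x) (at x within {a..b})"
    by (auto intro!: derivative_eq_intros)
  then show ?thesis
    unfolding has_field_derivative_def by (rule has_derivative_transform[OF x int, rotated])
qed

lemma eventually_at_left_knot:
  fixes a x0 :: real
  shows "\<forall>\<^sub>F y in at_left x0. (a \<le> y \<longleftrightarrow> a < x0) \<and> (y < a \<longleftrightarrow> x0 \<le> a) \<and> y < x0"
proof (cases "a < x0")
  case True
  then have "\<forall>\<^sub>F y in at_left x0. y \<in> {a<..<x0}" by (rule eventually_at_left_real)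
  then show ?thesis by eventually_elim (use True in auto)
next
  case False
  have "\<forall>\<^sub>F y in at_left x0. y \<in> {x0 - 1<..<x0}" by (rule eventually_at_left_real) simp
  then show ?thesis by eventually_elim (use False in auto)
qed

lemma eventually_at_right_knot:
  fixes a x0 :: real
  shows "\<forall>\<^sub>F y in at_right x0. (a \<le> y \<longleftrightarrow> a \<le> x0) \<and> (y < a \<longleftrightarrow> x0 < a) \<and> x0 < y"
proof (cases "x0 < a")
  case True
  then have "\<forall>\<^sub>F y in at_right x0. y \<in> {x0<..<a}" by (rule eventually_at_right_real)
  then show ?thesis by eventually_elim (use True in auto)
next
  case False
  have "\<forall>\<^sub>F y in at_right x0. y \<in> {x0<..<x0 + 1}" by (rule eventually_at_right_real) simp
  then show ?thesis by eventually_elim (use False in auto)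
qed

lemma summation_by_parts:
  fixes c u :: "nat \<Rightarrow> real"
  assumes "a \<le> m"
  shows "(\<Sum>j=a..m. c j * (u j - u (Suc j)))
    = c a * u a - c m * u (Suc m) + (\<Sum>j=Suc a..m. (c j - c (j - 1)) * u j)"
  using assms
proof (induction m rule: dec_induct)
  case base
  then show ?case by (simp add: algebra_simps)
next
  case (step m)
  then show ?case by (simp add: sum.nat_ivl_Suc' algebra_simps)
qed

lemma tendsto_recursion:
  fixes f g :: "real \<Rightarrow> real"
  assumes "(f \<longlongrightarrow> A) (at x within S)" "(g \<longlongrightarrow> B) (at x within S)"
  shows "((\<lambda>y. (y - a) * c * f y + (d - y) * e * g y) \<longlongrightarrow> (x - a) * c * A + (d - x) * e * B) (at x within S)"
  by (intro tendsto_intros assms)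

context knot_vector
begin

lemma bspline_right_continuous:
  assumes "x0 < x2"
  shows "(b q j \<longlongrightarrow> b q j x0) (at_right x0)"
proof (induction q arbitrary: j)
  case 0
  have "\<forall>\<^sub>F y in at_right x0. b 0 j y = b 0 j x0"
    using eventually_at_right_knot[of "\<xi> j" x0] eventually_at_right_knot[of "\<xi> (j+1)" x0]
      eventually_at_right_knot[of x2 x0]
    by eventually_elim (use assms in auto)
  then show ?case by (rule tendsto_eventually)
next
  case (Suc q)
  show ?case unfolding bspline_Suc by (intro tendsto_recursion Suc.IH)
qed

text \<open>In degree 0 this is the purpose of the closed last knot span in the definition; the recursion then
preserves the limit.\<close>
lemma bspline_left_continuous_at_end:
  assumes "1 \<le> j" "j + q \<le> k + p"
  shows "(b q j \<longlongrightarrow> b q j x2) (at_left x2)"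
  using assms
proof (induction q arbitrary: j)
  case 0
  have r: "\<xi> j \<le> x2" "\<xi> (j+1) \<le> x2" using knots_in_range 0 by auto
  have "\<forall>\<^sub>F y in at_left x2. b 0 j y = b 0 j x2"
    using eventually_at_left_knot[of "\<xi> j" x2] eventually_at_left_knot[of "\<xi> (j+1)" x2]
    by eventually_elim (use r in auto)
  then show ?case by (rule tendsto_eventually)
next
  case (Suc q)
  show ?case unfolding bspline_Suc by (intro tendsto_recursion Suc.IH) (use Suc.prems in auto)
qed

text \<open>The value minus the left limit of \<open>b q j\<close> at \<open>x\<close>. Each of the two terms requires \<open>q + 1\<close> consecutive
knots to coincide with \<open>x\<close>.\<close>
definition jump :: "nat \<Rightarrow> nat \<Rightarrow> real \<Rightarrow> real" where
  "jump q j x = of_bool (\<xi> j = x \<and> \<xi> (j+q) = x \<and> x < \<xi> (j+q+1))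
              - of_bool (\<xi> j < x \<and> \<xi> (j+1) = x \<and> \<xi> (j+q+1) = x)"

text \<open>The closed form of the jump satisfies the recursion of the B-splines at \<open>x0\<close>: whenever a lower-degree
jump is non-zero, its linear factor either vanishes at \<open>x0\<close> or is equal to the knot difference by
which it is divided.\<close>
lemma bspline_left_limit:
  assumes "1 \<le> j" "j + q \<le> k + p" "x0 < x2"
  shows "(b q j \<longlongrightarrow> b q j x0 - jump q j x0) (at_left x0)"
  using assms
proof (induction q arbitrary: j)
  case 0
  have r: "\<xi> j \<le> \<xi> (j+1)" using 0 by (intro knots_mono) auto
  have "\<forall>\<^sub>F y in at_left x0. b 0 j y = b 0 j x0 - jump 0 j x0"
    using eventually_at_left_knot[of "\<xi> j" x0] eventually_at_left_knot[of "\<xi> (j+1)" x0]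
    by eventually_elim (use r 0 in \<open>auto simp: jump_def\<close>)
  then show ?case by (rule tendsto_eventually)
next
  case (Suc q)
  let ?e = "\<lambda>i. 1 / (\<xi> (i+q+1) - \<xi> i)"
  have "(b (Suc q) j \<longlongrightarrow> (x0 - \<xi> j) * ?e j * (b q j x0 - jump q j x0) +
      (\<xi> (j+q+2) - x0) * (1 / (\<xi> (j+q+2) - \<xi> (j+1))) * (b q (j+1) x0 - jump q (j+1) x0)) (at_left x0)"
    unfolding bspline_Suc by (intro tendsto_recursion Suc.IH) (use Suc.prems in auto)
  moreover have "jump (Suc q) j x0 = (x0 - \<xi> j) * ?e j * jump q j x0 +
      (\<xi> (j+q+2) - x0) * (1 / (\<xi> (j+q+2) - \<xi> (j+1))) * jump q (j+1) x0"
  proof -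
    have "\<xi> j \<le> \<xi> (j+1)" "\<xi> (j+1) \<le> \<xi> (j+q+1)" "\<xi> (j+q+1) \<le> \<xi> (j+q+2)"
      using Suc.prems by (auto intro!: knots_mono)
    then show ?thesis
      by (auto simp: jump_def of_bool_def numeral_2_eq_2) (simp_all add: field_simps)
  qed
  moreover have "A * (B - J) + C * (B' - J') = (A * B + C * B') - (A * J + C * J')" for A B C B' J J' :: real
    by (simp add: algebra_simps)
  ultimately show ?case unfolding bspline_Suc[of q j x0] by (simp only:)
qed

text \<open>A jump in degree at least \<open>p - 1\<close> would need \<open>p\<close> coinciding interior knots.\<close>
lemma jump_eq_0:
  assumes "1 \<le> j" "j + q \<le> k + p" "p - 1 \<le> q" "x1 < x0" "x0 < x2"
  shows "jump q j x0 = 0"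
proof -
  have p: "2 \<le> p" by (rule degree_ge_2)
  have "\<not> (\<xi> j = x0 \<and> \<xi> (j+q) = x0)"
  proof
    assume *: "\<xi> j = x0 \<and> \<xi> (j+q) = x0"
    have "\<xi> (j + p - 1) \<le> \<xi> (j + q)" using assms p by (intro knots_mono) auto
    then have "\<xi> j < \<xi> (j + p - 1)" using assms p * by (intro knots_multiplicity) auto
    with * \<open>\<xi> (j + p - 1) \<le> \<xi> (j + q)\<close> show False by simp
  qed
  moreover have "\<not> (\<xi> j < x0 \<and> \<xi> (j+1) = x0 \<and> \<xi> (j+q+1) = x0)"
  proof
    assume *: "\<xi> j < x0 \<and> \<xi> (j+1) = x0 \<and> \<xi> (j+q+1) = x0"
    have "j \<le> k" using * knots_end[of j] assms p by force
    have "\<xi> (j + 1 + p - 1) \<le> \<xi> (j + q + 1)" using assms p by (intro knots_mono) auto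
    then have "\<xi> (j+1) < \<xi> (j + 1 + p - 1)" using assms p * \<open>j \<le> k\<close> by (intro knots_multiplicity) auto
    with * \<open>\<xi> (j + 1 + p - 1) \<le> \<xi> (j + q + 1)\<close> show False by simp
  qed
  ultimately show ?thesis by (auto simp: jump_def)
qed

lemma bspline_continuous:
  assumes "1 \<le> j" "j + q \<le> k + p" "p - 1 \<le> q"
  shows "continuous_on {x1..x2} (b q j)"
  unfolding continuous_on_def
proof
  fix x0 assume x0: "x0 \<in> {x1..x2}"
  consider "x0 = x1" | "x0 = x2" | "x1 < x0" "x0 < x2" using x0 by force
  then show "(b q j \<longlongrightarrow> b q j x0) (at x0 within {x1..x2})"
  proof cases
    case 1
    then show ?thesis using bspline_right_continuous[of x0 q j] ends_less
      by (simp add: at_within_Icc_at_right)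
  next
    case 2
    then show ?thesis using bspline_left_continuous_at_end[of j q] assms ends_less
      by (simp add: at_within_Icc_at_left)
  next
    case 3
    then have "(b q j \<longlongrightarrow> b q j x0) (at x0)"
      using bspline_right_continuous[of x0 q j] bspline_left_limit[of j q x0] jump_eq_0[of j q x0] assms
      by (intro filterlim_split_at) auto
    then show ?thesis using tendsto_within_subset by blast
  qed
qed

text \<open>The derivative of \<open>b p j\<close> as a combination of B-splines of degree \<open>p - 1\<close>.\<close>
definition b' :: "nat \<Rightarrow> real \<Rightarrow> real" where
  "b' j x = p * (b (p-1) j x / (\<xi> (j+p) - \<xi> j) - b (p-1) (j+1) x / (\<xi> (j+p+1) - \<xi> (j+1)))"

lemma bspline_deriv_continuous:
  assumes "1 \<le> j" "j \<le> k"
  shows "continuous_on {x1..x2} (b' j)"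
proof -
  have "continuous_on {x1..x2} (b (p-1) j)" "continuous_on {x1..x2} (b (p-1) (j+1))"
    using assms degree_ge_2 by (auto intro!: bspline_continuous)
  then have "continuous_on {x1..x2} (\<lambda>x. p * (b (p-1) j x * (1 / (\<xi> (j+p) - \<xi> j)) - b (p-1) (j+1) x * (1 / (\<xi> (j+p+1) - \<xi> (j+1)))))"
    by (intro continuous_intros)
  then show ?thesis unfolding b'_def[abs_def] by simp
qed

lemma bspline_has_derivative:
  assumes "1 \<le> j" "j \<le> k" "x \<in> {x1..x2}"
  shows "(b p j has_real_derivative b' j x) (at x within {x1..x2})"
proof (rule C1_of_finite_exceptions)
  show "finite (\<xi> ` {1..k+p+1})" by simp
  show "continuous_on {x1..x2} (b p j)" using assms by (intro bspline_continuous) auto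
  show "continuous_on {x1..x2} (b' j)" using assms by (intro bspline_deriv_continuous) auto
  fix y assume y: "y \<in> {x1<..<x2} - \<xi> ` {1..k+p+1}"
  have p: "Suc (p - 1) = p" "j + (p - 1) + 1 = j + p" "j + (p - 1) + 2 = j + p + 1"
    using degree_ge_2 by auto
  show "(b p j has_real_derivative b' j y) (at y)"
    using bspline_derivative_off_knots[of j "p - 1" y] y assms unfolding p b'_def by simp
qed (use assms in auto)

text \<open>At the left end only the function whose support starts with exactly \<open>q + 1\<close> copies of \<open>x1\<close>, that is
the one of index \<open>p + 1 - q\<close>, survives the recursion.\<close>
lemma bspline_at_start:
  assumes "1 \<le> j" "j + q \<le> k + p" "q \<le> p"
  shows "b q j x1 = of_bool (j + q = p + 1)"
  using assms
proof (induction q arbitrary: j)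
  case 0
  have "\<xi> j \<le> x1 \<longleftrightarrow> j \<le> p + 1"
    using knots_start[of j] knots_start_less knots_mono[of "p+2" j] 0 num_ge by (cases "j \<le> p + 1") auto
  moreover have "x1 < \<xi> (j+1) \<longleftrightarrow> p + 1 \<le> j"
    using knots_start[of "j+1"] knots_start_less knots_mono[of "p+2" "j+1"] 0 num_ge by (cases "j + 1 \<le> p + 1") auto
  ultimately show ?case using ends_less by auto
next
  case (Suc q)
  have 1: "(x1 - \<xi> j) * b q j x1 = 0"
    using Suc.IH[of j] Suc.prems knots_start[of j] by auto
  have 2: "b q (j+1) x1 = of_bool (j + Suc q = p + 1)"
    using Suc.IH[of "j+1"] Suc.prems by auto
  show ?case
  proof (cases "j + Suc q = p + 1")
    case True
    then have "\<xi> (j+1) = x1" "\<xi> (j+q+2) = \<xi> (p+2)" using Suc.prems knots_start[of "j+1"] by auto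
    then show ?thesis using 1 2 True knots_start_less unfolding bspline_Suc by simp
  next
    case False
    then show ?thesis using 1 2 unfolding bspline_Suc by simp
  qed
qed

lemma bspline_at_end:
  assumes "1 \<le> j" "j + q \<le> k + p" "q \<le> p"
  shows "b q j x2 = of_bool (j = k)"
  using assms
proof (induction q arbitrary: j)
  case 0
  have "\<xi> j < x2 \<longleftrightarrow> j \<le> k"
    using knots_end[of j] knots_end_less knots_mono[of j k] 0 by (cases "j \<le> k") auto
  moreover have "\<xi> (j+1) = x2 \<longleftrightarrow> k \<le> j"
    using knots_end[of "j+1"] knots_end_less knots_mono[of "j+1" k] 0 by (cases "k \<le> j") auto
  moreover have "\<xi> (j+1) \<le> x2" using knots_in_range[of "j+1"] 0 by auto
  ultimately show ?case by auto
next
  case (Suc q)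
  have 1: "(\<xi> (j+q+2) - x2) * b q (j+1) x2 = 0"
    using Suc.IH[of "j+1"] Suc.prems knots_end[of "j+q+2"] by auto
  have 2: "b q j x2 = of_bool (j = k)"
    using Suc.IH[of j] Suc.prems by auto
  show ?case
  proof (cases "j = k")
    case True
    then have "\<xi> (j+q+1) = x2" using Suc.prems knots_end[of "j+q+1"] by auto
    then show ?thesis using 1 2 True knots_end_less unfolding bspline_Suc by simp
  next
    case False
    then show ?thesis using 1 2 unfolding bspline_Suc by simp
  qed
qed

lemma bspline_deriv_at_start:
  assumes "1 \<le> j" "j \<le> k"
  shows "b' j x1 = p / (\<xi> (p+2) - x1) * (of_bool (j = 2) - of_bool (j = 1))"
proof -
  have "b (p-1) j x1 = of_bool (j = 2)" "b (p-1) (j+1) x1 = of_bool (j = 1)"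
    using assms degree_ge_2 by (subst bspline_at_start; auto)+
  moreover have "\<xi> 2 = x1" using degree_ge_2 by (intro knots_start) auto
  ultimately show ?thesis by (auto simp: b'_def add.commute numeral_2_eq_2)
qed

lemma bspline_deriv_at_end:
  assumes "1 \<le> j" "j \<le> k"
  shows "b' j x2 = p / (x2 - \<xi> k) * (of_bool (j = k) - of_bool (j + 1 = k))"
proof -
  have "b (p-1) j x2 = of_bool (j = k)" "b (p-1) (j+1) x2 = of_bool (j + 1 = k)"
    using assms degree_ge_2 by (subst bspline_at_end; auto)+
  moreover have "\<xi> (k + p) = x2" using degree_ge_2 by (intro knots_end) auto
  ultimately show ?thesis by (auto simp: b'_def)
qed

text \<open>The sum of the derivatives telescopes to two terms with coinciding knots, which are 0, so the sum of
the B-splines is constant; its value is read off at the left end.\<close>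
lemma bspline_partition_of_unity:
  assumes "x \<in> {x1..x2}"
  shows "(\<Sum>j=1..k. b p j x) = 1"
proof -
  have "((\<lambda>x. \<Sum>j=1..k. b p j x) has_real_derivative 0) (at y within {x1..x2})" if y: "y \<in> {x1..x2}" for y
  proof -
    have "((\<lambda>x. \<Sum>j=1..k. b p j x) has_real_derivative (\<Sum>j=1..k. b' j y)) (at y within {x1..x2})"
      using y by (intro DERIV_sum bspline_has_derivative) auto
    moreover have "(\<Sum>j=1..k. b' j y) = 0"
    proof -
      define u where "u j = b (p-1) j y / (\<xi> (j+p) - \<xi> j)" for j
      have "(\<Sum>j=1..k. b' j y) = p * (\<Sum>j=1..k. u j - u (Suc j))"
        by (simp add: b'_def u_def sum_distrib_left)
      also have "(\<Sum>j=1..k. u j - u (Suc j)) = u 1 - u (Suc k)"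
        using sum_Suc_diff[of 1 k "\<lambda>j. - u j"] num_ge by simp
      also have "u 1 = 0" using knots_start[of 1] knots_start[of "p+1"] by (simp add: u_def)
      also have "u (Suc k) = 0" using knots_end[of "k+1"] knots_end[of "k+p+1"] by (simp add: u_def)
      finally show ?thesis by simp
    qed
    ultimately show ?thesis by simp
  qed
  then obtain c where c: "\<And>y. y \<in> {x1..x2} \<Longrightarrow> (\<Sum>j=1..k. b p j y) = c"
    using has_field_derivative_zero_constant[of "{x1..x2}" "\<lambda>x. \<Sum>j=1..k. b p j x"] by auto
  have "(\<Sum>j=1..k. b p j x1) = (\<Sum>j=1..k. of_bool (j = 1))"
    by (intro sum.cong) (auto simp: bspline_at_start)
  also have "\<dots> = 1" using num_ge by (simp add: of_bool_def)
  finally show ?thesis using c[of x1] c[of x] assms ends_less by simp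
qed

lemma bspline_pos_on_span:
  assumes "p + 1 \<le> m" "m \<le> k" "\<xi> m < x" "x < \<xi> (m+1)" "q \<le> p"
  shows "0 < b q m x"
  using assms(5)
proof (induction q)
  case 0
  then show ?case using assms by simp
next
  case (Suc q)
  have m: "\<xi> (m+1) \<le> \<xi> (m+q+1)" "\<xi> (m+1) \<le> \<xi> (m+q+2)" using assms Suc.prems by (auto intro!: knots_mono)
  have "0 < (x - \<xi> m) * (1 / (\<xi> (m+q+1) - \<xi> m)) * b q m x"
    using Suc m assms by (intro mult_pos_pos) auto
  moreover have "0 \<le> (\<xi> (m+q+2) - x) * (1 / (\<xi> (m+q+2) - \<xi> (m+1))) * b q (m+1) x"
    using Suc m assms bspline_nonneg[of "m+1" q x] by (intro mult_nonneg_nonneg) auto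
  ultimately show ?case unfolding bspline_Suc by linarith
qed

lemma no_knots_in_span:
  assumes "1 \<le> m" "m \<le> k" "\<xi> m < x" "x < \<xi> (m+1)"
  shows "x \<notin> \<xi> ` {1..k+p+1}"
proof
  assume "x \<in> \<xi> ` {1..k+p+1}"
  then obtain i where i: "1 \<le> i" "i \<le> k + p + 1" "x = \<xi> i" by auto
  show False
  proof (cases "i \<le> m")
    case True
    then show False using knots_mono[of i m] i assms by auto
  next
    case False
    then show False using knots_mono[of "m+1" i] i assms by auto
  qed
qed

text \<open>The derivative of a vanishing combination is, after summation by parts, a vanishing combination of
lower degree whose coefficients are multiples of differences of neighbouring \<open>c j\<close>. So all the
\<open>c j\<close> agree, and they vanish because the sum of the B-splines is positive on the span.\<close>
lemma bspline_locally_independent: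
  assumes m: "p + 1 \<le> m" "m \<le> k" "\<xi> m < \<xi> (m+1)" and "q \<le> p"
    and "\<And>x. \<xi> m < x \<Longrightarrow> x < \<xi> (m+1) \<Longrightarrow> (\<Sum>j=m-q..m. c j * b q j x) = 0"
    and "j \<in> {m-q..m}"
  shows "c j = 0"
  using assms(4-)
proof (induction q arbitrary: c j)
  case 0
  obtain x where "\<xi> m < x" "x < \<xi> (m+1)" using dense m by blast
  with 0(2)[of x] 0(3) show ?case by simp
next
  case (Suc q)
  define a where "a = m - Suc q"
  have a: "1 \<le> a" "a \<le> m" "Suc a = m - q" "a + Suc q = m" using Suc.prems m by (auto simp: a_def)
  have "(c i - c (i-1)) / (\<xi> (i+q+1) - \<xi> i) = 0" if "i \<in> {m-q..m}" for i
  proof (rule Suc.IH[where c = "\<lambda>i. (c i - c (i-1)) / (\<xi> (i+q+1) - \<xi> i)"])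
    fix x assume x: "\<xi> m < x" "x < \<xi> (m+1)"
    define u where "u j = b q j x / (\<xi> (j+q+1) - \<xi> j)" for j
    have "((\<lambda>y. \<Sum>j=a..m. c j * b (Suc q) j y) has_real_derivative
        (\<Sum>j=a..m. c j * (Suc q * (u j - u (Suc j))))) (at x)"
    proof (intro DERIV_sum DERIV_cmult)
      fix j assume "j \<in> {a..m}"
      then show "(b (Suc q) j has_real_derivative Suc q * (u j - u (Suc j))) (at x)"
        using bspline_derivative_off_knots[of j q x] no_knots_in_span[of m x] x m a Suc.prems
        by (simp add: u_def)
    qed
    moreover have "((\<lambda>y. \<Sum>j=a..m. c j * b (Suc q) j y) has_real_derivative 0) (at x)"
    proof (rule has_field_derivative_transform_within_open[of "\<lambda>_. 0"])
      show "open {\<xi> m<..<\<xi> (m+1)}" by simp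
    qed (use Suc.prems(2) x in \<open>auto simp: a_def\<close>)
    ultimately have "(\<Sum>j=a..m. c j * (Suc q * (u j - u (Suc j)))) = 0" by (rule DERIV_unique)
    then have "Suc q * (\<Sum>j=a..m. c j * (u j - u (Suc j))) = 0"
      unfolding sum_distrib_left by (simp add: algebra_simps)
    then have "(\<Sum>j=a..m. c j * (u j - u (Suc j))) = 0" by simp
    moreover have "u a = 0" using x a m Suc.prems by (auto simp: u_def intro!: bspline_eq_0)
    moreover have "u (Suc m) = 0" using x a m Suc.prems bspline_eq_0[of "Suc m" q x] by (auto simp: u_def)
    ultimately have "(\<Sum>j=Suc a..m. (c j - c (j - 1)) * u j) = 0"
      using summation_by_parts[OF a(2), of c u] by simp
    then show "(\<Sum>j=m-q..m. (c j - c (j-1)) / (\<xi> (j+q+1) - \<xi> j) * b q j x) = 0"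
      unfolding a(3) u_def by simp
  qed (use Suc.prems that in auto)
  moreover have "\<xi> i < \<xi> (i+q+1)" if "i \<in> {m-q..m}" for i
  proof -
    have "1 \<le> i" "i \<le> m" "m + 1 \<le> i + q + 1" "i + q + 1 \<le> k + p + 1"
      using that m Suc.prems by auto
    then show ?thesis using knots_mono[of i m] knots_mono[of "m+1" "i+q+1"] m by auto
  qed
  ultimately have eq: "c i = c (i-1)" if "i \<in> {m-q..m}" for i using that by force
  have const: "c (a + i) = c a" if "a + i \<le> m" for i
    using that by (induction i) (use eq a in auto)
  obtain x where x: "\<xi> m < x" "x < \<xi> (m+1)" using dense m by blast
  have "0 = (\<Sum>j=a..m. c j * b (Suc q) j x)" using Suc.prems(2)[of x] x by (simp add: a_def)
  also have "\<dots> = (\<Sum>j=a..m. c a * b (Suc q) j x)"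
    by (intro sum.cong refl) (metis atLeastAtMost_iff const le_add_diff_inverse)
  also have "\<dots> = c a * (\<Sum>j=a..m. b (Suc q) j x)" by (simp add: sum_distrib_left)
  finally have "c a * (\<Sum>j=a..m. b (Suc q) j x) = 0" by simp
  moreover have "0 < (\<Sum>j=a..m. b (Suc q) j x)"
    using a m Suc.prems x by (intro sum_pos2[of _ m] bspline_pos_on_span bspline_nonneg) auto
  ultimately have "c a = 0" by simp
  then show ?case using const[of "j - a"] Suc.prems(3) by (auto simp: a_def)
qed

lemma nondegenerate_span_below:
  assumes "a < e" "\<xi> a < \<xi> e"
  shows "\<exists>m. a \<le> m \<and> m < e \<and> \<xi> m < \<xi> (m+1)"
proof (rule ccontr)
  assume *: "\<not> ?thesis"
  have "\<xi> (a + i) \<le> \<xi> a" if "a + i \<le> e" for i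
    using that
  proof (induction i)
    case (Suc i)
    then have "\<xi> (a + i + 1) \<le> \<xi> (a + i)" using * Suc.prems
      by (metis add_Suc_right le_add1 not_le_imp_less not_less_eq_eq)
    with Suc show ?case by simp
  qed simp
  from this[of "e - a"] assms show False by simp
qed

text \<open>Every B-spline has a nondegenerate knot span in its support, and on that span local independence
applies.\<close>
lemma bspline_independent:
  assumes "\<And>x. x1 < x \<Longrightarrow> x < x2 \<Longrightarrow> (\<Sum>j=1..k. c j * b p j x) = 0" and j: "1 \<le> j" "j \<le> k"
  shows "c j = 0"
proof -
  \<comment> \<open>Indices \<open>m\<close> with \<open>a \<le> m < e\<close> are those of the knot spans in the support of \<open>b p j\<close> that lie in the interval.\<close>
  define a where "a = max j (p+1)"
  define e where "e = min (j+p+1) (k+1)"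
  have p: "2 \<le> p" "p + 1 \<le> k" using degree_ge_2 num_ge by auto
  have ae: "a < e" using j p by (auto simp: a_def e_def)
  have "\<xi> a < \<xi> e"
  proof (cases "j \<le> p + 1")
    case True
    have "\<xi> (p+2) \<le> \<xi> e" using j p by (intro knots_mono) (auto simp: e_def)
    moreover have "\<xi> a = x1" using True knots_start[of a] by (simp add: a_def max_def)
    ultimately show ?thesis using knots_start_less by simp
  next
    case False
    then have a: "a = j" by (simp add: a_def)
    show ?thesis
    proof (cases "k \<le> j + p")
      case True
      then have "\<xi> e = x2" using knots_end[of e] by (simp add: e_def)
      then show ?thesis using knots_end_less knots_mono[of j k] j a by simp
    next
      case F: False
      then have e: "e = j + p + 1" by (simp add: e_def)
      have "\<xi> (p+2) \<le> \<xi> j" using False j by (intro knots_mono) auto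
      moreover have "\<xi> (j+p-1) \<le> \<xi> k" using F j p by (intro knots_mono) auto
      ultimately have "\<xi> j < \<xi> (j+p-1)"
        using F j p knots_start_less knots_end_less by (intro knots_multiplicity) auto
      also have "\<dots> \<le> \<xi> e" unfolding e using F j p by (intro knots_mono) auto
      finally show ?thesis using a by simp
    qed
  qed
  from nondegenerate_span_below[OF ae this] obtain m where m: "a \<le> m" "m < e" "\<xi> m < \<xi> (m+1)" by blast
  then have m': "p + 1 \<le> m" "m \<le> k" "j \<in> {m-p..m}" by (auto simp: a_def e_def)
  show ?thesis
  proof (rule bspline_locally_independent[OF m'(1,2) m(3), of p c])
    fix x assume x: "\<xi> m < x" "x < \<xi> (m+1)"
    have "(\<Sum>j=m-p..m. c j * b p j x) = (\<Sum>j=1..k. c j * b p j x)"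
    proof (rule sum.mono_neutral_left)
      show "\<forall>i\<in>{1..k} - {m - p..m}. c i * b p i x = 0"
      proof
        fix i assume i: "i \<in> {1..k} - {m - p..m}"
        have "x < \<xi> i \<or> \<xi> (i+p+1) < x"
        proof (cases "i < m - p")
          case True
          then have "i + p + 1 \<le> m" by arith
          then show ?thesis using x knots_mono[of "i+p+1" m] i m' by auto
        next
          case False
          then show ?thesis using x knots_mono[of "m+1" i] i m' by auto
        qed
        then show "c i * b p i x = 0" using bspline_eq_0[of i p x] i by auto
      qed
    qed (use m' in auto)
    also have "\<dots> = 0"
      using knots_in_range[of m] knots_in_range[of "m+1"] m' x by (intro assms) auto
    finally show "(\<Sum>j=m-p..m. c j * b p j x) = 0" .
  qed (use m' in auto)
qed

end

section \<open>Rational B-splines on one segment\<close>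

text \<open>The derivative of the second rational B-spline at the left end of the segment. It is the number
\<open>beta\<close> of the joint at this end.\<close>
definition start_slope :: "segment \<Rightarrow> real" where
  "start_slope \<sigma> = deg \<sigma> / (knot \<sigma> (deg \<sigma> + 2) - lo \<sigma>) * (weight \<sigma> 2 / weight \<sigma> 1)"

text \<open>The derivative of the last rational B-spline at the right end of the segment. It is the number
\<open>alpha\<close> of the joint at this end.\<close>
definition end_slope :: "segment \<Rightarrow> real" where
  "end_slope \<sigma> = deg \<sigma> / (hi \<sigma> - knot \<sigma> (num \<sigma>)) * (weight \<sigma> (num \<sigma> - 1) / weight \<sigma> (num \<sigma>))"

lemma sum_of_bool_mult:
  "finite A \<Longrightarrow> n \<in> A \<Longrightarrow> (\<Sum>j\<in>A. h j * of_bool (j = n)) = (h n :: real)"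
  by (simp add: of_bool_def if_distrib cong: if_cong)

locale rational_segment =
  fixes \<sigma> :: segment
  assumes valid: "valid_segment \<sigma>"
begin

sublocale knot_vector "deg \<sigma>" "num \<sigma>" "lo \<sigma>" "hi \<sigma>" "knot \<sigma>"
  using valid by unfold_locales (simp add: valid_segment_def)

lemma weight_pos: "1 \<le> j \<Longrightarrow> j \<le> num \<sigma> \<Longrightarrow> 0 < weight \<sigma> j"
  using valid by (simp add: valid_segment_def)

lemma num_ge_3: "3 \<le> num \<sigma>"
  using num_ge degree_ge_2 by simp

abbreviation "bj j \<equiv> b (deg \<sigma>) j"

definition W :: "real \<Rightarrow> real" where
  "W x = (\<Sum>i=1..num \<sigma>. weight \<sigma> i * bj i x)"

definition W' :: "real \<Rightarrow> real" where
  "W' x = (\<Sum>i=1..num \<sigma>. weight \<sigma> i * b' i x)"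

definition nurbs' :: "nat \<Rightarrow> real \<Rightarrow> real" where
  "nurbs' j x = weight \<sigma> j * (b' j x * W x - bj j x * W' x) / (W x * W x)"

lemma nurbs_W: "nurbs \<sigma> j x = weight \<sigma> j * bj j x / W x"
  by (simp add: nurbs_def W_def)

lemma W_pos:
  assumes "x \<in> {lo \<sigma>..hi \<sigma>}"
  shows "0 < W x"
proof -
  have nn: "0 \<le> weight \<sigma> i * bj i x" if "i \<in> {1..num \<sigma>}" for i
    using that weight_pos[of i] bspline_nonneg[of i "deg \<sigma>" x] by auto
  have "W x \<noteq> 0"
  proof
    assume "W x = 0"
    then have "\<forall>i\<in>{1..num \<sigma>}. weight \<sigma> i * bj i x = 0"
      unfolding W_def by (subst (asm) sum_nonneg_eq_0_iff) (use nn in auto)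
    then have "bj i x = 0" if "i \<in> {1..num \<sigma>}" for i using weight_pos[of i] that by fastforce
    then have "(\<Sum>j=1..num \<sigma>. bj j x) = 0" by simp
    then show False using bspline_partition_of_unity[OF assms] by simp
  qed
  moreover have "0 \<le> W x" unfolding W_def by (intro sum_nonneg nn)
  ultimately show ?thesis by simp
qed

lemma nurbs_nonneg:
  assumes "x \<in> {lo \<sigma>..hi \<sigma>}" "1 \<le> j" "j \<le> num \<sigma>"
  shows "0 \<le> nurbs \<sigma> j x"
  using W_pos[OF assms(1)] weight_pos[OF assms(2,3)] bspline_nonneg[of j "deg \<sigma>" x] assms
  by (simp add: nurbs_W)

lemma nurbs_partition_of_unity:
  assumes "x \<in> {lo \<sigma>..hi \<sigma>}"
  shows "(\<Sum>j=1..num \<sigma>. nurbs \<sigma> j x) = 1"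
  using W_pos[OF assms] unfolding nurbs_W sum_divide_distrib[symmetric] W_def[symmetric] by simp

lemma W_has_derivative:
  assumes "x \<in> {lo \<sigma>..hi \<sigma>}"
  shows "(W has_real_derivative W' x) (at x within {lo \<sigma>..hi \<sigma>})"
  unfolding W_def[abs_def] W'_def
  by (intro DERIV_sum DERIV_cmult bspline_has_derivative) (use assms in auto)

lemma nurbs_has_derivative:
  assumes "x \<in> {lo \<sigma>..hi \<sigma>}" "1 \<le> j" "j \<le> num \<sigma>"
  shows "(nurbs \<sigma> j has_real_derivative nurbs' j x) (at x within {lo \<sigma>..hi \<sigma>})"
proof -
  have "((\<lambda>x. weight \<sigma> j * bj j x / W x) has_real_derivative nurbs' j x) (at x within {lo \<sigma>..hi \<sigma>})"
    using W_pos[OF assms(1)]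
    by (auto intro!: derivative_eq_intros W_has_derivative bspline_has_derivative assms
        simp: nurbs'_def algebra_simps)
  then show ?thesis unfolding nurbs_W[abs_def] .
qed

lemma nurbs'_continuous:
  assumes "1 \<le> j" "j \<le> num \<sigma>"
  shows "continuous_on {lo \<sigma>..hi \<sigma>} (nurbs' j)"
proof -
  have "continuous_on {lo \<sigma>..hi \<sigma>} W" "continuous_on {lo \<sigma>..hi \<sigma>} W'"
    unfolding W_def[abs_def] W'_def[abs_def]
    by (auto intro!: continuous_intros bspline_continuous bspline_deriv_continuous)
  then show ?thesis
    unfolding nurbs'_def[abs_def] using W_pos assms
    by (intro continuous_intros bspline_continuous bspline_deriv_continuous) fastforce+
qed

lemma W_at_start: "W (lo \<sigma>) = weight \<sigma> 1"
proof -
  have "W (lo \<sigma>) = (\<Sum>i=1..num \<sigma>. weight \<sigma> i * of_bool (i = 1))"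
    unfolding W_def by (intro sum.cong refl) (simp add: bspline_at_start)
  then show ?thesis using sum_of_bool_mult[of "{1..num \<sigma>}" 1] num_ge_3 by simp
qed

lemma W_at_end: "W (hi \<sigma>) = weight \<sigma> (num \<sigma>)"
proof -
  have "W (hi \<sigma>) = (\<Sum>i=1..num \<sigma>. weight \<sigma> i * of_bool (i = num \<sigma>))"
    unfolding W_def by (intro sum.cong refl) (simp add: bspline_at_end)
  then show ?thesis using sum_of_bool_mult[of "{1..num \<sigma>}" "num \<sigma>"] num_ge_3 by simp
qed

lemma nurbs_at_start: "1 \<le> j \<Longrightarrow> j \<le> num \<sigma> \<Longrightarrow> nurbs \<sigma> j (lo \<sigma>) = of_bool (j = 1)"
  using weight_pos[of 1] num_ge_3 by (simp add: nurbs_W W_at_start bspline_at_start)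

lemma nurbs_at_end: "1 \<le> j \<Longrightarrow> j \<le> num \<sigma> \<Longrightarrow> nurbs \<sigma> j (hi \<sigma>) = of_bool (j = num \<sigma>)"
  using weight_pos[of "num \<sigma>"] num_ge_3 by (simp add: nurbs_W W_at_end bspline_at_end)

lemma nurbs_deriv_at_start:
  assumes "1 \<le> j" "j \<le> num \<sigma>"
  shows "nurbs' j (lo \<sigma>) = start_slope \<sigma> * (of_bool (j = 2) - of_bool (j = 1))"
proof -
  define s where "s = deg \<sigma> / (knot \<sigma> (deg \<sigma> + 2) - lo \<sigma>)"
  have "W' (lo \<sigma>) = (\<Sum>i=1..num \<sigma>. weight \<sigma> i * (s * (of_bool (i = 2) - of_bool (i = 1))))"
    unfolding W'_def by (intro sum.cong refl) (simp only: atLeastAtMost_iff bspline_deriv_at_start s_def)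
  also have "\<dots> = s * ((\<Sum>i=1..num \<sigma>. weight \<sigma> i * of_bool (i = 2)) - (\<Sum>i=1..num \<sigma>. weight \<sigma> i * of_bool (i = 1)))"
    unfolding sum_distrib_left sum_subtractf[symmetric] by (simp add: algebra_simps)
  also have "\<dots> = s * (weight \<sigma> 2 - weight \<sigma> 1)"
    using num_ge_3 by (subst (1 2) sum_of_bool_mult) auto
  finally have W': "W' (lo \<sigma>) = s * (weight \<sigma> 2 - weight \<sigma> 1)" .
  have d: "b' j (lo \<sigma>) = s * (of_bool (j = 2) - of_bool (j = 1))"
    using bspline_deriv_at_start[of j] assms by (simp only: s_def)
  show ?thesis
    using weight_pos[of 1] num_ge_3 assms unfolding start_slope_def s_def[symmetric]
    by (auto simp: nurbs'_def W' W_at_start bspline_at_start d)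
       (simp_all add: field_simps)
qed

lemma nurbs_deriv_at_end:
  assumes "1 \<le> j" "j \<le> num \<sigma>"
  shows "nurbs' j (hi \<sigma>) = end_slope \<sigma> * (of_bool (j = num \<sigma>) - of_bool (j = num \<sigma> - 1))"
proof -
  define s where "s = deg \<sigma> / (hi \<sigma> - knot \<sigma> (num \<sigma>))"
  have pred: "(i + 1 = num \<sigma>) = (i = num \<sigma> - 1)" for i using num_ge_3 by auto
  have "W' (hi \<sigma>) = (\<Sum>i=1..num \<sigma>. weight \<sigma> i * (s * (of_bool (i = num \<sigma>) - of_bool (i = num \<sigma> - 1))))"
    unfolding W'_def by (intro sum.cong refl) (simp only: atLeastAtMost_iff bspline_deriv_at_end s_def pred)
  also have "\<dots> = s * ((\<Sum>i=1..num \<sigma>. weight \<sigma> i * of_bool (i = num \<sigma>)) - (\<Sum>i=1..num \<sigma>. weight \<sigma> i * of_bool (i = num \<sigma> - 1)))"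
    unfolding sum_distrib_left sum_subtractf[symmetric] by (simp add: algebra_simps)
  also have "\<dots> = s * (weight \<sigma> (num \<sigma>) - weight \<sigma> (num \<sigma> - 1))"
    using num_ge_3 by (subst (1 2) sum_of_bool_mult) auto
  finally have W': "W' (hi \<sigma>) = s * (weight \<sigma> (num \<sigma>) - weight \<sigma> (num \<sigma> - 1))" .
  have d: "b' j (hi \<sigma>) = s * (of_bool (j = num \<sigma>) - of_bool (j = num \<sigma> - 1))"
    using bspline_deriv_at_end[of j] assms by (simp only: s_def pred)
  show ?thesis
    using weight_pos[of "num \<sigma>"] num_ge_3 assms unfolding end_slope_def s_def[symmetric]
    by (auto simp: nurbs'_def W' W_at_end bspline_at_end d)
       (simp_all add: field_simps)
qed

lemma start_slope_pos: "0 < start_slope \<sigma>"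
  unfolding start_slope_def
  using degree_ge_2 knots_start_less weight_pos[of 1] weight_pos[of 2] num_ge_3
  by (intro mult_pos_pos divide_pos_pos) auto

lemma end_slope_pos: "0 < end_slope \<sigma>"
  unfolding end_slope_def
  using degree_ge_2 knots_end_less weight_pos[of "num \<sigma>"] weight_pos[of "num \<sigma> - 1"] num_ge_3
  by (intro mult_pos_pos divide_pos_pos) auto

lemma nurbs_independent:
  assumes "\<And>x. lo \<sigma> < x \<Longrightarrow> x < hi \<sigma> \<Longrightarrow> (\<Sum>j=1..num \<sigma>. c j * nurbs \<sigma> j x) = 0"
    and j: "1 \<le> j" "j \<le> num \<sigma>"
  shows "c j = 0"
proof -
  have "c j * weight \<sigma> j = 0"
  proof (rule bspline_independent[of "\<lambda>j. c j * weight \<sigma> j"])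
    fix x assume x: "lo \<sigma> < x" "x < hi \<sigma>"
    have "(\<Sum>j=1..num \<sigma>. c j * weight \<sigma> j * bj j x) = W x * (\<Sum>j=1..num \<sigma>. c j * nurbs \<sigma> j x)"
      unfolding sum_distrib_left using W_pos[of x] x by (intro sum.cong refl) (simp add: nurbs_W)
    then show "(\<Sum>j=1..num \<sigma>. c j * weight \<sigma> j * bj j x) = 0" using assms(1)[OF x] by simp
  qed (use j in auto)
  then show ?thesis using weight_pos[OF j] by simp
qed

end

section \<open>Joining segments with continuous first derivative\<close>

definition C1_on :: "real \<Rightarrow> real \<Rightarrow> (real \<Rightarrow> real) \<Rightarrow> (real \<Rightarrow> real) \<Rightarrow> bool" where
  "C1_on a b f f' \<longleftrightarrow> continuous_on {a..b} f' \<and>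
     (\<forall>x\<in>{a..b}. (f has_real_derivative f' x) (at x within {a..b}))"

lemma C1_on_has_derivative:
  "C1_on a b f f' \<Longrightarrow> x \<in> {a..b} \<Longrightarrow> (f has_real_derivative f' x) (at x within {a..b})"
  by (simp add: C1_on_def)

lemma C1_on_interior:
  assumes "C1_on a b f f'" "a < x" "x < b"
  shows "(f has_real_derivative f' x) (at x)"
  using C1_on_has_derivative[OF assms(1), of x] at_within_Icc_at[OF assms(2,3)] assms(2,3) by simp

lemma C1_on_continuous: "C1_on a b f f' \<Longrightarrow> continuous_on {a..b} f"
  unfolding C1_on_def continuous_on_eq_continuous_within using DERIV_continuous by blast

lemma C1_on_continuous_deriv: "C1_on a b f f' \<Longrightarrow> continuous_on {a..b} f'"
  by (simp add: C1_on_def)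

lemma subinterval_exists:
  fixes a :: "nat \<Rightarrow> real"
  assumes "1 \<le> m" "a 1 \<le> x" "x \<le> a (Suc m)"
  shows "\<exists>i\<in>{1..m}. a i \<le> x \<and> (x < a (Suc i) \<or> i = m \<and> x = a (Suc i))"
  using assms
proof (induction m rule: dec_induct)
  case base
  then show ?case by force
next
  case (step n)
  show ?case
  proof (cases "x < a (Suc n)")
    case True
    with step obtain i where "i \<in> {1..n}" "a i \<le> x" "x < a (Suc i) \<or> i = n \<and> x = a (Suc i)" by force
    with True show ?thesis by (intro bexI[of _ i]) auto
  next
    case False
    with step show ?thesis by (intro bexI[of _ "Suc n"]) auto
  qed
qed

text \<open>Agreement with the pieces on the closed subintervals says that values and derivatives match at the
joints, so \<open>f\<close> and \<open>g\<close> are continuous, and the finitely many joints are covered by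
\<open>C1_of_finite_exceptions\<close>.\<close>
lemma C1_glue:
  fixes a :: "nat \<Rightarrow> real"
  assumes m: "1 \<le> m" and less: "\<And>i. i \<in> {1..m} \<Longrightarrow> a i < a (Suc i)"
    and f: "\<And>i x. i \<in> {1..m} \<Longrightarrow> x \<in> {a i..a (Suc i)} \<Longrightarrow> f x = fi i x"
    and g: "\<And>i x. i \<in> {1..m} \<Longrightarrow> x \<in> {a i..a (Suc i)} \<Longrightarrow> g x = gi i x"
    and C1: "\<And>i. i \<in> {1..m} \<Longrightarrow> C1_on (a i) (a (Suc i)) (fi i) (gi i)"
  shows "C1_on (a 1) (a (Suc m)) f g"
proof -
  have mono: "a 1 \<le> a n" if "1 \<le> n" "n \<le> Suc m" for n
    using that
  proof (induction n rule: nat_induct_at_least)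
    case (Suc n)
    then show ?case using less[of n] by simp
  qed simp
  have cont: "continuous_on {a 1..a (Suc n)} h"
    if h: "\<And>i. i \<in> {1..m} \<Longrightarrow> continuous_on {a i..a (Suc i)} h" and n: "1 \<le> n" "n \<le> m" for h :: "real \<Rightarrow> real" and n
    using n
  proof (induction n rule: nat_induct_at_least)
    case base
    then show ?case using h m by simp
  next
    case (Suc n)
    have "{a 1..a (Suc (Suc n))} = {a 1..a (Suc n)} \<union> {a (Suc n)..a (Suc (Suc n))}"
      using mono[of "Suc n"] less[of "Suc n"] Suc by (intro ivl_disj_un_two_touch(4)[symmetric]) auto
    then show ?case using Suc h[of "Suc n"] by (auto intro!: continuous_on_closed_Un)
  qed
  have cf: "continuous_on {a i..a (Suc i)} f" if i: "i \<in> {1..m}" for i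
    using C1_on_continuous[OF C1[OF i]] f[OF i] by (subst continuous_on_cong) auto
  have cg: "continuous_on {a i..a (Suc i)} g" if i: "i \<in> {1..m}" for i
    using C1_on_continuous_deriv[OF C1[OF i]] g[OF i] by (subst continuous_on_cong) auto
  have "(f has_real_derivative g x) (at x within {a 1..a (Suc m)})" if x: "x \<in> {a 1..a (Suc m)}" for x
  proof (rule C1_of_finite_exceptions[OF _ _ _ _ x])
    show "finite (a ` {1..Suc m})" by simp
    show "continuous_on {a 1..a (Suc m)} f" "continuous_on {a 1..a (Suc m)} g"
      using cont[of f m] cont[of g m] cf cg m by auto
    fix y assume y: "y \<in> {a 1<..<a (Suc m)} - a ` {1..Suc m}"
    then obtain i where i: "i \<in> {1..m}" "a i \<le> y" "y < a (Suc i) \<or> i = m \<and> y = a (Suc i)"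
      using subinterval_exists[of m a y] m by auto
    then have "a i < y" "y < a (Suc i)" using y by (force simp: less_le)+
    then have "(fi i has_real_derivative g y) (at y)"
      using C1_on_interior[OF C1[OF i(1)]] g[OF i(1), of y] by simp
    then show "(f has_real_derivative g y) (at y)"
      by (rule has_field_derivative_transform_within_open[of _ _ _ "{a i<..<a (Suc i)}"])
        (use \<open>a i < y\<close> \<open>y < a (Suc i)\<close> f[OF i(1)] in auto)
  qed
  then show ?thesis using cont[of g m] cg m by (auto simp: C1_on_def)
qed

lemma C1_on_shift:
  assumes "C1_on a b f f'"
  shows "C1_on (a + c) (b + c) (\<lambda>x. f (x - c)) (\<lambda>x. f' (x - c))"
  unfolding C1_on_def
proof safe
  have im: "(\<lambda>x. x - c) ` {a + c..b + c} = {a..b}"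
  proof
    show "{a..b} \<subseteq> (\<lambda>x. x - c) ` {a + c..b + c}"
    proof
      fix y assume "y \<in> {a..b}"
      then show "y \<in> (\<lambda>x. x - c) ` {a + c..b + c}" by (intro image_eqI[of _ _ "y + c"]) auto
    qed
  qed auto
  show "continuous_on {a + c..b + c} (\<lambda>x. f' (x - c))"
  proof (rule continuous_on_compose2[of "{a..b}" f'])
    show "continuous_on {a..b} f'" using assms by (simp add: C1_on_def)
    show "continuous_on {a + c..b + c} (\<lambda>x. x - c)" by (intro continuous_intros)
  qed (simp add: im)
  fix x assume x: "x \<in> {a + c..b + c}"
  have "(f has_real_derivative f' (x - c)) (at (x - c) within (\<lambda>x. x - c) ` {a + c..b + c})"
    using assms x unfolding im C1_on_def by auto
  moreover have "((\<lambda>x. x - c) has_real_derivative 1) (at x within {a + c..b + c})"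
    by (auto intro!: derivative_eq_intros)
  ultimately show "((\<lambda>x. f (x - c)) has_real_derivative f' (x - c)) (at x within {a + c..b + c})"
    using DERIV_image_chain[of f "f' (x - c)" "\<lambda>x. x - c" x "{a + c..b + c}" 1] by (simp add: o_def)
qed

lemma C1_on_reflect:
  assumes "C1_on 0 L f f'"
  shows "C1_on 0 L (\<lambda>t. f (L - t)) (\<lambda>t. - f' (L - t))"
  unfolding C1_on_def
proof safe
  have im: "(\<lambda>t. L - t) ` {0..L} = {0..L}"
  proof
    show "{0..L} \<subseteq> (\<lambda>t. L - t) ` {0..L}"
    proof
      fix y assume "y \<in> {0..L}"
      then show "y \<in> (\<lambda>t. L - t) ` {0..L}" by (intro image_eqI[of _ _ "L - y"]) auto
    qed
  qed auto
  have "continuous_on {0..L} (\<lambda>t. f' (L - t))"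
  proof (rule continuous_on_compose2[of "{0..L}" f'])
    show "continuous_on {0..L} f'" using assms by (simp add: C1_on_def)
    show "continuous_on {0..L} (\<lambda>t. L - t)" by (intro continuous_intros)
  qed (simp add: im)
  then show "continuous_on {0..L} (\<lambda>t. - f' (L - t))" by (rule continuous_on_minus)
  fix t assume t: "t \<in> {0..L}"
  have "(f has_real_derivative f' (L - t)) (at (L - t) within (\<lambda>t. L - t) ` {0..L})"
    using assms t unfolding im C1_on_def by auto
  moreover have "((\<lambda>t. L - t) has_real_derivative - 1) (at t within {0..L})"
    by (auto intro!: derivative_eq_intros)
  ultimately show "((\<lambda>t. f (L - t)) has_real_derivative - f' (L - t)) (at t within {0..L})"
    using DERIV_image_chain[of f "f' (L - t)" "\<lambda>t. L - t" t "{0..L}" "- 1"] by (simp add: o_def)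
qed

lemma C1_on_sum:
  assumes "\<And>j. j \<in> A \<Longrightarrow> C1_on a b (f j) (f' j)"
  shows "C1_on a b (\<lambda>x. \<Sum>j\<in>A. c j * f j x) (\<lambda>x. \<Sum>j\<in>A. c j * f' j x)"
  using assms unfolding C1_on_def
  by (intro conjI ballI continuous_on_sum continuous_on_mult continuous_on_const DERIV_sum DERIV_cmult) blast+

locale segment_chain =
  fixes m :: nat and S :: "nat \<Rightarrow> segment"
  assumes m: "1 \<le> m" and valid: "\<And>i. i \<in> {1..m} \<Longrightarrow> valid_segment (S i)"
begin

lemma rational_segment: "i \<in> {1..m} \<Longrightarrow> rational_segment (S i)"
  using valid by (simp add: rational_segment_def)

lemma num_ge_3: "i \<in> {1..m} \<Longrightarrow> 3 \<le> num (S i)"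
  by (rule rational_segment.num_ge_3[OF rational_segment])

lemma lo_less_hi: "i \<in> {1..m} \<Longrightarrow> lo (S i) < hi (S i)"
  using valid by (auto simp: valid_segment_def open_knot_vector_def)

lemma offset_1: "offset S 1 = 0"
  by (simp add: offset_def)

lemma offset_Suc: "1 \<le> i \<Longrightarrow> offset S (Suc i) = offset S i + (hi (S i) - lo (S i))"
  by (simp add: offset_def)

lemma offset_less: "i \<in> {1..m} \<Longrightarrow> offset S i < offset S (Suc i)"
  using offset_Suc[of i] lo_less_hi[of i] by simp

lemma offset_mono:
  assumes "1 \<le> i" "i \<le> j" "j \<le> Suc m"
  shows "offset S i \<le> offset S j"
  using assms(2,3)
proof (induction j rule: dec_induct)
  case (step n)
  then show ?case using offset_less[of n] assms(1) by simp
qed simp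

lemma length_pos: "0 < offset S (Suc m)"
  using offset_mono[of 1 m] offset_less[of m] m offset_1 by simp

lemma mu_ge: "i \<le> m \<Longrightarrow> 3 * i \<le> mu S i"
proof (induction i)
  case (Suc i)
  then show ?case using num_ge_3[of "Suc i"] by (simp add: mu_def)
qed (simp add: mu_def)

lemma eta_Suc: "Suc i \<le> m \<Longrightarrow> eta S (Suc i) = eta S i + (num (S (Suc i)) - 2)"
  using mu_ge[of i] num_ge_3[of "Suc i"] by (simp add: eta_def mu_def)

lemma eta_0: "eta S 0 = 0"
  by (simp add: eta_def mu_def)

lemma eta_pred: "i \<in> {1..m} \<Longrightarrow> eta S i = eta S (i - 1) + (num (S i) - 2)"
  using eta_Suc[of "i - 1"] by simp

lemma eta_mono: "i \<le> j \<Longrightarrow> j \<le> m \<Longrightarrow> eta S i \<le> eta S j"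
proof (induction j rule: dec_induct)
  case (step n)
  then show ?case using eta_Suc[of n] by simp
qed simp

lemma inner_row_exists:
  assumes "r \<in> {1..eta S n}" "n \<le> m"
  shows "\<exists>i\<in>{1..n}. \<exists>j\<in>{1..num (S i) - 2}. r = eta S (i - 1) + j"
  using assms
proof (induction n)
  case (Suc n)
  show ?case
  proof (cases "r \<le> eta S n")
    case True
    then show ?thesis using Suc by fastforce
  next
    case False
    then show ?thesis using Suc eta_Suc[of n]
      by (intro bexI[of _ "Suc n"] bexI[of _ "r - eta S n"]) auto
  qed
qed (simp add: eta_0)

text \<open>The intervals are half-open except for the last one, in accordance with \<open>segment_fun\<close>.\<close>
definition in_segment :: "nat \<Rightarrow> real \<Rightarrow> bool" where
  "in_segment i x \<longleftrightarrow> offset S i \<le> x \<and> (x < offset S (Suc i) \<or> i = m \<and> x = offset S (Suc i))"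

lemma segment_exists:
  assumes "x \<in> {0..offset S (Suc m)}"
  shows "\<exists>i\<in>{1..m}. in_segment i x"
  using subinterval_exists[of m "offset S" x] m assms offset_1 by (auto simp: in_segment_def)

lemma segment_unique:
  assumes "i \<in> {1..m}" "j \<in> {1..m}" "in_segment i x" "in_segment j x"
  shows "i = j"
proof (rule ccontr)
  assume "i \<noteq> j"
  then consider "i < j" | "j < i" by linarith
  then show False
  proof cases
    case 1
    then show False using offset_mono[of "Suc i" j] assms by (auto simp: in_segment_def)
  next
    case 2
    then show False using offset_mono[of "Suc j" i] assms by (auto simp: in_segment_def)
  qed
qed

lemma segment_fun_eq:
  "segment_fun m S i j x = (if in_segment i x then nurbs (S i) j (x - offset S i + lo (S i)) else 0)"
  by (simp add: segment_fun_def in_segment_def)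

lemma sum_segments:
  assumes "i \<in> {1..m}" "in_segment i x"
  shows "(\<Sum>l=1..m. if in_segment l x then h l else 0) = (h i :: real)"
proof -
  have "(\<Sum>l=1..m. if in_segment l x then h l else 0) = (\<Sum>l\<in>{i}. if in_segment l x then h l else 0)"
    using assms segment_unique by (intro sum.mono_neutral_right) auto
  then show ?thesis using assms by simp
qed

text \<open>Row \<open>r\<close> of a family that is glued from the segments. Here \<open>J i r\<close> is the common coefficient of the two
functions that do not vanish at the joint between the segments \<open>i\<close> and \<open>i + 1\<close>; \<open>J 0 r\<close> and \<open>J m r\<close>
are the coefficients of the first and of the last function of all.\<close>
definition coef :: "(nat \<Rightarrow> nat \<Rightarrow> real) \<Rightarrow> nat \<Rightarrow> nat \<Rightarrow> nat \<Rightarrow> real" where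
  "coef J r i j = (if j = 1 then J (i - 1) r else if j = num (S i) then J i r
                   else of_bool (r = eta S (i - 1) + (j - 1)))"

definition piece :: "(nat \<Rightarrow> nat \<Rightarrow> real) \<Rightarrow> nat \<Rightarrow> nat \<Rightarrow> real \<Rightarrow> real" where
  "piece J r i x = (\<Sum>j=1..num (S i). coef J r i j * nurbs (S i) j (x - offset S i + lo (S i)))"

definition piece' :: "(nat \<Rightarrow> nat \<Rightarrow> real) \<Rightarrow> nat \<Rightarrow> nat \<Rightarrow> real \<Rightarrow> real" where
  "piece' J r i x = (\<Sum>j=1..num (S i). coef J r i j * rational_segment.nurbs' (S i) j (x - offset S i + lo (S i)))"

text \<open>The non-periodic and the periodic basis both have this form; they differ in \<open>J 0\<close> and \<open>J m\<close>.\<close>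
definition glued :: "(nat \<Rightarrow> nat \<Rightarrow> real) \<Rightarrow> nat \<Rightarrow> real \<Rightarrow> real" where
  "glued J r x = (\<Sum>i=1..m. \<Sum>j=1..num (S i). coef J r i j * segment_fun m S i j x)"

definition glued' :: "(nat \<Rightarrow> nat \<Rightarrow> real) \<Rightarrow> nat \<Rightarrow> real \<Rightarrow> real" where
  "glued' J r x = (\<Sum>i=1..m. if in_segment i x then piece' J r i x else 0)"

lemma glued_segment:
  assumes "i \<in> {1..m}" "in_segment i x"
  shows "glued J r x = piece J r i x"
proof -
  have "glued J r x = (\<Sum>l=1..m. if in_segment l x then piece J r l x else 0)"
    unfolding glued_def piece_def segment_fun_eq by (intro sum.cong refl) auto
  then show ?thesis using sum_segments[OF assms] by simp
qed

lemma glued'_segment: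
  assumes "i \<in> {1..m}" "in_segment i x"
  shows "glued' J r x = piece' J r i x"
  unfolding glued'_def using sum_segments[OF assms] by simp

lemma piece_at_start:
  assumes "i \<in> {1..m}"
  shows "piece J r i (offset S i) = J (i - 1) r"
proof -
  have "piece J r i (offset S i) = (\<Sum>j=1..num (S i). coef J r i j * of_bool (j = 1))"
    unfolding piece_def
    by (intro sum.cong refl) (simp add: rational_segment.nurbs_at_start[OF rational_segment[OF assms]])
  also have "\<dots> = J (i - 1) r" using num_ge_3[OF assms] by (subst sum_of_bool_mult) (auto simp: coef_def)
  finally show ?thesis .
qed

lemma piece_at_end:
  assumes "i \<in> {1..m}"
  shows "piece J r i (offset S (Suc i)) = J i r"
proof -
  have x: "offset S (Suc i) - offset S i + lo (S i) = hi (S i)" using offset_Suc[of i] assms by simp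
  have "piece J r i (offset S (Suc i)) = (\<Sum>j=1..num (S i). coef J r i j * of_bool (j = num (S i)))"
    unfolding piece_def x
    by (intro sum.cong refl) (simp add: rational_segment.nurbs_at_end[OF rational_segment[OF assms]])
  also have "\<dots> = J i r" using num_ge_3[OF assms] by (subst sum_of_bool_mult) (auto simp: coef_def)
  finally show ?thesis .
qed

lemma piece'_at_start:
  assumes "i \<in> {1..m}"
  shows "piece' J r i (offset S i) = start_slope (S i) * (of_bool (r = eta S (i - 1) + 1) - J (i - 1) r)"
proof -
  have "piece' J r i (offset S i) = start_slope (S i) *
     ((\<Sum>j=1..num (S i). coef J r i j * of_bool (j = 2)) - (\<Sum>j=1..num (S i). coef J r i j * of_bool (j = 1)))"
    unfolding piece'_def sum_distrib_left sum_subtractf[symmetric]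
    by (intro sum.cong refl)
      (simp add: rational_segment.nurbs_deriv_at_start[OF rational_segment[OF assms]] algebra_simps)
  also have "\<dots> = start_slope (S i) * (of_bool (r = eta S (i - 1) + 1) - J (i - 1) r)"
    using num_ge_3[OF assms] by (subst (1 2) sum_of_bool_mult) (auto simp: coef_def)
  finally show ?thesis .
qed

lemma piece'_at_end:
  assumes "i \<in> {1..m}"
  shows "piece' J r i (offset S (Suc i)) = end_slope (S i) * (J i r - of_bool (r = eta S i))"
proof -
  have x: "offset S (Suc i) - offset S i + lo (S i) = hi (S i)" using offset_Suc[of i] assms by simp
  have e: "eta S (i - 1) + (num (S i) - 1 - 1) = eta S i" using eta_pred[OF assms] by simp
  have "piece' J r i (offset S (Suc i)) = end_slope (S i) *
     ((\<Sum>j=1..num (S i). coef J r i j * of_bool (j = num (S i))) - (\<Sum>j=1..num (S i). coef J r i j * of_bool (j = num (S i) - 1)))"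
    unfolding piece'_def x sum_distrib_left sum_subtractf[symmetric]
    by (intro sum.cong refl)
      (simp only: atLeastAtMost_iff rational_segment.nurbs_deriv_at_end[OF rational_segment[OF assms]] algebra_simps)
  also have "\<dots> = end_slope (S i) * (coef J r i (num (S i)) - coef J r i (num (S i) - 1))"
    using num_ge_3[OF assms] by (subst (1 2) sum_of_bool_mult) auto
  also have "\<dots> = end_slope (S i) * (J i r - of_bool (r = eta S i))"
    using num_ge_3[OF assms] unfolding coef_def e by auto
  finally show ?thesis .
qed

lemma piece_C1:
  assumes "i \<in> {1..m}"
  shows "C1_on (offset S i) (offset S (Suc i)) (piece J r i) (piece' J r i)"
proof -
  interpret rational_segment "S i" using rational_segment[OF assms] .
  have ends: "lo (S i) + (offset S i - lo (S i)) = offset S i"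
    "hi (S i) + (offset S i - lo (S i)) = offset S (Suc i)"
    using offset_Suc[of i] assms by auto
  have "C1_on (lo (S i)) (hi (S i)) (nurbs (S i) j) (nurbs' j)" if "j \<in> {1..num (S i)}" for j
    using nurbs_has_derivative nurbs'_continuous that by (auto simp: C1_on_def)
  then have "C1_on (lo (S i)) (hi (S i)) (\<lambda>x. \<Sum>j=1..num (S i). coef J r i j * nurbs (S i) j x)
      (\<lambda>x. \<Sum>j=1..num (S i). coef J r i j * nurbs' j x)"
    by (rule C1_on_sum)
  from C1_on_shift[OF this, of "offset S i - lo (S i)"] show ?thesis
    unfolding piece_def[abs_def] piece'_def[abs_def] ends by (simp add: algebra_simps)
qed

lemma glued_nonneg:
  assumes "x \<in> {0..offset S (Suc m)}" "\<And>i. i \<le> m \<Longrightarrow> 0 \<le> J i r"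
  shows "0 \<le> glued J r x"
proof -
  obtain i where i: "i \<in> {1..m}" "in_segment i x" using segment_exists[OF assms(1)] by blast
  have "x - offset S i + lo (S i) \<in> {lo (S i)..hi (S i)}"
    using i offset_Suc[of i] by (auto simp: in_segment_def)
  moreover have "0 \<le> coef J r i j" for j using assms(2)[of i] assms(2)[of "i-1"] i(1) by (auto simp: coef_def)
  ultimately show ?thesis unfolding glued_segment[OF i] piece_def
    by (intro sum_nonneg mult_nonneg_nonneg rational_segment.nurbs_nonneg[OF rational_segment[OF i(1)]]) auto
qed

lemma glued_partition_of_unity:
  assumes "x \<in> {0..offset S (Suc m)}" "finite R" "{1..eta S m} \<subseteq> R"
    and J: "\<And>i. i \<le> m \<Longrightarrow> (\<Sum>r\<in>R. J i r) = 1"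
  shows "(\<Sum>r\<in>R. glued J r x) = 1"
proof -
  obtain i where i: "i \<in> {1..m}" "in_segment i x" using segment_exists[OF assms(1)] by blast
  have x: "x - offset S i + lo (S i) \<in> {lo (S i)..hi (S i)}"
    using i offset_Suc[of i] by (auto simp: in_segment_def)
  have c: "(\<Sum>r\<in>R. coef J r i j) = 1" if j: "j \<in> {1..num (S i)}" for j
  proof -
    consider "j = 1" | "j = num (S i)" "j \<noteq> 1" | "j \<noteq> 1" "j \<noteq> num (S i)" by blast
    then show ?thesis
    proof cases
      case 3
      have "eta S (i-1) + (j-1) \<in> {1..eta S m}"
        using 3 j eta_pred[OF i(1)] eta_mono[of i m] i(1) by auto
      then have "eta S (i-1) + (j-1) \<in> R" using assms by blast
      then have "(\<Sum>r\<in>R. 1 * of_bool (r = eta S (i-1) + (j-1))) = (1::real)"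
        by (intro sum_of_bool_mult[OF assms(2)])
      then show ?thesis using 3 by (simp add: coef_def)
    qed (use J i(1) in \<open>auto simp: coef_def\<close>)
  qed
  have "(\<Sum>r\<in>R. glued J r x) = (\<Sum>j=1..num (S i). \<Sum>r\<in>R. coef J r i j * nurbs (S i) j (x - offset S i + lo (S i)))"
    unfolding glued_segment[OF i] piece_def by (rule sum.swap)
  also have "\<dots> = (\<Sum>j=1..num (S i). nurbs (S i) j (x - offset S i + lo (S i)))"
    unfolding sum_distrib_right[symmetric] using c by simp
  also have "\<dots> = 1" by (rule rational_segment.nurbs_partition_of_unity[OF rational_segment[OF i(1)] x])
  finally show ?thesis .
qed

text \<open>In the interior of one segment only its rational B-splines contribute, so \<open>c\<close> is orthogonal to each
column of coefficients. An inner column is a unit vector, and the other columns are values of \<open>J\<close>.\<close>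
lemma glued_independent:
  assumes "finite R" "{1..eta S m} \<subseteq> R"
    and 0: "\<And>x. x \<in> {0..offset S (Suc m)} \<Longrightarrow> (\<Sum>r\<in>R. c r * glued J r x) = 0"
  shows "\<And>r. r \<in> {1..eta S m} \<Longrightarrow> c r = 0"
    and "\<And>i. i \<le> m \<Longrightarrow> (\<Sum>r\<in>R. c r * J i r) = 0"
proof -
  have d: "(\<Sum>r\<in>R. c r * coef J r i j) = 0" if i: "i \<in> {1..m}" and j: "j \<in> {1..num (S i)}" for i j
  proof (rule rational_segment.nurbs_independent[OF rational_segment[OF i], of "\<lambda>j. \<Sum>r\<in>R. c r * coef J r i j"])
    fix y assume y: "lo (S i) < y" "y < hi (S i)"
    define x where "x = y + offset S i - lo (S i)"
    have "in_segment i x" using y offset_Suc[of i] i by (auto simp: in_segment_def x_def)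
    moreover have "x \<in> {0..offset S (Suc m)}"
      using y offset_Suc[of i] offset_mono[of 1 i] offset_mono[of "Suc i" "Suc m"] i offset_1 by (auto simp: x_def)
    ultimately have "0 = (\<Sum>r\<in>R. c r * piece J r i x)" using 0[of x] glued_segment[OF i] by simp
    also have "\<dots> = (\<Sum>j=1..num (S i). \<Sum>r\<in>R. c r * (coef J r i j * nurbs (S i) j y))"
      unfolding piece_def sum_distrib_left x_def by (subst sum.swap) simp
    also have "\<dots> = (\<Sum>j=1..num (S i). (\<Sum>r\<in>R. c r * coef J r i j) * nurbs (S i) j y)"
      unfolding sum_distrib_right by (simp add: mult.assoc)
    finally show "(\<Sum>j=1..num (S i). (\<Sum>r\<in>R. c r * coef J r i j) * nurbs (S i) j y) = 0" by simp
  qed (use j in auto)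
  show "c r = 0" if r: "r \<in> {1..eta S m}" for r
  proof -
    obtain i j where ij: "i \<in> {1..m}" "j \<in> {1..num (S i) - 2}" "r = eta S (i-1) + j"
      using inner_row_exists[OF r order.refl] by blast
    have "(\<Sum>r'\<in>R. c r' * coef J r' i (j+1)) = (\<Sum>r'\<in>R. c r' * of_bool (r' = r))"
      using ij by (intro sum.cong refl) (auto simp: coef_def)
    also have "\<dots> = c r" using r assms by (intro sum_of_bool_mult) auto
    finally show ?thesis using d[of i "j+1"] ij by auto
  qed
  show "(\<Sum>r\<in>R. c r * J i r) = 0" if "i \<le> m" for i
  proof (cases "i = 0")
    case True
    then show ?thesis using d[of 1 1] m num_ge_3[of 1] by (simp add: coef_def)
  next
    case False
    then show ?thesis using d[of i "num (S i)"] num_ge_3[of i] that by (simp add: coef_def)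
  qed
qed

lemma glued_at_0: "glued J r 0 = J 0 r"
  and glued'_at_0: "glued' J r 0 = start_slope (S 1) * (of_bool (r = 1) - J 0 r)"
proof -
  have "in_segment 1 0" using offset_1 offset_less[of 1] m by (auto simp: in_segment_def)
  then show "glued J r 0 = J 0 r" "glued' J r 0 = start_slope (S 1) * (of_bool (r = 1) - J 0 r)"
    using glued_segment[of 1 0] glued'_segment[of 1 0] piece_at_start[of 1] piece'_at_start[of 1] m offset_1 eta_0
    by auto
qed

lemma glued_at_length: "glued J r (offset S (Suc m)) = J m r"
  and glued'_at_length: "glued' J r (offset S (Suc m)) = end_slope (S m) * (J m r - of_bool (r = eta S m))"
proof -
  have "in_segment m (offset S (Suc m))" using offset_less[of m] m by (auto simp: in_segment_def)
  then show "glued J r (offset S (Suc m)) = J m r"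
      "glued' J r (offset S (Suc m)) = end_slope (S m) * (J m r - of_bool (r = eta S m))"
    using glued_segment[of m] glued'_segment[of m] piece_at_end[of m] piece'_at_end[of m] m by auto
qed

text \<open>The solution \<open>x\<close> of \<open>\<alpha> * (x - of_bool (r = eta S i)) = \<beta> * (of_bool (r = eta S i + 1) - x)\<close>, where
\<open>\<alpha>\<close> and \<open>\<beta>\<close> are the slopes at the joint. The two sides are the derivatives of row \<open>r\<close> from the
left and from the right.\<close>
definition joint_weight :: "nat \<Rightarrow> nat \<Rightarrow> real" where
  "joint_weight i r = (end_slope (S i) * of_bool (r = eta S i) + start_slope (S (Suc i)) * of_bool (r = eta S i + 1))
     / (end_slope (S i) + start_slope (S (Suc i)))"

lemma glued_C1:
  assumes J: "\<And>i. 1 \<le> i \<Longrightarrow> i < m \<Longrightarrow> J i r = joint_weight i r"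
  shows "C1_on 0 (offset S (Suc m)) (glued J r) (glued' J r)"
proof -
  have joint: "piece' J r i (offset S (Suc i)) = piece' J r (Suc i) (offset S (Suc i))"
    if i: "1 \<le> i" "i < m" for i
  proof -
    have "0 < end_slope (S i)" "0 < start_slope (S (Suc i))"
      using rational_segment.end_slope_pos[OF rational_segment, of i]
        rational_segment.start_slope_pos[OF rational_segment, of "Suc i"] i by auto
    then show ?thesis
      using i by (simp add: piece'_at_end piece'_at_start J[OF i] joint_weight_def of_bool_def field_simps)
  qed
  have closed: "(in_segment i x) \<or> (1 \<le> i \<and> i < m \<and> x = offset S (Suc i) \<and> in_segment (Suc i) x)"
    if "i \<in> {1..m}" "x \<in> {offset S i..offset S (Suc i)}" for i x
    using that offset_less[of "Suc i"] by (auto simp: in_segment_def)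
  have "C1_on (offset S 1) (offset S (Suc m)) (glued J r) (glued' J r)"
  proof (rule C1_glue[of m "offset S" _ "piece J r" _ "piece' J r", OF m offset_less _ _ piece_C1])
    fix i x assume ix: "i \<in> {1..m}" "x \<in> {offset S i..offset S (Suc i)}"
    then show "glued J r x = piece J r i x"
      using closed[OF ix] glued_segment[of i x] glued_segment[of "Suc i" x] piece_at_end[of i] piece_at_start[of "Suc i"]
      by auto
    show "glued' J r x = piece' J r i x"
      using closed[OF ix] glued'_segment[of i x] glued'_segment[of "Suc i" x] joint[of i] ix by auto
  qed
  then show ?thesis unfolding offset_1 .
qed

end

section \<open>Closed curves\<close>

lemma shift_into_period:
  fixes L :: real
  assumes "0 < L"
  shows "\<exists>n::int. s + of_int n * L \<in> {0..L}"
proof -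
  have "s + of_int (- \<lfloor>s / L\<rfloor>) * L = L * (s / L - of_int \<lfloor>s / L\<rfloor>)"
    using assms by (simp add: field_simps)
  moreover have "0 \<le> s / L - of_int \<lfloor>s / L\<rfloor>" "s / L - of_int \<lfloor>s / L\<rfloor> \<le> 1" by linarith+
  ultimately have "s + of_int (- \<lfloor>s / L\<rfloor>) * L \<in> {0..L}"
    using assms by (auto intro: mult_left_le)
  then show ?thesis by blast
qed

definition periodic_ext :: "real \<Rightarrow> (real \<Rightarrow> real) \<Rightarrow> real \<Rightarrow> real" where
  "periodic_ext L f x = f (x - of_int \<lfloor>x / L\<rfloor> * L)"

lemma periodic_ext_shift:
  assumes "0 < L"
  shows "periodic_ext L f (x + of_int n * L) = periodic_ext L f x"
proof -
  have "(x + of_int n * L) / L = x / L + of_int n" using assms by (simp add: field_simps)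
  then have "\<lfloor>(x + of_int n * L) / L\<rfloor> = \<lfloor>x / L\<rfloor> + n" by simp
  then show ?thesis by (simp add: periodic_ext_def algebra_simps)
qed

lemma periodic_ext_on_period:
  assumes "0 < L" "f 0 = f L" "of_int k * L \<le> x" "x \<le> of_int k * L + L"
  shows "periodic_ext L f x = f (x - of_int k * L)"
proof (cases "x = of_int k * L + L")
  case True
  then have "x / L = of_int (k + 1)" using assms by (simp add: field_simps)
  then have "\<lfloor>x / L\<rfloor> = k + 1" by (metis floor_of_int)
  then show ?thesis using True assms by (simp add: periodic_ext_def algebra_simps)
next
  case False
  then have "x < of_int k * L + L" using assms by simp
  then have "\<lfloor>x / L\<rfloor> = k"
    using assms by (intro floor_unique) (auto simp: field_simps)
  then show ?thesis by (simp add: periodic_ext_def)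
qed

text \<open>Around any point the extension is glued from two translates of \<open>f\<close> on adjacent periods.\<close>
lemma periodic_ext_C1:
  assumes L: "0 < L" and C1: "C1_on 0 L f f'" and ends: "f 0 = f L" "f' 0 = f' L"
  shows "(periodic_ext L f has_real_derivative periodic_ext L f' x) (at x)"
    and "continuous_on UNIV (periodic_ext L f')"
proof -
  have loc: "(periodic_ext L f has_real_derivative periodic_ext L f' x) (at x) \<and> isCont (periodic_ext L f') x" for x
  proof -
    define n where "n = \<lfloor>x / L\<rfloor>"
    define k where "k i = n + int i - 2" for i
    \<comment> \<open>With \<open>i\<close> from 1 to 3 these are the end points of the two periods on either side of \<open>n * L\<close>; \<open>x\<close> lies in the second.\<close>
    define a where "a i = of_int (k i) * L" for i
    have a_Suc: "a (Suc i) = a i + L" for i by (simp add: a_def k_def algebra_simps)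
    have "C1_on (a 1) (a (Suc 2)) (periodic_ext L f) (periodic_ext L f')"
    proof (rule C1_glue[of 2 a _ "\<lambda>i x. f (x - a i)" _ "\<lambda>i x. f' (x - a i)"])
      fix i :: nat
      show "a i < a (Suc i)" using a_Suc[of i] L by simp
      show "C1_on (a i) (a (Suc i)) (\<lambda>x. f (x - a i)) (\<lambda>x. f' (x - a i))"
        using C1_on_shift[OF C1, of "a i"] by (simp add: a_Suc add.commute)
      fix y assume "y \<in> {a i..a (Suc i)}"
      then have y: "of_int (k i) * L \<le> y" "y \<le> of_int (k i) * L + L"
        using a_Suc[of i] by (auto simp: a_def)
      show "periodic_ext L f y = f (y - a i)" "periodic_ext L f' y = f' (y - a i)"
        unfolding a_def using periodic_ext_on_period[OF L ends(1) y] periodic_ext_on_period[OF L ends(2) y] by auto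
    qed simp
    moreover have x: "a 1 < x" "x < a (Suc 2)"
    proof -
      have "of_int n \<le> x / L" "x / L < of_int n + 1" unfolding n_def by linarith+
      then have "of_int n * L \<le> x" "x < (of_int n + 1) * L" using L by (simp_all add: field_simps)
      then show "a 1 < x" "x < a (Suc 2)" using L by (auto simp: a_def k_def algebra_simps)
    qed
    ultimately have C: "C1_on (a 1) (a (Suc 2)) (periodic_ext L f) (periodic_ext L f')" and x: "a 1 < x" "x < a (Suc 2)"
      by auto
    have "continuous (at x within {a 1..a (Suc 2)}) (periodic_ext L f')"
      using C1_on_continuous_deriv[OF C] x unfolding continuous_on_eq_continuous_within by auto
    then show ?thesis using C1_on_interior[OF C x] unfolding at_within_Icc_at[OF x] by simp
  qed
  show "(periodic_ext L f has_real_derivative periodic_ext L f' x) (at x)" using loc by blast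
  show "continuous_on UNIV (periodic_ext L f')" using loc by (simp add: continuous_at_imp_continuous_on)
qed

text \<open>The properties of the periodic basis that matter for closed curves.\<close>
locale periodic_family =
  fixes ns :: nat and s2 :: real and Bs Bs' :: "nat \<Rightarrow> real \<Rightarrow> real"
  assumes s2_pos: "0 < s2"
    and Bs_C1: "\<And>i. i \<in> {1..ns} \<Longrightarrow> C1_on 0 s2 (Bs i) (Bs' i)"
    and Bs_ends: "\<And>i. i \<in> {1..ns} \<Longrightarrow> Bs i 0 = Bs i s2" "\<And>i. i \<in> {1..ns} \<Longrightarrow> Bs' i 0 = Bs' i s2"
    and Bs_sum: "\<And>s. s \<in> {0..s2} \<Longrightarrow> (\<Sum>i=1..ns. Bs i s) = 1"
begin

text \<open>The closed curve with control points \<open>V\<close>, extended periodically.\<close>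
definition curve :: "(nat \<Rightarrow> 'a::real_normed_vector) \<Rightarrow> real \<Rightarrow> 'a" where
  "curve V s = (\<Sum>i=1..ns. periodic_ext s2 (Bs i) s *\<^sub>R V i)"

definition curve' :: "(nat \<Rightarrow> 'a::real_normed_vector) \<Rightarrow> real \<Rightarrow> 'a" where
  "curve' V s = (\<Sum>i=1..ns. periodic_ext s2 (Bs' i) s *\<^sub>R V i)"

lemma curve_deriv: "(curve V has_vector_derivative curve' V s) (at s)"
  unfolding curve_def[abs_def] curve'_def
proof (rule has_vector_derivative_sum)
  fix i assume "i \<in> {1..ns}"
  then have "(periodic_ext s2 (Bs i) has_real_derivative periodic_ext s2 (Bs' i) s) (at s)"
    by (intro periodic_ext_C1 s2_pos Bs_C1 Bs_ends)
  then show "((\<lambda>s. periodic_ext s2 (Bs i) s *\<^sub>R V i) has_vector_derivative periodic_ext s2 (Bs' i) s *\<^sub>R V i) (at s)"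
    using has_vector_derivative_scaleR[OF _ has_vector_derivative_const[of "V i"]] by fastforce
qed

lemma curve'_cont: "continuous_on UNIV (curve' V)"
  unfolding curve'_def[abs_def]
  by (intro continuous_on_sum continuous_on_scaleR continuous_on_const periodic_ext_C1(2)[OF s2_pos Bs_C1 Bs_ends])

lemma curve_periodic: "curve V (s + of_int n * s2) = curve V s" "curve' V (s + of_int n * s2) = curve' V s"
  unfolding curve_def curve'_def by (simp_all add: periodic_ext_shift[OF s2_pos])

lemma curve_eq:
  assumes "s \<in> {0..s2}"
  shows "curve V s = (\<Sum>i=1..ns. Bs i s *\<^sub>R V i)"
  unfolding curve_def
proof (intro sum.cong refl)
  fix i assume "i \<in> {1..ns}"
  then show "periodic_ext s2 (Bs i) s *\<^sub>R V i = Bs i s *\<^sub>R V i"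
    using periodic_ext_on_period[of s2 "Bs i" 0 s] s2_pos Bs_ends(1)[of i] assms by simp
qed

lemma curve_const: "curve (\<lambda>_. q) s = q"
proof -
  obtain n where n: "s + of_int n * s2 \<in> {0..s2}" using shift_into_period[OF s2_pos] by blast
  have "curve (\<lambda>_. q) s = curve (\<lambda>_. q) (s + of_int n * s2)" by (simp only: curve_periodic)
  also have "\<dots> = (\<Sum>i=1..ns. Bs i (s + of_int n * s2)) *\<^sub>R q"
    unfolding curve_eq[OF n] by (simp only: scaleR_sum_left)
  finally show ?thesis unfolding Bs_sum[OF n] by simp
qed

lemma curve_linear:
  "curve (\<lambda>i. V i + W i) s = curve V s + curve W s"
  "curve (\<lambda>i. c *\<^sub>R V i) s = c *\<^sub>R curve V s"
  unfolding curve_def by (simp_all add: scaleR_add_right sum.distrib scaleR_sum_right mult.commute)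

end

section \<open>The non-periodic and the periodic basis\<close>

lemma nth_concat_segments:
  fixes S :: "nat \<Rightarrow> segment"
  shows "length (concat (map (\<lambda>i. map (g i) [1..<num (S i) + 1]) [1..<m + 1])) = mu S m"
    and "1 \<le> i \<Longrightarrow> i \<le> m \<Longrightarrow> 1 \<le> j \<Longrightarrow> j \<le> num (S i) \<Longrightarrow>
      concat (map (\<lambda>i. map (g i) [1..<num (S i) + 1]) [1..<m + 1]) ! (mu S (i - 1) + (j - 1)) = g i j"
proof -
  show len: "length (concat (map (\<lambda>i. map (g i) [1..<num (S i) + 1]) [1..<m + 1])) = mu S m" for m
    by (induction m) (auto simp: mu_def)
  show "1 \<le> i \<Longrightarrow> i \<le> m \<Longrightarrow> 1 \<le> j \<Longrightarrow> j \<le> num (S i) \<Longrightarrow>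
      concat (map (\<lambda>i. map (g i) [1..<num (S i) + 1]) [1..<m + 1]) ! (mu S (i - 1) + (j - 1)) = g i j"
  proof (induction m)
    case (Suc m)
    let ?L = "concat (map (\<lambda>i. map (g i) [1..<num (S i) + 1]) [1..<m + 1])"
    have split: "concat (map (\<lambda>i. map (g i) [1..<num (S i) + 1]) [1..<Suc m + 1])
        = ?L @ map (g (Suc m)) [1..<num (S (Suc m)) + 1]" by simp
    have len: "length ?L = mu S m" using len[of m] .
    show ?case
    proof (cases "i \<le> m")
      case True
      have "mu S (i - 1) + num (S i) = mu S i" using Suc.prems by (cases i) (auto simp: mu_def)
      moreover have "mu S i \<le> mu S m" unfolding mu_def using True by (intro sum_mono2) auto
      ultimately have "mu S (i - 1) + (j - 1) < length ?L" using Suc.prems unfolding len by linarith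
      then show ?thesis unfolding split using Suc.IH Suc.prems True by (simp only: nth_append if_True)
    next
      case False
      then have "i = Suc m" using Suc.prems by simp
      moreover have "(?L @ map (g (Suc m)) [1..<num (S (Suc m)) + 1]) ! (mu S m + (j - 1)) = g (Suc m) j"
        using nth_append_length_plus[of ?L "map (g (Suc m)) [1..<num (S (Suc m)) + 1]" "j - 1"]
          \<open>i = Suc m\<close> Suc.prems nth_upt[of 1 "j - 1" "num (S (Suc m)) + 1"]
        unfolding len by (simp del: upt_Suc)
      ultimately show ?thesis unfolding split by simp
    qed
  qed simp
qed

lemma sum_first_last:
  fixes h :: "nat \<Rightarrow> real"
  assumes "3 \<le> n"
  shows "(\<Sum>c = 0..<n. h c) = h 0 + (\<Sum>c = 1..n-2. h c) + h (n-1)"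
proof -
  obtain k where n: "n = Suc (Suc k)" using assms by (cases n; cases "n - 1") auto
  have "(\<Sum>c = 0..<n. h c) = (\<Sum>c = 0..<Suc k. h c) + h (n - 1)" unfolding n by simp
  also have "(\<Sum>c = 0..<Suc k. h c) = h 0 + (\<Sum>c = 1..<Suc k. h c)"
    by (subst sum.atLeast_Suc_lessThan) auto
  also have "{1..<Suc k} = {1..n-2}" unfolding n by auto
  finally show ?thesis by simp
qed

context segment_chain
begin

abbreviation N :: "real \<Rightarrow> nat \<Rightarrow> nat \<Rightarrow> real" where
  "N x i j \<equiv> segment_fun m S i j x"

lemma dim_b_vec: "dim_vec (b_vec m S x) = mu S m"
  unfolding b_vec_def using nth_concat_segments(1)[of "\<lambda>i j. segment_fun m S i j x" S m] by simp

lemma b_vec_index: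
  assumes "i \<in> {1..m}" "j \<in> {1..num (S i)}"
  shows "vec_index (b_vec m S x) (mu S (i - 1) + (j - 1)) = N x i j"
  unfolding b_vec_def vec_of_list_index
  using nth_concat_segments(2)[of i m j S "\<lambda>i j. segment_fun m S i j x"] assms by auto

lemma mu_pred: "i \<in> {1..m} \<Longrightarrow> mu S i = mu S (i - 1) + num (S i)"
  by (cases i) (auto simp: mu_def)

lemma mu_mono: "i \<le> j \<Longrightarrow> mu S i \<le> mu S j"
  unfolding mu_def by (intro sum_mono2) auto

lemma alpha_eq: "alpha S i = end_slope (S i)"
  by (simp add: alpha_def end_slope_def Let_def)

lemma beta_eq: "beta m S i = start_slope (S (if i = m then 1 else Suc i))"
  by (simp add: beta_def start_slope_def Let_def)

lemma sum_if_mult: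
  fixes v :: "nat \<Rightarrow> real"
  assumes "finite A" "a \<in> A"
  shows "(\<Sum>c\<in>A. (if P \<and> c = a then 1 else 0) * v c) = of_bool P * v a"
proof -
  have "(\<Sum>c\<in>A. (if P \<and> c = a then 1 else 0) * v c) = (\<Sum>c\<in>A. (of_bool P * v c) * of_bool (c = a))"
    by (intro sum.cong) auto
  then show ?thesis using sum_of_bool_mult[OF assms] by simp
qed

text \<open>After an interchange of summations every summand of \<open>Hc_entry\<close> picks out the one or two columns on
which it is non-zero.\<close>
lemma Hc_row_sum:
  fixes v :: "nat \<Rightarrow> real"
  shows "(\<Sum>c = 1..mu S m - 2. Hc_entry m S r c * v c) =
     (\<Sum>i=1..m. \<Sum>j=1..num (S i) - 2. of_bool (r = eta S (i-1) + j) * v (mu S (i-1) + j)) +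
     (\<Sum>i=1..<m. joint_weight i r * (v (mu S i - 1) + v (mu S i)))"
proof -
  let ?A = "{1..mu S m - 2}"
  have 1: "(\<Sum>c\<in>?A. (\<Sum>i=1..m. \<Sum>j=1..num (S i) - 2.
        if r = eta S (i-1) + j \<and> c = mu S (i-1) + j then 1 else 0) * v c)
     = (\<Sum>i=1..m. \<Sum>j=1..num (S i) - 2. of_bool (r = eta S (i-1) + j) * v (mu S (i-1) + j))"
  proof -
    have "(\<Sum>c\<in>?A. (\<Sum>i=1..m. \<Sum>j=1..num (S i) - 2.
        if r = eta S (i-1) + j \<and> c = mu S (i-1) + j then 1 else 0) * v c)
      = (\<Sum>i=1..m. \<Sum>j=1..num (S i) - 2. \<Sum>c\<in>?A. (if r = eta S (i-1) + j \<and> c = mu S (i-1) + j then 1 else 0) * v c)"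
      unfolding sum_distrib_right by (subst sum.swap) (intro sum.cong refl sum.swap)
    also have "\<dots> = (\<Sum>i=1..m. \<Sum>j=1..num (S i) - 2. of_bool (r = eta S (i-1) + j) * v (mu S (i-1) + j))"
    proof (intro sum.cong refl sum_if_mult)
      fix i j assume "i \<in> {1..m}" "j \<in> {1..num (S i) - 2}"
      then show "mu S (i-1) + j \<in> ?A" using mu_pred[of i] mu_mono[of i m] by auto
    qed simp
    finally show ?thesis .
  qed
  let ?X = "\<lambda>i. if r = eta S i then alpha S i / (alpha S i + beta m S i)
          else if r = eta S i + 1 then beta m S i / (alpha S i + beta m S i) else 0"
  have X: "?X i = joint_weight i r" if "i < m" for i
    using that by (auto simp: joint_weight_def alpha_eq beta_eq)
  have 2: "(\<Sum>c\<in>?A. (\<Sum>i=1..<m. if c = mu S i - 1 \<or> c = mu S i then ?X i else 0) * v c)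
      = (\<Sum>i=1..<m. joint_weight i r * (v (mu S i - 1) + v (mu S i)))"
  proof -
    have "(\<Sum>c\<in>?A. (\<Sum>i=1..<m. if c = mu S i - 1 \<or> c = mu S i then ?X i else 0) * v c)
      = (\<Sum>i=1..<m. \<Sum>c\<in>?A. (if c = mu S i - 1 \<or> c = mu S i then ?X i else 0) * v c)"
      unfolding sum_distrib_right by (rule sum.swap)
    also have "\<dots> = (\<Sum>i=1..<m. joint_weight i r * (v (mu S i - 1) + v (mu S i)))"
    proof (intro sum.cong refl)
      fix i assume i: "i \<in> {1..<m}"
      have mem: "mu S i - 1 \<in> ?A" "mu S i \<in> ?A"
        using i mu_ge[of i] mu_pred[of "Suc i"] num_ge_3[of "Suc i"] mu_mono[of "Suc i" m] by auto
      have ne: "mu S i - 1 \<noteq> mu S i" using i mu_ge[of i] by auto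
      have "(\<Sum>c\<in>?A. (if c = mu S i - 1 \<or> c = mu S i then ?X i else 0) * v c)
        = (\<Sum>c\<in>{mu S i - 1, mu S i}. ?X i * v c)"
        using mem by (intro sum.mono_neutral_cong_right) auto
      also have "\<dots> = ?X i * (v (mu S i - 1) + v (mu S i))" using ne by (simp add: algebra_simps)
      finally show "(\<Sum>c\<in>?A. (if c = mu S i - 1 \<or> c = mu S i then ?X i else 0) * v c)
        = joint_weight i r * (v (mu S i - 1) + v (mu S i))" using X[of i] i by simp
    qed
    finally show ?thesis .
  qed
  show ?thesis
    unfolding Hc_entry_def distrib_right sum.distrib 1 2 ..
qed

lemma Hc_row_b_vec:
  "(\<Sum>c = 1..mu S m - 2. Hc_entry m S r c * vec_index (b_vec m S x) c) =
     (\<Sum>i=1..m. \<Sum>j=1..num (S i) - 2. of_bool (r = eta S (i-1) + j) * N x i (j + 1)) +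
     (\<Sum>i=1..<m. joint_weight i r * (N x i (num (S i)) + N x (Suc i) 1))"
proof -
  have "vec_index (b_vec m S x) (mu S (i-1) + j) = N x i (j+1)" if "i \<in> {1..m}" "j \<in> {1..num (S i) - 2}" for i j
    using b_vec_index[of i "j+1" x] that by auto
  moreover have "vec_index (b_vec m S x) (mu S i - 1) = N x i (num (S i))" if "i \<in> {1..<m}" for i
    using b_vec_index[of i "num (S i)" x] that mu_pred[of i] num_ge_3[of i] by auto
  moreover have "vec_index (b_vec m S x) (mu S i) = N x (Suc i) 1" if "i \<in> {1..<m}" for i
    using b_vec_index[of "Suc i" 1 x] that num_ge_3[of "Suc i"] by auto
  ultimately show ?thesis unfolding Hc_row_sum by simp
qed

text \<open>The sum over the segments regrouped by joints, in the shape of \<open>Hc_row_b_vec\<close>.\<close>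
lemma glued_expand:
  "glued J r x = J 0 r * N x 1 1 + J m r * N x m (num (S m)) +
     ((\<Sum>i=1..m. \<Sum>j=1..num (S i) - 2. of_bool (r = eta S (i-1) + j) * N x i (j + 1)) +
     (\<Sum>i=1..<m. J i r * (N x i (num (S i)) + N x (Suc i) 1)))"
proof -
  have "(\<Sum>j=1..num (S i). coef J r i j * N x i j) = J (i-1) r * N x i 1 + J i r * N x i (num (S i)) +
      (\<Sum>j=1..num (S i) - 2. of_bool (r = eta S (i-1) + j) * N x i (j + 1))" if i: "i \<in> {1..m}" for i
  proof -
    have k: "3 \<le> num (S i)" by (rule num_ge_3[OF i])
    have "(\<Sum>j=1..num (S i). coef J r i j * N x i j) = (\<Sum>c=0..<num (S i). coef J r i (c+1) * N x i (c+1))"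
      by (rule sum.reindex_bij_witness[of _ "\<lambda>c. c + 1" "\<lambda>j. j - 1"]) auto
    also have "\<dots> = coef J r i 1 * N x i 1 + (\<Sum>c=1..num (S i)-2. coef J r i (c+1) * N x i (c+1))
        + coef J r i (num (S i)) * N x i (num (S i))"
      using k by (subst sum_first_last) auto
    also have "(\<Sum>c=1..num (S i)-2. coef J r i (c+1) * N x i (c+1))
        = (\<Sum>c=1..num (S i)-2. of_bool (r = eta S (i-1) + c) * N x i (c+1))"
      using k by (intro sum.cong refl) (auto simp: coef_def)
    finally show ?thesis using k by (simp add: coef_def)
  qed
  then have "glued J r x = (\<Sum>i=1..m. J (i-1) r * N x i 1) + (\<Sum>i=1..m. J i r * N x i (num (S i)))
      + (\<Sum>i=1..m. \<Sum>j=1..num (S i) - 2. of_bool (r = eta S (i-1) + j) * N x i (j + 1))"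
    unfolding glued_def by (simp add: sum.distrib)
  moreover have "(\<Sum>i=1..m. J (i-1) r * N x i 1) = J 0 r * N x 1 1 + (\<Sum>i=1..<m. J i r * N x (Suc i) 1)"
  proof -
    have "(\<Sum>i=1..m. J (i-1) r * N x i 1) = (\<Sum>i=0..<m. J i r * N x (Suc i) 1)"
      by (rule sum.reindex_bij_witness[of _ "\<lambda>c. c + 1" "\<lambda>j. j - 1"]) auto
    then show ?thesis using m by (subst (asm) sum.atLeast_Suc_lessThan) auto
  qed
  moreover have "(\<Sum>i=1..m. J i r * N x i (num (S i))) = (\<Sum>i=1..<m. J i r * N x i (num (S i))) + J m r * N x m (num (S m))"
    using m by (simp add: sum.last_plus)
  ultimately show ?thesis by (simp add: sum.distrib algebra_simps)
qed

definition nonperiodic_joints :: "nat \<Rightarrow> nat \<Rightarrow> real" where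
  "nonperiodic_joints i r =
     (if i = 0 then of_bool (r = 0) else if i = m then of_bool (r = eta S m + 1) else joint_weight i r)"

definition periodic_joints :: "nat \<Rightarrow> nat \<Rightarrow> real" where
  "periodic_joints i r =
     (if i = 0 \<or> i = m
      then (end_slope (S m) * of_bool (r = eta S m) + start_slope (S 1) * of_bool (r = 1))
             / (end_slope (S m) + start_slope (S 1))
      else joint_weight i r)"

lemma dim_Hc: "dim_row (Hc m S) = eta S m" "dim_col (Hc m S) = mu S m - 2"
  by (auto simp: Hc_def)

lemma mu_m_ge_3: "3 \<le> mu S m"
  using mu_ge[of m] m by simp

lemma eta_pos: "1 \<le> i \<Longrightarrow> i \<le> m \<Longrightarrow> 1 \<le> eta S i"
  using eta_pred[of i] num_ge_3[of i] by auto

lemma b_vec_first: "vec_index (b_vec m S x) 0 = N x 1 1"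
  using b_vec_index[of 1 1 x] m num_ge_3[of 1] by (simp add: mu_def)

lemma b_vec_last: "vec_index (b_vec m S x) (mu S m - 1) = N x m (num (S m))"
  using b_vec_index[of m "num (S m)" x] m mu_pred[of m] num_ge_3[of m] by auto

text \<open>Rows are counted from 0 on the right-hand side: rows 0 and \<open>eta S m + 1\<close> come from the two unit blocks,
and the rows of \<open>Hc\<close> keep their one-based index.\<close>
lemma nonperiodic_basis_eq_glued:
  assumes "j \<in> {1..eta S m + 2}"
  shows "nonperiodic_basis m S j x = glued nonperiodic_joints (j - 1) x"
proof -
  define A where "A = diag_block_mat [1\<^sub>m 1, Hc m S, 1\<^sub>m 1]"
  have mu: "3 \<le> mu S m" by (rule mu_m_ge_3)
  have dimA: "dim_row A = eta S m + 2" "dim_col A = mu S m"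
    using mu by (auto simp: A_def dim_Hc Let_def)
  have entry: "A $$ (r, c) =
      (if r = 0 then of_bool (c = 0) else if r = eta S m + 1 then of_bool (c = mu S m - 1)
       else if c = 0 \<or> c = mu S m - 1 then 0 else Hc_entry m S r c)"
    if "r < eta S m + 2" "c < mu S m" for r c
  proof -
    have raw: "A $$ (r, c) =
      (if r < 1 then if c < 1 then of_bool (r = c) else 0
       else if c < 1 then 0
       else if r - 1 < eta S m then if c - 1 < mu S m - 2 then Hc m S $$ (r - 1, c - 1) else 0
       else if c - 1 < mu S m - 2 then 0 else of_bool (r - 1 - eta S m = c - 1 - (mu S m - 2)))"
      using that mu unfolding A_def by (simp add: Let_def dim_Hc)
    show ?thesis
    proof (cases "r = 0 \<or> c = 0")
      case True
      then show ?thesis unfolding raw using mu by auto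
    next
      case False
      then have rc: "\<not> r < 1" "\<not> c < 1" by auto
      have c: "c - 1 < mu S m - 2 \<longleftrightarrow> c \<noteq> mu S m - 1" "c = mu S m - 1 \<Longrightarrow> c - 1 - (mu S m - 2) = 0"
        using that mu rc by auto
      have r: "r - 1 < eta S m \<longleftrightarrow> r \<noteq> eta S m + 1" "r = eta S m + 1 \<Longrightarrow> r - 1 - eta S m = 0"
        using that rc by auto
      have H: "Hc m S $$ (r - 1, c - 1) = Hc_entry m S r c" if "r \<noteq> eta S m + 1" "c \<noteq> mu S m - 1"
        using that c(1) r(1) rc by (simp add: Hc_def)
      show ?thesis unfolding raw using False rc c r H by simp
    qed
  qed
  define r where "r = j - 1"
  have r: "r < eta S m + 2" using assms by (auto simp: r_def)
  have "nonperiodic_basis m S j x = (\<Sum>c = 0..<mu S m. A $$ (r, c) * vec_index (b_vec m S x) c)"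
    unfolding nonperiodic_basis_def A_def[symmetric] r_def[symmetric]
    using r by (simp add: dimA scalar_prod_def dim_b_vec)
  also have "\<dots> = A $$ (r, 0) * N x 1 1 + (\<Sum>c = 1..mu S m - 2. A $$ (r, c) * vec_index (b_vec m S x) c)
      + A $$ (r, mu S m - 1) * N x m (num (S m))"
    unfolding sum_first_last[OF mu] b_vec_first b_vec_last ..
  also have "(\<Sum>c = 1..mu S m - 2. A $$ (r, c) * vec_index (b_vec m S x) c) =
     (\<Sum>i=1..m. \<Sum>j=1..num (S i) - 2. of_bool (r = eta S (i-1) + j) * N x i (j + 1)) +
     (\<Sum>i=1..<m. nonperiodic_joints i r * (N x i (num (S i)) + N x (Suc i) 1))"
  proof (cases "r = 0 \<or> r = eta S m + 1")
    case True
    have "A $$ (r, c) = 0" if "c \<in> {1..mu S m - 2}" for c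
      using True mu that r by (subst entry) auto
    moreover have "r \<noteq> eta S (i-1) + j" if "i \<in> {1..m}" "j \<in> {1..num (S i) - 2}" for i j
      using True that eta_pred[of i] eta_mono[of i m] by auto
    moreover have "nonperiodic_joints i r = 0" if "i \<in> {1..<m}" for i
      using True that eta_pos[of i] eta_mono[of "Suc i" m] eta_pred[of "Suc i"] num_ge_3[of "Suc i"]
      by (auto simp: nonperiodic_joints_def joint_weight_def)
    ultimately show ?thesis by simp
  next
    case False
    have "(\<Sum>c = 1..mu S m - 2. A $$ (r, c) * vec_index (b_vec m S x) c)
        = (\<Sum>c = 1..mu S m - 2. Hc_entry m S r c * vec_index (b_vec m S x) c)"
      using False r mu by (intro sum.cong refl) (subst entry, auto)
    then show ?thesis unfolding Hc_row_b_vec by (simp add: nonperiodic_joints_def)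
  qed
  finally show ?thesis
    unfolding glued_expand r_def[symmetric] using r mu m
    by (subst (asm) (1 2) entry) (auto simp: nonperiodic_joints_def)
qed

text \<open>With at least two rows, the top and the bottom entry of \<open>h_vec\<close> are in different places, so that
\<open>h_vec\<close> is the sum that occurs in \<open>periodic_joints\<close>.\<close>
lemma periodic_basis_eq_glued:
  assumes "2 \<le> eta S m" "j \<in> {1..eta S m}"
  shows "periodic_basis m S j x = glued periodic_joints j x"
proof -
  define A where "A = mat_of_cols (eta S m) ([h_vec m S] @ cols (Hc m S) @ [h_vec m S])"
  have mu: "3 \<le> mu S m" by (rule mu_m_ge_3)
  have dimA: "dim_row A = eta S m" "dim_col A = mu S m"
    using mu by (auto simp: A_def dim_Hc)
  define r where "r = j - 1"
  have r: "r < eta S m" "j = r + 1" using assms by (auto simp: r_def)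
  have h: "vec_index (h_vec m S) r = periodic_joints m j"
    using r assms by (auto simp: h_vec_def periodic_joints_def alpha_eq beta_eq add.commute)
  have A_first: "A $$ (r, 0) = periodic_joints m j"
    using r mu h unfolding A_def by (subst mat_of_cols_index) (auto simp: dim_Hc)
  have A_last: "A $$ (r, mu S m - 1) = periodic_joints m j"
    using r mu h unfolding A_def by (subst mat_of_cols_index) (auto simp: dim_Hc nth_append)
  have A_mid: "A $$ (r, c) = Hc_entry m S j c" if "c \<in> {1..mu S m - 2}" for c
    using r mu that unfolding A_def
    by (subst mat_of_cols_index) (auto simp: dim_Hc nth_append nth_Cons', auto simp: Hc_def)
  have "periodic_basis m S j x = (\<Sum>c = 0..<mu S m. A $$ (r, c) * vec_index (b_vec m S x) c)"
    unfolding periodic_basis_def A_def[symmetric] r_def[symmetric]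
    using r by (simp add: dimA scalar_prod_def dim_b_vec)
  also have "\<dots> = A $$ (r, 0) * N x 1 1 + (\<Sum>c = 1..mu S m - 2. A $$ (r, c) * vec_index (b_vec m S x) c)
      + A $$ (r, mu S m - 1) * N x m (num (S m))"
    unfolding sum_first_last[OF mu] b_vec_first b_vec_last ..
  also have "(\<Sum>c = 1..mu S m - 2. A $$ (r, c) * vec_index (b_vec m S x) c)
    = (\<Sum>c = 1..mu S m - 2. Hc_entry m S j c * vec_index (b_vec m S x) c)"
    by (intro sum.cong refl) (simp only: A_mid)
  finally show ?thesis
    unfolding glued_expand Hc_row_b_vec A_first A_last using m by (simp add: periodic_joints_def)
qed

end

context segment_chain
begin

lemma start_slope_pos: "i \<in> {1..m} \<Longrightarrow> 0 < start_slope (S i)"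
  by (rule rational_segment.start_slope_pos[OF rational_segment])

lemma end_slope_pos: "i \<in> {1..m} \<Longrightarrow> 0 < end_slope (S i)"
  by (rule rational_segment.end_slope_pos[OF rational_segment])

lemma sum_weighted_pair:
  fixes a b :: real
  assumes "finite R" "u \<in> R" "v \<in> R" "0 < a" "0 < b"
  shows "(\<Sum>r\<in>R. (a * of_bool (r = u) + b * of_bool (r = v)) / (a + b)) = 1"
proof -
  have "(\<Sum>r\<in>R. (a * of_bool (r = u) + b * of_bool (r = v)) / (a + b)) = (a + b) / (a + b)"
    unfolding sum_divide_distrib[symmetric] sum.distrib
    using sum_of_bool_mult[OF assms(1,2), of "\<lambda>_. a"] sum_of_bool_mult[OF assms(1,3), of "\<lambda>_. b"] by simp
  then show ?thesis using assms by simp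
qed

lemma joint_weight_nonneg: "1 \<le> i \<Longrightarrow> i < m \<Longrightarrow> 0 \<le> joint_weight i r"
  using end_slope_pos[of i] start_slope_pos[of "Suc i"] unfolding joint_weight_def by auto

lemma joint_weight_sum:
  assumes "1 \<le> i" "i < m" "finite R" "{1..eta S m} \<subseteq> R"
  shows "(\<Sum>r\<in>R. joint_weight i r) = 1"
proof -
  have "eta S i + 1 \<le> eta S m" using eta_pred[of "Suc i"] num_ge_3[of "Suc i"] eta_mono[of "Suc i" m] assms by auto
  then have "eta S i \<in> R" "eta S i + 1 \<in> R" using assms eta_pos[of i] by auto
  then show ?thesis unfolding joint_weight_def
    using assms end_slope_pos[of i] start_slope_pos[of "Suc i"] by (intro sum_weighted_pair) auto
qed

lemma periodic_joints_nonneg: "i \<le> m \<Longrightarrow> 0 \<le> periodic_joints i r"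
  using end_slope_pos[of m] start_slope_pos[of 1] joint_weight_nonneg[of i r] m unfolding periodic_joints_def by auto

lemma nonperiodic_joints_nonneg: "i \<le> m \<Longrightarrow> 0 \<le> nonperiodic_joints i r"
  using joint_weight_nonneg[of i r] unfolding nonperiodic_joints_def by auto

definition periodic_deriv :: "nat \<Rightarrow> real \<Rightarrow> real" where
  "periodic_deriv j = glued' periodic_joints j"

definition nonperiodic_deriv :: "nat \<Rightarrow> real \<Rightarrow> real" where
  "nonperiodic_deriv j = glued' nonperiodic_joints (j - 1)"

lemma periodic_basis_fun:
  "2 \<le> eta S m \<Longrightarrow> j \<in> {1..eta S m} \<Longrightarrow> periodic_basis m S j = glued periodic_joints j"
  using periodic_basis_eq_glued by blast

lemma nonperiodic_basis_fun:
  "j \<in> {1..eta S m + 2} \<Longrightarrow> nonperiodic_basis m S j = glued nonperiodic_joints (j - 1)"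
  using nonperiodic_basis_eq_glued by blast

lemma periodic_basis_nonneg:
  assumes "2 \<le> eta S m" "j \<in> {1..eta S m}" "x \<in> {0..offset S (Suc m)}"
  shows "0 \<le> periodic_basis m S j x"
  unfolding periodic_basis_fun[OF assms(1,2)] by (intro glued_nonneg assms periodic_joints_nonneg)

text \<open>The two ends of the interval are treated like a joint between the last and the first segment, so
values and derivatives at 0 and at the right end agree for the same reason as at the other joints.\<close>
lemma periodic_basis_family:
  assumes "2 \<le> eta S m"
  shows "periodic_family (eta S m) (offset S (Suc m)) (periodic_basis m S) periodic_deriv"
proof
  show "0 < offset S (Suc m)" by (rule length_pos)
  have pos: "0 < end_slope (S m)" "0 < start_slope (S 1)" using end_slope_pos start_slope_pos m by auto
  fix j assume j: "j \<in> {1..eta S m}"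
  show "C1_on 0 (offset S (Suc m)) (periodic_basis m S j) (periodic_deriv j)"
    unfolding periodic_basis_fun[OF assms j] periodic_deriv_def by (rule glued_C1) (simp add: periodic_joints_def)
  show "periodic_basis m S j 0 = periodic_basis m S j (offset S (Suc m))"
    unfolding periodic_basis_fun[OF assms j] glued_at_0 glued_at_length by (simp add: periodic_joints_def)
  show "periodic_deriv j 0 = periodic_deriv j (offset S (Suc m))"
    using pos unfolding periodic_deriv_def glued'_at_0 glued'_at_length
    by (simp add: periodic_joints_def of_bool_def field_simps)
next
  fix s assume s: "s \<in> {0..offset S (Suc m)}"
  have "(\<Sum>j=1..eta S m. periodic_basis m S j s) = (\<Sum>j\<in>{1..eta S m}. glued periodic_joints j s)"
    using periodic_basis_fun[OF assms] by (intro sum.cong) auto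
  also have "\<dots> = 1"
  proof (rule glued_partition_of_unity[OF s])
    fix i assume i: "i \<le> m"
    show "(\<Sum>r\<in>{1..eta S m}. periodic_joints i r) = 1"
    proof (cases "i = 0 \<or> i = m")
      case True
      then show ?thesis
        using assms end_slope_pos[of m] start_slope_pos[of 1] m
        unfolding periodic_joints_def by (simp only: if_True) (intro sum_weighted_pair, auto)
    next
      case False
      then show ?thesis using joint_weight_sum[of i "{1..eta S m}"] i by (simp add: periodic_joints_def)
    qed
  qed auto
  finally show "(\<Sum>j=1..eta S m. periodic_basis m S j s) = 1" .
qed

lemma periodic_basis_independent:
  assumes "2 \<le> eta S m" and j: "j \<in> {1..eta S m}"
    and 0: "\<And>x. x \<in> {0..offset S (Suc m)} \<Longrightarrow> (\<Sum>j=1..eta S m. c j * periodic_basis m S j x) = 0"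
  shows "c j = 0"
proof (rule glued_independent(1)[of "{1..eta S m}" c periodic_joints])
  fix x assume x: "x \<in> {0..offset S (Suc m)}"
  have "(\<Sum>j\<in>{1..eta S m}. c j * glued periodic_joints j x) = (\<Sum>j=1..eta S m. c j * periodic_basis m S j x)"
    using periodic_basis_fun[OF assms(1)] by (intro sum.cong) auto
  then show "(\<Sum>j\<in>{1..eta S m}. c j * glued periodic_joints j x) = 0" using 0[OF x] by simp
qed (use j in auto)

lemma nonperiodic_basis_nonneg:
  assumes "j \<in> {1..eta S m + 2}" "x \<in> {0..offset S (Suc m)}"
  shows "0 \<le> nonperiodic_basis m S j x"
  unfolding nonperiodic_basis_fun[OF assms(1)] by (intro glued_nonneg assms nonperiodic_joints_nonneg)

lemma nonperiodic_basis_C1: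
  assumes "j \<in> {1..eta S m + 2}"
  shows "C1_on 0 (offset S (Suc m)) (nonperiodic_basis m S j) (nonperiodic_deriv j)"
  unfolding nonperiodic_basis_fun[OF assms] nonperiodic_deriv_def
  by (rule glued_C1) (simp add: nonperiodic_joints_def)

lemma nonperiodic_basis_shift:
  "(\<Sum>j=1..eta S m + 2. c (j - 1) * nonperiodic_basis m S j x) =
     (\<Sum>r\<in>{0..eta S m + 1}. c r * glued nonperiodic_joints r x)"
  by (rule sum.reindex_bij_witness[of _ "\<lambda>r. r + 1" "\<lambda>j. j - 1"])
     (auto simp: nonperiodic_basis_fun)

lemma nonperiodic_joints_ends:
  "nonperiodic_joints 0 r = of_bool (r = 0)" "nonperiodic_joints m r = of_bool (r = eta S m + 1)"
  using m by (auto simp: nonperiodic_joints_def)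

lemma nonperiodic_basis_sum:
  assumes x: "x \<in> {0..offset S (Suc m)}"
  shows "(\<Sum>j=1..eta S m + 2. nonperiodic_basis m S j x) = 1"
proof -
  have "(\<Sum>r\<in>{0..eta S m + 1}. glued nonperiodic_joints r x) = 1"
  proof (rule glued_partition_of_unity[OF x])
    fix i assume i: "i \<le> m"
    show "(\<Sum>r\<in>{0..eta S m + 1}. nonperiodic_joints i r) = 1"
    proof (cases "i = 0 \<or> i = m")
      case True
      have "(\<Sum>r\<in>{0..eta S m + 1}. 1 * of_bool (r = n)) = (1::real)" if "n \<in> {0..eta S m + 1}" for n
        by (rule sum_of_bool_mult) (use that in auto)
      from this[of 0] this[of "eta S m + 1"] show ?thesis using True by (auto simp: nonperiodic_joints_ends)
    next
      case False
      then show ?thesis using joint_weight_sum[of i "{0..eta S m + 1}"] i by (simp add: nonperiodic_joints_def)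
    qed
  qed auto
  then show ?thesis using nonperiodic_basis_shift[of "\<lambda>_. 1" x] by simp
qed

lemma nonperiodic_basis_independent:
  assumes j: "j \<in> {1..eta S m + 2}"
    and 0: "\<And>x. x \<in> {0..offset S (Suc m)} \<Longrightarrow> (\<Sum>j=1..eta S m + 2. c j * nonperiodic_basis m S j x) = 0"
  shows "c j = 0"
proof -
  define d where "d r = c (r + 1)" for r
  let ?R = "{0..eta S m + 1}"
  have d0: "(\<Sum>r\<in>?R. d r * glued nonperiodic_joints r x) = 0" if "x \<in> {0..offset S (Suc m)}" for x
  proof -
    have "(\<Sum>j=1..eta S m + 2. d (j - 1) * nonperiodic_basis m S j x)
        = (\<Sum>j=1..eta S m + 2. c j * nonperiodic_basis m S j x)"
      by (intro sum.cong) (auto simp: d_def)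
    then show ?thesis using nonperiodic_basis_shift[of d x] 0[OF that] by simp
  qed
  have R: "finite ?R" "{1..eta S m} \<subseteq> ?R" by auto
  have ends: "(\<Sum>r\<in>?R. d r * nonperiodic_joints i r) = 0" if "i \<le> m" for i
    by (rule glued_independent(2)[OF R d0 that])
  have "d 0 = 0" using ends[of 0] sum_of_bool_mult[of ?R 0 d] unfolding nonperiodic_joints_ends by simp
  moreover have "d (eta S m + 1) = 0"
    using ends[of m] sum_of_bool_mult[of ?R "eta S m + 1" d] unfolding nonperiodic_joints_ends by simp
  moreover have "d r = 0" if "r \<in> {1..eta S m}" for r by (rule glued_independent(1)[OF R d0 that])
  moreover have "j - 1 = 0 \<or> j - 1 = eta S m + 1 \<or> j - 1 \<in> {1..eta S m}" using j by auto
  ultimately have "d (j - 1) = 0" by metis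
  then show ?thesis using j by (simp add: d_def)
qed

lemma nonperiodic_basis_at_0:
  assumes "j \<in> {1..eta S m + 2}"
  shows "nonperiodic_basis m S j 0 = of_bool (j = 1)"
    and "nonperiodic_deriv j 0 = start_slope (S 1) * (of_bool (j = 2) - of_bool (j = 1))"
proof -
  have "j - 1 = 0 \<longleftrightarrow> j = 1" "j - 1 = 1 \<longleftrightarrow> j = 2" using assms by auto
  then show "nonperiodic_basis m S j 0 = of_bool (j = 1)"
    "nonperiodic_deriv j 0 = start_slope (S 1) * (of_bool (j = 2) - of_bool (j = 1))"
    unfolding nonperiodic_basis_fun[OF assms] nonperiodic_deriv_def glued_at_0 glued'_at_0 nonperiodic_joints_ends
    by (simp_all only:)
qed

lemma nonperiodic_basis_at_length:
  assumes "j \<in> {1..eta S m + 2}"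
  shows "nonperiodic_basis m S j (offset S (Suc m)) = of_bool (j = eta S m + 2)"
    and "nonperiodic_deriv j (offset S (Suc m)) = end_slope (S m) * (of_bool (j = eta S m + 2) - of_bool (j = eta S m + 1))"
proof -
  have "j - 1 = eta S m + 1 \<longleftrightarrow> j = eta S m + 2" "j - 1 = eta S m \<longleftrightarrow> j = eta S m + 1"
    using assms eta_pos[of m] m by auto
  then show "nonperiodic_basis m S j (offset S (Suc m)) = of_bool (j = eta S m + 2)"
    "nonperiodic_deriv j (offset S (Suc m)) = end_slope (S m) * (of_bool (j = eta S m + 2) - of_bool (j = eta S m + 1))"
    unfolding nonperiodic_basis_fun[OF assms] nonperiodic_deriv_def glued_at_length glued'_at_length nonperiodic_joints_ends
    by (simp_all only:)
qed

end

section \<open>The extraction matrix\<close>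

text \<open>\<open>1 / 3 + pole_coef a x y\<close> is the barycentric coordinate of \<open>(x, y)\<close> for vertex \<open>a\<close> of the equilateral
triangle with vertices \<open>(2, 0)\<close>, \<open>(- 1, sqrt 3)\<close>, \<open>(- 1, - sqrt 3)\<close>.\<close>
definition pole_coef :: "nat \<Rightarrow> real \<Rightarrow> real \<Rightarrow> real" where
  "pole_coef a x y = (if a = 0 then x / 3 else if a = 1 then - x / 6 + sqrt 3 / 6 * y else - x / 6 - sqrt 3 / 6 * y)"

lemma dim_E_bar: "dim_row (E_bar ns) = 3" "dim_col (E_bar ns) = 2 * ns"
  by (auto simp: E_bar_def)

lemma E_bar_entry:
  assumes "a < 3" "c < 2 * ns"
  shows "E_bar ns $$ (a, c) =
    (if c < ns then 1 / 3
     else 1 / 3 + pole_coef a (cos (theta ns (c - ns + 1))) (sin (theta ns (c - ns + 1))))"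
proof -
  have a: "a = 0 \<or> a = 1 \<or> a = 2" using assms by auto
  show ?thesis
  proof (cases "c < ns")
    case True
    then have "E_bar ns $$ (a, c) = vec_index (vec_of_list [1/3, 1/3, 1/3]) a"
      using assms unfolding E_bar_def by (subst mat_of_cols_index) (auto simp: nth_append)
    then show ?thesis using True a unfolding vec_of_list_index by auto
  next
    case False
    have "E_bar ns $$ (a, c) = vec_index (mat_of_rows_list 3 [[ 1/3,           0, 1/3],
                                  [-1/6,  sqrt 3 / 6, 1/3],
                                  [-1/6, -sqrt 3 / 6, 1/3]]
                *\<^sub>v vec_of_list [cos (theta ns (c - ns + 1)), sin (theta ns (c - ns + 1)), 1]) a"
      using assms False unfolding E_bar_def
      by (subst mat_of_cols_index) (auto simp: nth_append simp del: upt_Suc)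
    also have "\<dots> = 1 / 3 + pole_coef a (cos (theta ns (c - ns + 1))) (sin (theta ns (c - ns + 1)))"
      using a by (auto simp: mat_of_rows_list_def scalar_prod_def pole_coef_def numeral_3_eq_3 numeral_2_eq_2 sum.atLeast0_lessThan_Suc)
    finally show ?thesis using False by simp
  qed
qed

lemma exchange_E_bar_exchange:
  assumes "a < 3" "c < 2 * ns"
  shows "(exchange_mat 3 * E_bar ns * exchange_mat (2 * ns)) $$ (a, c) = E_bar ns $$ (2 - a, 2 * ns - 1 - c)"
proof -
  have 1: "(exchange_mat 3 * E_bar ns) $$ (a, c') = E_bar ns $$ (2 - a, c')" if "c' < 2 * ns" for c'
  proof -
    have "(exchange_mat 3 * E_bar ns) $$ (a, c') = (\<Sum>i = 0..<3. exchange_mat 3 $$ (a, i) * E_bar ns $$ (i, c'))"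
      using assms that by (simp add: scalar_prod_def dim_E_bar exchange_mat_def)
    also have "\<dots> = (\<Sum>i = 0..<3. if i = 2 - a then E_bar ns $$ (i, c') else 0)"
      using assms by (intro sum.cong refl) (auto simp: exchange_mat_def)
    also have "\<dots> = E_bar ns $$ (2 - a, c')" by simp
    finally show ?thesis .
  qed
  have "(exchange_mat 3 * E_bar ns * exchange_mat (2 * ns)) $$ (a, c)
      = (\<Sum>i = 0..<2 * ns. (exchange_mat 3 * E_bar ns) $$ (a, i) * exchange_mat (2 * ns) $$ (i, c))"
    using assms by (subst index_mult_mat) (auto simp: scalar_prod_def dim_E_bar exchange_mat_def)
  also have "\<dots> = (\<Sum>i = 0..<2 * ns. if i = 2 * ns - 1 - c then (exchange_mat 3 * E_bar ns) $$ (a, i) else 0)"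
    using assms by (intro sum.cong refl) (auto simp: exchange_mat_def)
  also have "\<dots> = (exchange_mat 3 * E_bar ns) $$ (a, 2 * ns - 1 - c)"
    using assms by simp
  also have "\<dots> = E_bar ns $$ (2 - a, 2 * ns - 1 - c)" using assms by (intro 1) auto
  finally show ?thesis .
qed

lemma dim_E_mat:
  assumes "4 \<le> nt"
  shows "dim_row (E_mat ns nt) = ns * (nt - 4) + 6" "dim_col (E_mat ns nt) = ns * nt"
proof -
  obtain k where k: "nt = k + 4" using assms by (metis add.commute le_iff_add)
  show "dim_row (E_mat ns nt) = ns * (nt - 4) + 6" "dim_col (E_mat ns nt) = ns * nt"
    by (auto simp: E_mat_def Let_def dim_E_bar exchange_mat_def k algebra_simps)
qed

lemma E_mat_entry:
  assumes "4 \<le> nt" "r < ns * (nt - 4) + 6" "q < ns * nt"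
  shows "E_mat ns nt $$ (r, q) =
    (if r < 3 then if q < 2 * ns then E_bar ns $$ (r, q) else 0
     else if r < ns * (nt - 4) + 3 then of_bool (q = 2 * ns + (r - 3))
     else if ns * nt - 2 * ns \<le> q then E_bar ns $$ (ns * (nt - 4) + 5 - r, ns * nt - 1 - q) else 0)"
proof -
  define M where "M = ns * (nt - 4)"
  define Z where "Z = exchange_mat 3 * E_bar ns * exchange_mat (2 * ns)"
  have dimZ: "dim_row Z = 3" "dim_col Z = 2 * ns" by (auto simp: Z_def exchange_mat_def)
  have M: "ns * nt = M + 4 * ns" using assms(1) unfolding M_def by (simp add: diff_mult_distrib2)
  have raw: "E_mat ns nt $$ (r, q) =
     (if r < 3 then if q < 2 * ns then E_bar ns $$ (r, q) else 0
      else if q < 2 * ns then 0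
      else if r - 3 < M then if q - 2 * ns < M then of_bool (r - 3 = q - 2 * ns) else 0
      else if q - 2 * ns < M then 0 else Z $$ (r - 3 - M, q - 2 * ns - M))"
    using assms M unfolding E_mat_def Z_def[symmetric] M_def[symmetric]
    by (simp add: Let_def dim_E_bar dimZ)
  show ?thesis
  proof (cases "r < 3 + M")
    case True
    then show ?thesis unfolding raw M_def[symmetric] by auto
  next
    case False
    have "Z $$ (r - 3 - M, q - 2 * ns - M) = E_bar ns $$ (M + 5 - r, ns * nt - 1 - q)"
      if "2 * ns + M \<le> q"
    proof -
      have e: "2 - (r - 3 - M) = M + 5 - r" "2 * ns - 1 - (q - 2 * ns - M) = ns * nt - 1 - q"
        using False that assms M by auto
      have "r - 3 - M < 3" "q - 2 * ns - M < 2 * ns"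
        using False that assms M unfolding M_def by auto
      then show ?thesis
        unfolding Z_def by (simp only: exchange_E_bar_exchange e)
    qed
    then show ?thesis unfolding raw M_def[symmetric] using False M by auto
  qed
qed

text \<open>Reversing the order of the rows and columns at the second pole turns \<open>theta\<close> into \<open>theta_hat\<close>.\<close>
lemma theta_reflect:
  assumes "1 \<le> i" "i \<le> ns"
  shows "theta ns (ns + 1 - i) = theta_hat ns i"
  using assms by (simp add: theta_hat_def theta_def of_nat_diff field_simps)

text \<open>The entry of the extraction matrix for \<open>N l\<close> and \<open>B i j\<close>, with one-based indices.\<close>
definition E_coef :: "nat \<Rightarrow> nat \<Rightarrow> nat \<Rightarrow> nat \<Rightarrow> nat \<Rightarrow> real" where
  "E_coef ns nt l i j = E_mat ns nt $$ (l - 1, (i - 1) + (j - 1) * ns)"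

lemma index_less:
  assumes "i \<in> {1..ns}" "j \<in> {1..nt}"
  shows "(i - 1) + (j - 1) * ns < ns * (nt::nat)"
proof -
  have "i - 1 < ns" using assms by auto
  then have "(i - 1) + (j - 1) * ns < ns + (j - 1) * ns" by simp
  also have "\<dots> = ns * j" using assms by (cases j) (auto simp: algebra_simps)
  also have "\<dots> \<le> ns * nt" using assms by simp
  finally show ?thesis .
qed

lemma E_coef_first:
  assumes "4 \<le> nt" "l \<in> {1..3}" "i \<in> {1..ns}" "j \<in> {1..nt}"
  shows "E_coef ns nt l i j =
    (if j = 1 then 1 / 3
     else if j = 2 then 1 / 3 + pole_coef (l - 1) (cos (theta ns i)) (sin (theta ns i)) else 0)"
proof -
  have q: "(i - 1) + (j - 1) * ns < ns * nt" using index_less assms by auto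
  have l: "l - 1 < 3" "l - 1 < ns * (nt - 4) + 6" using assms by auto
  consider "j = 1" | "j = 2" | "3 \<le> j"
    using assms(4) by force
  then show ?thesis
  proof cases
    case 3
    then have "2 * ns \<le> (j - 1) * ns" by (intro mult_right_mono) auto
    then have "\<not> (i - 1) + (j - 1) * ns < 2 * ns" by linarith
    then show ?thesis using 3 unfolding E_coef_def E_mat_entry[OF assms(1) l(2) q] using l by simp
  qed (use assms l q in \<open>auto simp: E_coef_def E_mat_entry E_bar_entry\<close>)
qed

lemma E_coef_last:
  assumes "4 \<le> nt" "l + a = ns * (nt - 4) + 6" "a < 3" "i \<in> {1..ns}" "j \<in> {1..nt}"
  shows "E_coef ns nt l i j =
    (if j = nt then 1 / 3
     else if j = nt - 1 then 1 / 3 + pole_coef a (cos (theta_hat ns i)) (sin (theta_hat ns i)) else 0)"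
proof -
  define q where "q = (i - 1) + (j - 1) * ns"
  have q: "q < ns * nt" unfolding q_def using index_less assms by auto
  have r: "l - 1 < ns * (nt - 4) + 6" "\<not> l - 1 < 3" "\<not> l - 1 < ns * (nt - 4) + 3" "ns * (nt - 4) + 5 - (l - 1) = a"
    using assms by auto
  have E: "E_coef ns nt l i j = (if ns * nt - 2 * ns \<le> q then E_bar ns $$ (a, ns * nt - 1 - q) else 0)"
    unfolding E_coef_def q_def[symmetric] E_mat_entry[OF assms(1) r(1) q] using r by (simp only: if_False)
  obtain k where k: "nt = j + k" using assms(5) by (metis atLeastAtMost_iff le_iff_add)
  have "ns * j = (j - 1) * ns + ns" using assms(5) by (cases j) auto
  then have nsnt: "ns * nt = (j - 1) * ns + ns + k * ns" unfolding k by (simp add: algebra_simps)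
  consider "k = 0" | "k = 1" | "2 \<le> k" by linarith
  then show ?thesis
  proof cases
    case 1
    then have "ns * nt - 1 - q = ns - i" "ns * nt - 2 * ns \<le> q"
      using nsnt assms by (auto simp: q_def)
    moreover have "ns - i < ns" using assms(4) by auto
    ultimately show ?thesis unfolding E using 1 k assms E_bar_entry[of a "ns - i" ns] by simp
  next
    case 2
    then have *: "ns * nt - 1 - q = ns + (ns - i)" "ns * nt - 2 * ns \<le> q"
      using nsnt assms by (auto simp: q_def)
    have "ns + (ns - i) < 2 * ns" "\<not> ns + (ns - i) < ns" "ns + (ns - i) - ns + 1 = ns + 1 - i"
      using assms(4) by auto
    then have "E_bar ns $$ (a, ns + (ns - i)) = 1 / 3 + pole_coef a (cos (theta_hat ns i)) (sin (theta_hat ns i))"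
      using E_bar_entry[of a "ns + (ns - i)" ns] assms theta_reflect[of i ns] by simp
    then show ?thesis unfolding E * using *(2) 2 k by simp
  next
    case 3
    then have "2 * ns \<le> k * ns" by (intro mult_right_mono) auto
    moreover have "i - 1 < ns" using assms(4) by auto
    then have "q < (j - 1) * ns + ns" by (simp add: q_def)
    ultimately have "\<not> ns * nt - 2 * ns \<le> q" using nsnt by linarith
    then show ?thesis unfolding E using 3 k by auto
  qed
qed

lemma E_coef_middle:
  assumes "4 \<le> nt" "4 \<le> l" "l \<le> ns * (nt - 4) + 3" "i \<in> {1..ns}" "j \<in> {1..nt}"
  shows "E_coef ns nt l i j = of_bool ((i - 1) + (j - 1) * ns + 4 = 2 * ns + l)"
proof -
  have q: "(i - 1) + (j - 1) * ns < ns * nt" using index_less assms by auto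
  have l: "l - 1 < ns * (nt - 4) + 6" "\<not> l - 1 < 3" "l - 1 < ns * (nt - 4) + 3" using assms by auto
  have "((i - 1) + (j - 1) * ns = 2 * ns + (l - 1 - 3)) = ((i - 1) + (j - 1) * ns + 4 = 2 * ns + l)"
    using assms(2) by auto
  then show ?thesis
    unfolding E_coef_def E_mat_entry[OF assms(1) l(1) q] using l(2,3) by simp
qed

lemma E_coef_middle_pole:
  assumes "4 \<le> nt" "4 \<le> l" "l \<le> ns * (nt - 4) + 3" "i \<in> {1..ns}" "j \<in> {1, 2, nt - 1, nt}"
  shows "E_coef ns nt l i j = 0"
proof -
  have j: "j \<in> {1..nt}" using assms by auto
  have "(i - 1) + (j - 1) * ns + 4 \<noteq> 2 * ns + l"
  proof (cases "j \<le> 2")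
    case True
    then have "(j - 1) * ns \<le> 1 * ns" by (intro mult_right_mono) auto
    then show ?thesis using assms by auto
  next
    case False
    then have "(nt - 2) * ns \<le> (j - 1) * ns" using assms by (intro mult_right_mono) auto
    moreover have "(nt - 2) * ns = ns * (nt - 4) + 2 * ns"
    proof -
      obtain k where "nt = k + 4" using assms(1) by (metis add.commute le_iff_add)
      then show ?thesis by (simp add: algebra_simps)
    qed
    ultimately show ?thesis using assms by auto
  qed
  then show ?thesis using E_coef_middle[OF assms(1-4) j] by simp
qed

lemma sum_first_three_last_three:
  fixes g :: "nat \<Rightarrow> 'a::real_vector"
  shows "(\<Sum>l=1..M+6. g l) = (g 1 + g 2 + g 3) + (\<Sum>l=4..M+3. g l) + (g (M+6) + g (M+5) + g (M+4))"
proof -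
  have "{1..M+6} = {1,2,3} \<union> ({4..M+3} \<union> {M+6,M+5,M+4})" by auto
  moreover have "sum g ({1,2,3} \<union> ({4..M+3} \<union> {M+6,M+5,M+4})) = sum g {1,2,3} + sum g ({4..M+3} \<union> {M+6,M+5,M+4})"
    by (intro sum.union_disjoint) auto
  moreover have "sum g ({4..M+3} \<union> {M+6,M+5,M+4}) = sum g {4..M+3} + sum g {M+6,M+5,M+4}"
    by (intro sum.union_disjoint) auto
  ultimately show ?thesis by (simp add: add.assoc)
qed

text \<open>The coefficient of \<open>B i j\<close> in the polar surface with control points \<open>f\<close>.\<close>
definition tensor_control_point :: "nat \<Rightarrow> nat \<Rightarrow> (nat \<Rightarrow> 'a::real_vector) \<Rightarrow> nat \<Rightarrow> nat \<Rightarrow> 'a" where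
  "tensor_control_point ns nt f i j = (\<Sum>l=1..ns * (nt - 4) + 6. E_coef ns nt l i j *\<^sub>R f l)"

text \<open>The linear part of the affine map that sends a point of the plane to the combination of
\<open>g 0\<close>, \<open>g 1\<close>, \<open>g 2\<close> with its barycentric coordinates; \<open>pole_center\<close> is its value at 0.\<close>
definition pole_map :: "(nat \<Rightarrow> 'a::real_vector) \<Rightarrow> real \<times> real \<Rightarrow> 'a" where
  "pole_map g w = pole_coef 0 (fst w) (snd w) *\<^sub>R g 0 + pole_coef 1 (fst w) (snd w) *\<^sub>R g 1
     + pole_coef 2 (fst w) (snd w) *\<^sub>R g 2"

definition pole_center :: "(nat \<Rightarrow> 'a::real_vector) \<Rightarrow> 'a" where
  "pole_center g = (1 / 3) *\<^sub>R (g 0 + g 1 + g 2)"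

text \<open>The rows \<open>j = 1\<close> and \<open>j = 2\<close> of control points are the images of the origin and of points of the unit
circle under one affine map. The control points of the polar map in these rows are the origin and
\<open>1 / (nt - 1)\<close> times the same points of the circle.\<close>
lemma control_point_first_pole:
  assumes "4 \<le> nt" "i \<in> {1..ns}"
  shows "tensor_control_point ns nt f i 1 = pole_center (\<lambda>a. f (a + 1))" (is ?A)
    and "tensor_control_point ns nt f i 2 = pole_center (\<lambda>a. f (a + 1))
           + pole_map (\<lambda>a. f (a + 1)) (cos (theta ns i), sin (theta ns i))" (is ?B)
proof -
  define M where "M = ns * (nt - 4)"
  have j: "1 \<in> {1..nt}" "2 \<in> {1..nt}" "(2::nat) \<noteq> 1" using assms(1) by auto
  have last: "E_coef ns nt (M + 6) i j = 0" "E_coef ns nt (M + 5) i j = 0" "E_coef ns nt (M + 4) i j = 0"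
    if "j = 1 \<or> j = 2" for j
    using E_coef_last[of nt "M + 6" 0 ns i j] E_coef_last[of nt "M + 5" 1 ns i j]
      E_coef_last[of nt "M + 4" 2 ns i j] that assms by (auto simp: M_def)
  have mid: "(\<Sum>l=4..M+3. E_coef ns nt l i j *\<^sub>R f l) = 0" if "j = 1 \<or> j = 2" for j
    using E_coef_middle_pole[of nt _ ns i j] that assms by (intro sum.neutral) (auto simp: M_def)
  have first: "E_coef ns nt 1 i 1 = 1 / 3" "E_coef ns nt 2 i 1 = 1 / 3" "E_coef ns nt 3 i 1 = 1 / 3"
    by (subst E_coef_first[OF assms(1) _ assms(2) j(1)]; simp)+
  have first': "E_coef ns nt 1 i 2 = 1 / 3 + pole_coef 0 (cos (theta ns i)) (sin (theta ns i))"
    "E_coef ns nt 2 i 2 = 1 / 3 + pole_coef 1 (cos (theta ns i)) (sin (theta ns i))"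
    "E_coef ns nt 3 i 2 = 1 / 3 + pole_coef 2 (cos (theta ns i)) (sin (theta ns i))"
    by (subst E_coef_first[OF assms(1) _ assms(2) j(2)]; simp)+
  have arith: "(0::nat) + 1 = 1" "(1::nat) + 1 = 2" "(2::nat) + 1 = 3" by simp_all
  show ?A
    unfolding tensor_control_point_def M_def[symmetric] sum_first_three_last_three first
      mid[OF disjI1[OF refl]] last[OF disjI1[OF refl]] pole_center_def arith
    by (simp add: scaleR_add_right)
  show ?B
    unfolding tensor_control_point_def M_def[symmetric] sum_first_three_last_three first'
      mid[OF disjI2[OF refl]] last[OF disjI2[OF refl]] pole_center_def pole_map_def arith
    by (simp add: scaleR_add_right scaleR_add_left)
qed

lemma control_point_last_pole:
  assumes "4 \<le> nt" "i \<in> {1..ns}"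
  shows "tensor_control_point ns nt f i nt = pole_center (\<lambda>a. f (ns * (nt - 4) + 6 - a))" (is ?A)
    and "tensor_control_point ns nt f i (nt - 1) = pole_center (\<lambda>a. f (ns * (nt - 4) + 6 - a))
           + pole_map (\<lambda>a. f (ns * (nt - 4) + 6 - a)) (cos (theta_hat ns i), sin (theta_hat ns i))" (is ?B)
proof -
  define M where "M = ns * (nt - 4)"
  have j: "nt \<in> {1..nt}" "nt - 1 \<in> {1..nt}" "nt - 1 \<noteq> nt" using assms(1) by auto
  have first: "E_coef ns nt 1 i j = 0" "E_coef ns nt 2 i j = 0" "E_coef ns nt 3 i j = 0"
    if "j = nt \<or> j = nt - 1" for j
    using E_coef_first[of nt 1 i ns j] E_coef_first[of nt 2 i ns j] E_coef_first[of nt 3 i ns j] that assms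
    by auto
  have mid: "(\<Sum>l=4..M+3. E_coef ns nt l i j *\<^sub>R f l) = 0" if "j = nt \<or> j = nt - 1" for j
    using E_coef_middle_pole[of nt _ ns i j] that assms by (intro sum.neutral) (auto simp: M_def)
  have sums: "(M + 6) + 0 = ns * (nt - 4) + 6" "(M + 5) + 1 = ns * (nt - 4) + 6" "(M + 4) + 2 = ns * (nt - 4) + 6"
    by (auto simp: M_def)
  have three: "(0::nat) < 3" "(1::nat) < 3" "(2::nat) < 3" by auto
  have last: "E_coef ns nt (M + 6) i nt = 1 / 3" "E_coef ns nt (M + 5) i nt = 1 / 3" "E_coef ns nt (M + 4) i nt = 1 / 3"
    using E_coef_last[OF assms(1) sums(1) three(1) assms(2) j(1)] E_coef_last[OF assms(1) sums(2) three(2) assms(2) j(1)]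
      E_coef_last[OF assms(1) sums(3) three(3) assms(2) j(1)] by (simp_all only: if_True simp_thms)
  have last': "E_coef ns nt (M + 6) i (nt - 1) = 1 / 3 + pole_coef 0 (cos (theta_hat ns i)) (sin (theta_hat ns i))"
    "E_coef ns nt (M + 5) i (nt - 1) = 1 / 3 + pole_coef 1 (cos (theta_hat ns i)) (sin (theta_hat ns i))"
    "E_coef ns nt (M + 4) i (nt - 1) = 1 / 3 + pole_coef 2 (cos (theta_hat ns i)) (sin (theta_hat ns i))"
    using E_coef_last[OF assms(1) sums(1) three(1) assms(2) j(2)] E_coef_last[OF assms(1) sums(2) three(2) assms(2) j(2)]
      E_coef_last[OF assms(1) sums(3) three(3) assms(2) j(2)] j(3) by (simp_all only: if_True if_False simp_thms)
  have arith: "M + 6 - 0 = M + 6" "M + 6 - 1 = M + 5" "M + 6 - 2 = M + 4" by simp_all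
  show ?A
    unfolding tensor_control_point_def M_def[symmetric] sum_first_three_last_three last
      mid[OF disjI1[OF refl]] first[OF disjI1[OF refl]] pole_center_def arith
    by (simp add: scaleR_add_right)
  show ?B
    unfolding tensor_control_point_def M_def[symmetric] sum_first_three_last_three last'
      mid[OF disjI2[OF refl]] first[OF disjI2[OF refl]] pole_center_def pole_map_def arith
    by (simp add: scaleR_add_right scaleR_add_left)
qed

lemma control_point_middle:
  assumes "4 \<le> nt" "i \<in> {1..ns}" "3 \<le> j" "j \<le> nt - 2"
  shows "tensor_control_point ns nt f i j = f ((i - 1) + (j - 3) * ns + 4)"
proof -
  define M where "M = ns * (nt - 4)"
  define l0 where "l0 = (i - 1) + (j - 3) * ns + 4"
  have jn: "j \<in> {1..nt}" and j_ne: "j \<noteq> nt" "j \<noteq> nt - 1" using assms by auto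
  have "(i - 1) + (j - 3) * ns < ns + (nt - 5) * ns"
    using assms by (intro add_less_le_mono mult_right_mono) auto
  also have "\<dots> = M"
  proof -
    have "nt - 4 = Suc (nt - 5)" using assms by simp
    then show ?thesis by (simp add: M_def algebra_simps)
  qed
  finally have l0: "l0 \<in> {4..M+3}" by (auto simp: l0_def)
  have eq: "(i - 1) + (j - 1) * ns + 4 = 2 * ns + l0"
  proof -
    have "j - 1 = j - 3 + 2" using assms by simp
    then have "(j - 1) * ns = (j - 3) * ns + 2 * ns" by (simp only: distrib_right)
    then show ?thesis by (simp add: l0_def)
  qed
  have first: "E_coef ns nt 1 i j = 0" "E_coef ns nt 2 i j = 0" "E_coef ns nt 3 i j = 0"
    using E_coef_first[of nt 1 i ns j] E_coef_first[of nt 2 i ns j] E_coef_first[of nt 3 i ns j] jn assms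
    by auto
  have last: "E_coef ns nt (M + 6) i j = 0" "E_coef ns nt (M + 5) i j = 0" "E_coef ns nt (M + 4) i j = 0"
    using E_coef_last[of nt "M + 6" 0 ns i j] E_coef_last[of nt "M + 5" 1 ns i j]
      E_coef_last[of nt "M + 4" 2 ns i j] jn assms j_ne by (simp_all add: M_def)
  have "(\<Sum>l=4..M+3. E_coef ns nt l i j *\<^sub>R f l) = (\<Sum>l\<in>{l0}. E_coef ns nt l i j *\<^sub>R f l)"
  proof (rule sum.mono_neutral_right)
    show "\<forall>l\<in>{4..M+3} - {l0}. E_coef ns nt l i j *\<^sub>R f l = 0"
      using eq by (auto simp: E_coef_middle[OF assms(1) _ _ assms(2) jn] M_def)
  qed (use l0 in auto)
  also have "\<dots> = f l0" using l0 eq by (simp add: E_coef_middle[OF assms(1) _ _ assms(2) jn] M_def)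
  finally show ?thesis
    unfolding tensor_control_point_def M_def[symmetric] sum_first_three_last_three first last l0_def
    by simp
qed

text \<open>The unit circle is the incircle of the triangle of \<open>pole_coef\<close>.\<close>
lemma pole_coef_nonneg: "0 \<le> 1 / 3 + pole_coef a (cos x) (sin x)"
proof -
  have abs: "\<bar>- (1/6) * cos x + s * (sqrt 3 / 6) * sin x\<bar> \<le> 1 / 3" if "s = 1 \<or> s = -1" for s :: real
  proof (rule power2_le_imp_le)
    have "(- (1/6) * cos x + s * (sqrt 3 / 6) * sin x)\<^sup>2
       = 1 / 9 * ((cos x)\<^sup>2 + (sin x)\<^sup>2) - (s * sqrt 3 / 6 * cos x + 1 / 6 * sin x)\<^sup>2"
      using that by (auto simp: power2_eq_square algebra_simps)
    also have "\<dots> = 1 / 9 - (s * sqrt 3 / 6 * cos x + 1 / 6 * sin x)\<^sup>2"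
      by (simp only: sin_cos_squared_add2)
    also have "\<dots> \<le> (1 / 3)\<^sup>2"
      by (simp add: power2_eq_square)
    finally show "\<bar>- (1/6) * cos x + s * (sqrt 3 / 6) * sin x\<bar>\<^sup>2 \<le> (1 / 3)\<^sup>2" by simp
  qed simp
  have *: "- (1 / 3) \<le> - (1/6) * cos x + s * (sqrt 3 / 6) * sin x" if "s = 1 \<or> s = -1" for s :: real
    using abs_le_D2[OF abs[OF that]] by linarith
  consider "a = 0" | "a = 1" | "a \<noteq> 0" "a \<noteq> 1" by blast
  then show ?thesis
  proof cases
    case 1
    have "- 1 \<le> cos x" by (rule cos_ge_minus_one)
    then have "0 \<le> 1 / 3 + cos x / 3" by linarith
    with 1 show ?thesis by (simp add: pole_coef_def)
  next
    case 2
    then show ?thesis using *[of 1] by (simp add: pole_coef_def)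
  next
    case 3
    then show ?thesis using *[of "-1"] by (simp add: pole_coef_def)
  qed
qed

lemma sum_tensor_index:
  fixes g :: "nat \<Rightarrow> 'a::comm_monoid_add"
  shows "(\<Sum>q = 0..<ns * nt. g q) = (\<Sum>j=1..nt. \<Sum>i=1..ns. g ((i - 1) + (j - 1) * ns))"
proof (induction nt)
  case (Suc nt)
  have "(\<Sum>q = 0..<ns * Suc nt. g q) = (\<Sum>q = 0..<ns * nt. g q) + (\<Sum>q = ns * nt..<ns * nt + ns. g q)"
    by (subst sum.atLeastLessThan_concat) (auto simp: add.commute)
  also have "(\<Sum>q = ns * nt..<ns * nt + ns. g q) = (\<Sum>i=1..ns. g ((i - 1) + nt * ns))"
    by (rule sum.reindex_bij_witness[of _ "\<lambda>i. (i - 1) + nt * ns" "\<lambda>q. q - nt * ns + 1"])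
       (auto simp: mult.commute)
  finally show ?case using Suc by simp
qed simp

lemma polar_spline_sum:
  assumes "4 \<le> nt" "l \<in> {1..ns * (nt - 4) + 6}" "1 \<le> ns"
  shows "polar_spline ns nt B l z = (\<Sum>j=1..nt. \<Sum>i=1..ns. E_coef ns nt l i j * B i j z)"
proof -
  have l: "l - 1 < ns * (nt - 4) + 6" using assms by auto
  have "polar_spline ns nt B l z
      = (\<Sum>q = 0..<ns * nt. E_mat ns nt $$ (l - 1, q) * B (q mod ns + 1) (q div ns + 1) z)"
    unfolding polar_spline_def using l assms(1) by (simp add: scalar_prod_def tensor_vec_def dim_E_mat)
  also have "\<dots> = (\<Sum>j=1..nt. \<Sum>i=1..ns. E_coef ns nt l i j * B i j z)"
    unfolding sum_tensor_index
  proof (intro sum.cong refl)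
    fix i j assume ij: "i \<in> {1..ns}" "j \<in> {1..nt}"
    have "i - 1 < ns" using ij by auto
    then have "(i - 1 + (j - 1) * ns) mod ns = i - 1" "(i - 1 + (j - 1) * ns) div ns = j - 1"
      by simp_all
    then have "(i - 1 + (j - 1) * ns) mod ns + 1 = i" "(i - 1 + (j - 1) * ns) div ns + 1 = j"
      using ij by (simp_all del: mod_mult_self1 div_mult_self1)
    then show "E_mat ns nt $$ (l - 1, i - 1 + (j - 1) * ns) *
       B ((i - 1 + (j - 1) * ns) mod ns + 1) ((i - 1 + (j - 1) * ns) div ns + 1) z = E_coef ns nt l i j * B i j z"
      by (simp only: E_coef_def)
  qed
  finally show ?thesis .
qed

lemma polar_surface_sum:
  fixes f :: "nat \<Rightarrow> 'a::real_vector"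
  assumes "4 \<le> nt" "1 \<le> ns"
  shows "(\<Sum>l=1..ns * (nt - 4) + 6. polar_spline ns nt B l z *\<^sub>R f l) =
    (\<Sum>j=1..nt. \<Sum>i=1..ns. B i j z *\<^sub>R tensor_control_point ns nt f i j)"
proof -
  have "(\<Sum>l=1..ns * (nt - 4) + 6. polar_spline ns nt B l z *\<^sub>R f l)
     = (\<Sum>l=1..ns * (nt - 4) + 6. \<Sum>j=1..nt. \<Sum>i=1..ns. B i j z *\<^sub>R E_coef ns nt l i j *\<^sub>R f l)"
    using polar_spline_sum[OF assms(1) _ assms(2)]
    by (intro sum.cong refl) (simp add: scaleR_sum_left mult.commute)
  also have "\<dots> = (\<Sum>j=1..nt. \<Sum>i=1..ns. \<Sum>l=1..ns * (nt - 4) + 6. B i j z *\<^sub>R E_coef ns nt l i j *\<^sub>R f l)"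
    by (subst sum.swap) (intro sum.cong refl sum.swap)
  finally show ?thesis unfolding tensor_control_point_def scaleR_sum_right .
qed

lemma E_coef_nonneg:
  assumes "4 \<le> nt" "l \<in> {1..ns * (nt - 4) + 6}" "i \<in> {1..ns}" "j \<in> {1..nt}"
  shows "0 \<le> E_coef ns nt l i j"
proof -
  consider "l \<in> {1..3}" | "4 \<le> l" "l \<le> ns * (nt - 4) + 3" | "ns * (nt - 4) + 4 \<le> l"
    using assms(2) by force
  then show ?thesis
  proof cases
    case 1
    then show ?thesis using pole_coef_nonneg by (simp add: E_coef_first[OF assms(1) _ assms(3,4)])
  next
    case 2
    then show ?thesis by (simp add: E_coef_middle[OF assms(1) _ _ assms(3,4)])
  next
    case 3
    define a where "a = ns * (nt - 4) + 6 - l"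
    have "l + a = ns * (nt - 4) + 6" "a < 3" using 3 assms(2) by (auto simp: a_def)
    then show ?thesis using pole_coef_nonneg by (simp add: E_coef_last[OF assms(1) _ _ assms(3,4)])
  qed
qed

lemma control_point_cases:
  fixes nt j :: nat
  assumes "4 \<le> nt" "j \<in> {1..nt}"
  obtains "j = 1" | "j = 2" | "3 \<le> j" "j \<le> nt - 2" | "j = nt - 1" | "j = nt"
  using assms by force

text \<open>Equivalently, constant control points are reproduced, and this can be checked row by row.\<close>
lemma E_coef_column_sum:
  assumes "4 \<le> nt" "i \<in> {1..ns}" "j \<in> {1..nt}"
  shows "(\<Sum>l=1..ns * (nt - 4) + 6. E_coef ns nt l i j) = 1"
proof -
  have "(\<Sum>l=1..ns * (nt - 4) + 6. E_coef ns nt l i j) = tensor_control_point ns nt (\<lambda>_. 1 :: real) i j"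
    by (simp add: tensor_control_point_def)
  also have "\<dots> = 1"
  proof -
    have "pole_center (\<lambda>_. 1 :: real) = 1" "pole_map (\<lambda>_. 1 :: real) w = 0" for w
      by (auto simp: pole_center_def pole_map_def pole_coef_def)
    note pole = this control_point_first_pole[OF assms(1,2), of "\<lambda>_. 1 :: real"]
      control_point_last_pole[OF assms(1,2), of "\<lambda>_. 1 :: real"]
    from assms(1,3) show ?thesis
    proof (cases rule: control_point_cases)
      case 3
      then show ?thesis using control_point_middle[OF assms(1,2)] by simp
    qed (simp_all only: pole add_0_right)
  qed
  finally show ?thesis .
qed

lemma pole_map_eq:
  "pole_map g w = fst w *\<^sub>R ((1/3) *\<^sub>R g 0 - (1/6) *\<^sub>R g 1 - (1/6) *\<^sub>R g 2) + snd w *\<^sub>R ((sqrt 3 / 6) *\<^sub>R (g 1 - g 2))"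
proof -
  have c: "pole_coef 0 x y = x / 3" "pole_coef 1 x y = - (x / 6) + y * (sqrt 3 / 6)"
    "pole_coef 2 x y = - (x / 6) - y * (sqrt 3 / 6)" for x y
    by (simp_all add: pole_coef_def)
  have "(x / 3) *\<^sub>R u + (- (x / 6) + y * s) *\<^sub>R v + (- (x / 6) - y * s) *\<^sub>R w
    = x *\<^sub>R ((1/3) *\<^sub>R u - (1/6) *\<^sub>R v - (1/6) *\<^sub>R w) + y *\<^sub>R (s *\<^sub>R (v - w))"
    for x y s :: real and u v w :: 'a
    by (simp add: scaleR_diff_right scaleR_diff_left scaleR_add_left)
  then show ?thesis unfolding pole_map_def c .
qed

lemma sin_angle_step:
  assumes "3 \<le> ns"
  shows "sin (theta ns 1 - theta ns 2) \<noteq> 0" "sin (theta_hat ns 1 - theta_hat ns 2) \<noteq> 0"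
proof -
  have 1: "theta ns 1 - theta ns 2 = 2 * pi / ns" using assms by (simp add: theta_def field_simps)
  have "0 < 2 * pi / ns" "2 * pi / ns < pi" using assms by (auto simp: field_simps)
  then have s: "0 < sin (2 * pi / ns)" by (rule sin_gt_zero)
  then show "sin (theta ns 1 - theta ns 2) \<noteq> 0" unfolding 1 by simp
  have "theta_hat ns 1 - theta_hat ns 2 = - (2 * pi / ns)" using 1 by (simp add: theta_hat_def)
  then show "sin (theta_hat ns 1 - theta_hat ns 2) \<noteq> 0" using s by simp
qed

text \<open>The second assumption makes \<open>(cos x, sin x)\<close> and \<open>(cos y, sin y)\<close> linearly independent, so that
\<open>pole_map g\<close> vanishes identically and the three values of \<open>g\<close> are equal.\<close>
lemma pole_rows_independent:
  fixes g :: "nat \<Rightarrow> real"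
  assumes center: "pole_center g = 0" and s: "sin (x - y) \<noteq> 0"
    and x: "pole_map g (cos x, sin x) = 0" and y: "pole_map g (cos y, sin y) = 0"
  shows "g 0 = 0 \<and> g 1 = 0 \<and> g 2 = 0"
proof -
  define A where "A = (1/3) * g 0 - (1/6) * g 1 - (1/6) * g 2"
  define C where "C = (sqrt 3 / 6) * (g 1 - g 2)"
  have 1: "cos x * A + sin x * C = 0" "cos y * A + sin y * C = 0"
    using x y by (simp_all add: pole_map_eq A_def C_def)
  have "A * sin (x - y) = sin x * (cos y * A + sin y * C) - sin y * (cos x * A + sin x * C)"
    by (simp add: sin_diff algebra_simps)
  then have A: "A = 0" using 1 s by simp
  have "C * sin (x - y) = cos y * (cos x * A + sin x * C) - cos x * (cos y * A + sin y * C)"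
    by (simp add: sin_diff algebra_simps)
  then have "C = 0" using 1 s by simp
  then have "g 1 = g 2" by (simp add: C_def)
  moreover have "g 0 + g 1 + g 2 = 0" using center by (simp add: pole_center_def)
  ultimately show ?thesis using A by (simp add: A_def)
qed

text \<open>The combination in the assumption is one of \<open>g 0 - g 1\<close> and \<open>g 2 - g 1\<close>, which are linearly independent.\<close>
lemma pole_map_injective:
  fixes g :: "nat \<Rightarrow> 'a::euclidean_space"
  assumes nc: "\<not> collinear {g 0, g 1, g 2}"
    and 0: "x *\<^sub>R ((1/3) *\<^sub>R g 0 - (1/6) *\<^sub>R g 1 - (1/6) *\<^sub>R g 2) + y *\<^sub>R ((sqrt 3 / 6) *\<^sub>R (g 1 - g 2)) = 0"
  shows "x = 0 \<and> y = 0"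
proof -
  have nc': "\<not> collinear {0, g 0 - g 1, g 2 - g 1}" 
    using nc collinear_3[of "g 0" "g 1" "g 2"] by (simp add: NO_MATCH_def)
  define \<kappa> where "\<kappa> = x / 3"
  define \<mu> where "\<mu> = - x / 6 - y * (sqrt 3 / 6)"
  have "\<kappa> *\<^sub>R (g 0 - g 1) + \<mu> *\<^sub>R (g 2 - g 1)
     = x *\<^sub>R ((1/3) *\<^sub>R g 0 - (1/6) *\<^sub>R g 1 - (1/6) *\<^sub>R g 2) + y *\<^sub>R ((sqrt 3 / 6) *\<^sub>R (g 1 - g 2))"
  proof -
    have "\<kappa> *\<^sub>R (g 0 - g 1) + \<mu> *\<^sub>R (g 2 - g 1) = \<kappa> *\<^sub>R g 0 + (- \<kappa> - \<mu>) *\<^sub>R g 1 + \<mu> *\<^sub>R g 2"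
      by (simp add: algebra_simps)
    also have "- \<kappa> - \<mu> = - x / 6 + y * (sqrt 3 / 6)" by (simp add: \<kappa>_def \<mu>_def)
    finally show ?thesis unfolding \<kappa>_def \<mu>_def
      by (simp add: scaleR_diff_right scaleR_diff_left scaleR_add_left)
  qed
  then have eq: "\<kappa> *\<^sub>R (g 0 - g 1) + \<mu> *\<^sub>R (g 2 - g 1) = 0" using 0 by simp
  have "\<mu> = 0"
  proof (rule ccontr)
    assume "\<mu> \<noteq> 0"
    then have "g 2 - g 1 = (- \<kappa> / \<mu>) *\<^sub>R (g 0 - g 1)"
    proof -
      have "\<mu> *\<^sub>R (g 2 - g 1) = (- \<kappa>) *\<^sub>R (g 0 - g 1)" using eq by (simp add: add_eq_0_iff)
      then have "(1 / \<mu>) *\<^sub>R \<mu> *\<^sub>R (g 2 - g 1) = (1 / \<mu>) *\<^sub>R (- \<kappa>) *\<^sub>R (g 0 - g 1)" by simp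
      then show ?thesis using \<open>\<mu> \<noteq> 0\<close> by simp
    qed
    then show False using nc' unfolding collinear_lemma by blast
  qed
  moreover have "g 0 - g 1 \<noteq> 0" using nc' unfolding collinear_lemma by blast
  ultimately have "\<kappa> = 0" using eq by simp
  then show ?thesis using \<open>\<mu> = 0\<close> by (simp add: \<kappa>_def \<mu>_def)
qed

lemma polar_spline_rows_independent:
  fixes c :: "nat \<Rightarrow> real"
  assumes ns: "3 \<le> ns" and nt: "4 \<le> nt"
    and P: "\<And>i j. i \<in> {1..ns} \<Longrightarrow> j \<in> {1..nt} \<Longrightarrow> tensor_control_point ns nt c i j = 0"
    and l: "l \<in> {1..ns * (nt - 4) + 6}"
  shows "c l = 0"
proof -
  define M where "M = ns * (nt - 4)"
  have i: "1 \<in> {1..ns}" "2 \<in> {1..ns}" and j: "1 \<in> {1..nt}" "2 \<in> {1..nt}" "nt \<in> {1..nt}" "nt - 1 \<in> {1..nt}"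
    using ns nt by auto
  have first: "c (0 + 1) = 0 \<and> c (1 + 1) = 0 \<and> c (2 + 1) = 0"
  proof (rule pole_rows_independent[of "\<lambda>a. c (a + 1)", OF _ sin_angle_step(1)[OF ns]])
    show center: "pole_center (\<lambda>a. c (a + 1)) = 0"
      using control_point_first_pole(1)[OF nt i(1), of c] P[OF i(1) j(1)] by simp
    show "pole_map (\<lambda>a. c (a + 1)) (cos (theta ns 1), sin (theta ns 1)) = 0"
      using control_point_first_pole(2)[OF nt i(1), of c] P[OF i(1) j(2)] center by simp
    show "pole_map (\<lambda>a. c (a + 1)) (cos (theta ns 2), sin (theta ns 2)) = 0"
      using control_point_first_pole(2)[OF nt i(2), of c] P[OF i(2) j(2)] center by simp
  qed
  have last: "c (M + 6 - 0) = 0 \<and> c (M + 6 - 1) = 0 \<and> c (M + 6 - 2) = 0"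
  proof (rule pole_rows_independent[of "\<lambda>a. c (M + 6 - a)", OF _ sin_angle_step(2)[OF ns]])
    show center: "pole_center (\<lambda>a. c (M + 6 - a)) = 0"
      using control_point_last_pole(1)[OF nt i(1), of c] P[OF i(1) j(3)] unfolding M_def by simp
    show "pole_map (\<lambda>a. c (M + 6 - a)) (cos (theta_hat ns 1), sin (theta_hat ns 1)) = 0"
      using control_point_last_pole(2)[OF nt i(1), of c] P[OF i(1) j(4)] center unfolding M_def by simp
    show "pole_map (\<lambda>a. c (M + 6 - a)) (cos (theta_hat ns 2), sin (theta_hat ns 2)) = 0"
      using control_point_last_pole(2)[OF nt i(2), of c] P[OF i(2) j(4)] center unfolding M_def by simp
  qed
  consider "l = 0 + 1" | "l = 1 + 1" | "l = 2 + 1" | "4 \<le> l" "l \<le> M + 3" | "l = M + 6 - 0" | "l = M + 6 - 1" | "l = M + 6 - 2"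
    using l unfolding M_def[symmetric] atLeastAtMost_iff by linarith
  then show ?thesis
  proof cases
    case 4
    \<comment> \<open>Division with remainder by \<open>ns\<close> recovers the position \<open>(i, j)\<close> of the tensor product function.\<close>
    define q where "q = l - 4"
    have q: "q < ns * (nt - 4)" "l = q + 4" using 4 by (auto simp: q_def M_def)
    have nsp: "0 < ns" using ns by simp
    have "q div ns < nt - 4" using q(1) by (simp add: less_mult_imp_div_less mult.commute)
    then have "q mod ns + 1 \<in> {1..ns}" "3 \<le> q div ns + 3" "q div ns + 3 \<le> nt - 2" "q div ns + 3 \<in> {1..nt}"
      using nsp nt by (auto simp: Suc_le_eq)
    moreover from this have "c ((q mod ns + 1 - 1) + (q div ns + 3 - 3) * ns + 4) = 0"
      using control_point_middle[OF nt, of "q mod ns + 1" ns "q div ns + 3" c] P by metis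
    ultimately show ?thesis using q(2) by (simp add: mult.commute)
  qed (simp_all only: first last)
qed

section \<open>Inverting a polar map near its pole\<close>

definition cross :: "real \<times> real \<Rightarrow> real \<times> real \<Rightarrow> real" where
  "cross a b = fst a * snd b - snd a * fst b"

lemma cross_swap: "cross a b = - cross b a"
  by (simp add: cross_def)

lemma cramer:
  assumes "cross a b \<noteq> 0"
  shows "(cross w b / cross a b) *\<^sub>R a + (cross w a / cross b a) *\<^sub>R b = w"
proof -
  define d where "d = cross a b"
  have d: "d \<noteq> 0" "cross b a = - d" using assms cross_swap[of b a] by (auto simp: d_def)
  have "cross w b * fst a - cross w a * fst b = d * fst w" "cross w b * snd a - cross w a * snd b = d * snd w"
    by (auto simp: cross_def d_def algebra_simps)
  then show ?thesis using d unfolding d_def[symmetric]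
    by (intro prod_eqI) (simp_all add: field_simps)
qed

text \<open>The first quotient compares \<open>b t / t\<close>, which tends to \<open>b' 0 = 0\<close>, with \<open>r t / t\<close>, which tends to
\<open>r' 0\<close>.\<close>
lemma C1_on_quotient_at_0:
  assumes "0 < t2" "C1_on 0 t2 b b'" "b 0 = 0" "b' 0 = 0" "C1_on 0 t2 r r'" "r 0 = 0" "r' 0 \<noteq> 0"
  shows "((\<lambda>t. b t / r t) \<longlongrightarrow> 0) (at_right 0)"
    and "((\<lambda>t. b' t / r' t) \<longlongrightarrow> 0) (at_right 0)"
    and "(b \<longlongrightarrow> 0) (at_right 0)"
proof -
  have at: "at 0 within {0..t2} = at_right (0::real)" using assms(1) by (simp add: at_within_Icc_at_right)
  have quot: "((\<lambda>t. f t / t) \<longlongrightarrow> f' 0) (at_right 0)" if "C1_on 0 t2 f f'" "f 0 = 0" for f f'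
    using C1_on_has_derivative[OF that(1), of 0] assms(1) that(2) unfolding has_field_derivative_iff at by simp
  have "((\<lambda>t. (b t / t) / (r t / t)) \<longlongrightarrow> b' 0 / r' 0) (at_right 0)"
    by (intro tendsto_divide quot assms)
  then have "((\<lambda>t. (b t / t) / (r t / t)) \<longlongrightarrow> 0) (at_right 0)" using assms by simp
  moreover have "\<forall>\<^sub>F t in at_right 0. (b t / t) / (r t / t) = b t / r t"
    using eventually_at_right_less[of "0::real"] by eventually_elim auto
  ultimately show "((\<lambda>t. b t / r t) \<longlongrightarrow> 0) (at_right 0)"
    by (rule Lim_transform_eventually)
  have cont: "(f \<longlongrightarrow> f 0) (at_right 0)" if "continuous_on {0..t2} f" for f :: "real \<Rightarrow> real"
    using that assms(1) unfolding continuous_on_def at[symmetric] by auto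
  have "((\<lambda>t. b' t / r' t) \<longlongrightarrow> b' 0 / r' 0) (at_right 0)"
    by (intro tendsto_divide cont C1_on_continuous_deriv[OF assms(2)] C1_on_continuous_deriv[OF assms(5)] assms(7))
  then show "((\<lambda>t. b' t / r' t) \<longlongrightarrow> 0) (at_right 0)" using assms by simp
  show "(b \<longlongrightarrow> 0) (at_right 0)" using cont[OF C1_on_continuous[OF assms(2)]] assms(3) by simp
qed

lemma uniform_limit_scaleR_0:
  fixes A :: "real \<Rightarrow> 'a::real_normed_vector"
  assumes q: "(q \<longlongrightarrow> 0) F" and A: "continuous_on {a..b} A"
  shows "uniform_limit {a..b} (\<lambda>t s. q t *\<^sub>R A s) (\<lambda>_. 0) F"
proof (rule uniform_limitI)
  fix e :: real assume e: "0 < e"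
  have "bounded (A ` {a..b})" using A compact_continuous_image compact_Icc compact_imp_bounded by blast
  then obtain M where M: "0 < M" "\<And>s. s \<in> {a..b} \<Longrightarrow> norm (A s) \<le> M"
    unfolding bounded_pos by auto
  have "\<forall>\<^sub>F t in F. dist (q t) 0 < e / M" using q e M by (intro tendstoD) auto
  then show "\<forall>\<^sub>F t in F. \<forall>s\<in>{a..b}. dist (q t *\<^sub>R A s) 0 < e"
  proof eventually_elim
    case (elim t)
    show ?case
    proof
      fix s assume s: "s \<in> {a..b}"
      have "norm (q t *\<^sub>R A s) \<le> \<bar>q t\<bar> * M" using M(2)[OF s] by (simp add: mult_left_mono)
      also have "\<dots> < e" using elim M(1) by (simp add: field_simps)
      finally show "dist (q t *\<^sub>R A s) 0 < e" by simp
    qed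
  qed
qed

lemma uniform_limit_sum_0:
  fixes f :: "'i \<Rightarrow> 'b \<Rightarrow> 'c \<Rightarrow> 'a::real_normed_vector"
  assumes "\<And>j. j \<in> A \<Longrightarrow> uniform_limit X (f j) (\<lambda>_. 0) F"
  shows "uniform_limit X (\<lambda>t s. \<Sum>j\<in>A. f j t s) (\<lambda>_. 0) F"
  using assms
proof (induction A rule: infinite_finite_induct)
  case (insert j A)
  then have "uniform_limit X (\<lambda>t s. f j t s + (\<Sum>j\<in>A. f j t s)) (\<lambda>s. 0 + 0) F"
    by (intro uniform_limit_add) auto
  then show ?case using insert by simp
qed (simp_all add: uniform_limit_const)

text \<open>A polar map \<open>r(t) \<gamma>(s)\<close>. The closed curve \<open>\<gamma>\<close> is extended periodically to the real line, so that
the seam, where 0 and \<open>s2\<close> are identified, is no longer on the boundary of the domain.\<close>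
locale polar_parametrization =
  fixes s2 t2 :: real and \<gamma> \<gamma>' :: "real \<Rightarrow> real \<times> real" and r r' :: "real \<Rightarrow> real"
  assumes s2_pos: "0 < s2" and t2_pos: "0 < t2"
    and \<gamma>_deriv: "\<And>s. (\<gamma> has_vector_derivative \<gamma>' s) (at s)"
    and \<gamma>'_cont: "continuous_on UNIV \<gamma>'"
    and \<gamma>_periodic: "\<And>s n. \<gamma> (s + of_int n * s2) = \<gamma> s"
    and cross_nz: "\<And>s. cross (\<gamma>' s) (\<gamma> s) \<noteq> 0"
    and r_0: "r 0 = 0" and r_C1: "C1_on 0 t2 r r'" and r'_0: "0 < r' 0"
    and r_pos: "\<And>t. t \<in> {0<..<t2} \<Longrightarrow> 0 < r t"
    and r'_nz: "\<And>t. t \<in> {0<..<t2} \<Longrightarrow> r' t \<noteq> 0"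
    and F_inj: "\<And>s t u v. t \<in> {0<..<t2} \<Longrightarrow> v \<in> {0<..<t2} \<Longrightarrow> r t *\<^sub>R \<gamma> s = r v *\<^sub>R \<gamma> u
       \<Longrightarrow> t = v \<and> (\<exists>n::int. u = s + of_int n * s2)"
begin

definition F :: "real \<times> real \<Rightarrow> real \<times> real" where
  "F z = r (snd z) *\<^sub>R \<gamma> (fst z)"

lemma \<gamma>_cont: "continuous_on UNIV \<gamma>"
  using \<gamma>_deriv by (meson continuous_at_imp_continuous_on has_vector_derivative_continuous)

lemma \<gamma>_nz: "\<gamma> s \<noteq> 0"
  using cross_nz[of s] by (auto simp: cross_def)

lemma r_has_derivative: "t \<in> {0<..<t2} \<Longrightarrow> (r has_real_derivative r' t) (at t)"
  using C1_on_interior[OF r_C1] by auto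

lemma r_cont: "continuous_on {0..t2} r"
  by (rule C1_on_continuous[OF r_C1])

text \<open>Cramer's rule for the inverse of the derivative of \<open>F\<close> at \<open>(s, t)\<close>.\<close>
definition DF_inv :: "real \<Rightarrow> real \<Rightarrow> real \<times> real \<Rightarrow> real \<times> real" where
  "DF_inv s t w = (cross w (\<gamma> s) / cross (\<gamma>' s) (\<gamma> s) / r t, cross w (\<gamma>' s) / cross (\<gamma> s) (\<gamma>' s) / r' t)"

lemma F_has_derivative:
  assumes "t \<in> {0<..<t2}"
  shows "(F has_derivative (\<lambda>h. fst h *\<^sub>R r t *\<^sub>R \<gamma>' s + snd h *\<^sub>R r' t *\<^sub>R \<gamma> s)) (at (s, t))"
proof -
  have dr: "((\<lambda>z. r (snd z)) has_derivative (\<lambda>h. r' t * snd h)) (at (s, t))"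
    by (rule has_derivative_compose[of snd snd "(s,t)" UNIV r "\<lambda>h. r' t * h"])
      (use r_has_derivative[OF assms] in \<open>auto simp: has_field_derivative_def intro: has_derivative_snd\<close>)
  have dg: "((\<lambda>z. \<gamma> (fst z)) has_derivative (\<lambda>h. fst h *\<^sub>R \<gamma>' s)) (at (s, t))"
    by (rule has_derivative_compose[of fst fst "(s,t)" UNIV \<gamma> "\<lambda>h. h *\<^sub>R \<gamma>' s"])
      (use \<gamma>_deriv[of s] in \<open>auto simp: has_vector_derivative_def intro: has_derivative_fst\<close>)
  show ?thesis
    unfolding F_def[abs_def] using has_derivative_scaleR[OF dr dg]
    by (simp add: algebra_simps)
qed

lemma DF_DF_inv:
  assumes "t \<in> {0<..<t2}"
  shows "(\<lambda>h. fst h *\<^sub>R r t *\<^sub>R \<gamma>' s + snd h *\<^sub>R r' t *\<^sub>R \<gamma> s) \<circ> DF_inv s t = id"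
proof
  fix w
  have "((\<lambda>h. fst h *\<^sub>R r t *\<^sub>R \<gamma>' s + snd h *\<^sub>R r' t *\<^sub>R \<gamma> s) \<circ> DF_inv s t) w
    = (cross w (\<gamma> s) / cross (\<gamma>' s) (\<gamma> s)) *\<^sub>R \<gamma>' s + (cross w (\<gamma>' s) / cross (\<gamma> s) (\<gamma>' s)) *\<^sub>R \<gamma> s"
    using r_pos[OF assms] r'_nz[OF assms] by (simp add: DF_inv_def)
  also have "\<dots> = w" by (rule cramer[OF cross_nz])
  finally show "((\<lambda>h. fst h *\<^sub>R r t *\<^sub>R \<gamma>' s + snd h *\<^sub>R r' t *\<^sub>R \<gamma> s) \<circ> DF_inv s t) w = id w" by simp
qed

text \<open>On a strip whose width is one period the injectivity of \<open>F\<close> up to periods becomes injectivity.\<close>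
definition patch :: "real \<Rightarrow> (real \<times> real) set" where
  "patch s = {s - s2 / 2<..<s + s2 / 2} \<times> {0<..<t2}"

lemma open_patch: "open (patch s)"
  unfolding patch_def by (intro open_Times) auto

lemma F_cont_patch: "continuous_on (patch s) F"
  unfolding F_def[abs_def] patch_def
  by (intro continuous_intros continuous_on_compose2[OF r_cont] continuous_on_compose2[OF \<gamma>_cont]) auto

lemma F_inj_patch: "inj_on F (patch s)"
proof (rule inj_onI)
  fix z w assume zw: "z \<in> patch s" "w \<in> patch s" "F z = F w"
  obtain n where n: "snd z = snd w" "fst w = fst z + of_int n * s2"
    using F_inj[of "snd z" "snd w" "fst z" "fst w"] zw by (auto simp: patch_def F_def)
  have "\<bar>fst w - fst z\<bar> < s2" using zw by (auto simp: patch_def)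
  then have "\<bar>of_int n\<bar> * s2 < 1 * s2" using n s2_pos by (simp add: abs_mult)
  then have "\<bar>of_int n :: real\<bar> < 1" using s2_pos by (simp only: mult_less_cancel_right_pos)
  then have "n = 0" by linarith
  then show "z = w" using n by (intro prod_eqI) auto
qed

lemma open_F_patch: "open (F ` patch s)"
  by (intro invariance_of_domain F_cont_patch open_patch F_inj_patch)

text \<open>The cone \<open>C\<close> of positive multiples of points of \<open>\<gamma>\<close> is a union of dilations of images of patches, which
are open by invariance of domain. It is closed in the punctured plane because membership depends on
the direction of \<open>w\<close> only and the directions of \<open>\<gamma>\<close> form a compact set. The punctured plane is
connected.\<close>
lemma cone_eq_punctured_plane:
  fixes w :: "real \<times> real"
  assumes "w \<noteq> 0"
  shows "\<exists>l>0. \<exists>s\<in>{0..s2}. w = l *\<^sub>R \<gamma> s"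
proof -
  define C where "C = {l *\<^sub>R \<gamma> s | l s. 0 < l}"
  have mid: "t2 / 2 \<in> {0<..<t2}" using t2_pos by auto
  have "C = (\<Union>c\<in>{0<..}. \<Union>s. (\<lambda>w. c *\<^sub>R w) ` (F ` patch s))"
  proof (intro equalityI subsetI)
    fix w assume "w \<in> C"
    then obtain l s where l: "0 < l" "w = l *\<^sub>R \<gamma> s" by (auto simp: C_def)
    \<comment> \<open>Any parameter in the open interval would do in place of \<open>t2 / 2\<close>.\<close>
    have "(s, t2 / 2) \<in> patch s" using mid s2_pos by (auto simp: patch_def)
    moreover have "w = (l / r (t2/2)) *\<^sub>R F (s, t2 / 2)" using l r_pos[OF mid] by (simp add: F_def)
    ultimately show "w \<in> (\<Union>c\<in>{0<..}. \<Union>s. (\<lambda>w. c *\<^sub>R w) ` (F ` patch s))"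
      using l(1) r_pos[OF mid] by (intro UN_I[of "l / r (t2/2)"] UN_I[of s]) auto
  next
    fix w assume "w \<in> (\<Union>c\<in>{0<..}. \<Union>s. (\<lambda>w. c *\<^sub>R w) ` (F ` patch s))"
    then obtain c s z where c: "0 < c" "z \<in> patch s" "w = c *\<^sub>R F z" by auto
    then have "w = (c * r (snd z)) *\<^sub>R \<gamma> (fst z)" "0 < c * r (snd z)"
      using r_pos[of "snd z"] by (auto simp: F_def patch_def)
    then show "w \<in> C" by (auto simp: C_def)
  qed
  moreover have "open (\<Union>c\<in>{0<..}. \<Union>s. (\<lambda>w. c *\<^sub>R w) ` (F ` patch s))"
    by (intro open_UN ballI open_scaling open_F_patch) auto
  ultimately have "open C" by simp
  moreover have "C \<subseteq> - {0}" using \<gamma>_nz by (auto simp: C_def)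
  ultimately have op: "openin (top_of_set (- {0})) C"
    unfolding openin_open by (intro exI[of _ C]) auto
  define K where "K = (\<lambda>s. \<gamma> s /\<^sub>R norm (\<gamma> s)) ` {0..s2}"
  have "compact K" unfolding K_def
    by (intro compact_continuous_image continuous_intros continuous_on_subset[OF \<gamma>_cont]) (use \<gamma>_nz in auto)
  then have "closedin (top_of_set (- {0})) (- {0} \<inter> (\<lambda>w. w /\<^sub>R norm w) -` K)"
    by (intro continuous_closedin_preimage continuous_intros compact_imp_closed) auto
  moreover have "- {0} \<inter> (\<lambda>w. w /\<^sub>R norm w) -` K = C"
  proof (intro equalityI subsetI)
    fix w assume "w \<in> - {0} \<inter> (\<lambda>w. w /\<^sub>R norm w) -` K"
    then obtain s where w: "w \<noteq> 0" "w /\<^sub>R norm w = \<gamma> s /\<^sub>R norm (\<gamma> s)" by (auto simp: K_def)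
    have "(norm w / norm (\<gamma> s)) *\<^sub>R \<gamma> s = norm w *\<^sub>R (\<gamma> s /\<^sub>R norm (\<gamma> s))" by (simp add: divide_inverse)
    also have "\<dots> = norm w *\<^sub>R (w /\<^sub>R norm w)" by (simp only: w(2))
    also have "\<dots> = w" using w(1) by simp
    finally have "w = (norm w / norm (\<gamma> s)) *\<^sub>R \<gamma> s" ..
    moreover have "0 < norm w / norm (\<gamma> s)" using w \<gamma>_nz[of s] by simp
    ultimately show "w \<in> C" unfolding C_def by blast
  next
    fix w assume "w \<in> C"
    then obtain l s where l: "0 < l" "w = l *\<^sub>R \<gamma> s" by (auto simp: C_def)
    obtain n where n: "s + of_int n * s2 \<in> {0..s2}" using shift_into_period[OF s2_pos] by blast
    have "w /\<^sub>R norm w = \<gamma> s /\<^sub>R norm (\<gamma> s)" using l by simp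
    also have "\<dots> \<in> K" unfolding K_def using n \<gamma>_periodic[of s n]
      by (intro image_eqI[of _ _ "s + of_int n * s2"]) auto
    finally show "w \<in> - {0} \<inter> (\<lambda>w. w /\<^sub>R norm w) -` K" using l \<gamma>_nz[of s] by simp
  qed
  ultimately have cl: "closedin (top_of_set (- {0})) C" by simp
  have "connected (- {0::real \<times> real})" by (intro connected_punctured_universe) simp
  with op cl have "C = {} \<or> C = - {0}" unfolding connected_clopen by blast
  moreover have "1 *\<^sub>R \<gamma> 0 \<in> C" unfolding C_def by (intro CollectI exI[of _ 1] exI[of _ 0]) simp
  ultimately have "w \<in> C" using assms by auto
  then obtain l s where l: "0 < l" "w = l *\<^sub>R \<gamma> s" by (auto simp: C_def)
  obtain n where n: "s + of_int n * s2 \<in> {0..s2}" using shift_into_period[OF s2_pos] by blast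
  show ?thesis using l n \<gamma>_periodic[of s n]
    by (intro exI[of _ l] conjI bexI[of _ "s + of_int n * s2"]) auto
qed

text \<open>A short vector is a small multiple of a point of \<open>\<gamma>\<close>, since \<open>\<gamma>\<close> stays away from 0, and the
intermediate value theorem writes the factor as \<open>r t\<close>.\<close>
lemma F_covers_neighbourhood:
  assumes "\<tau> \<in> {0<..t2}"
  shows "\<exists>\<delta>>0. \<forall>w. w \<noteq> 0 \<and> norm w < \<delta> \<longrightarrow> (\<exists>s\<in>{0..s2}. \<exists>t\<in>{0<..<\<tau>}. w = F (s, t))"
proof -
  have "continuous_on {0..s2} (\<lambda>s. norm (\<gamma> s))"
    by (intro continuous_intros continuous_on_subset[OF \<gamma>_cont]) auto
  moreover have "{0..s2} \<noteq> {}" using s2_pos by auto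
  ultimately obtain c where c: "c \<in> {0..s2}" "\<And>s. s \<in> {0..s2} \<Longrightarrow> norm (\<gamma> c) \<le> norm (\<gamma> s)"
    using continuous_attains_inf[OF compact_Icc] by blast
  have cp: "0 < norm (\<gamma> c)" using \<gamma>_nz by simp
  have rp: "0 < r (\<tau> / 2)" using assms by (intro r_pos) auto
  show ?thesis
  proof (intro exI conjI allI impI)
    show "0 < norm (\<gamma> c) * r (\<tau> / 2)" using cp rp by simp
    fix w :: "real \<times> real" assume w: "w \<noteq> 0 \<and> norm w < norm (\<gamma> c) * r (\<tau> / 2)"
    then obtain l s where l: "0 < l" "s \<in> {0..s2}" "w = l *\<^sub>R \<gamma> s" using cone_eq_punctured_plane by blast
    have "norm (\<gamma> c) * l \<le> norm w" using l c(2)[OF l(2)] by (simp add: mult.commute)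
    then have "norm (\<gamma> c) * l < norm (\<gamma> c) * r (\<tau> / 2)" using w by linarith
    then have "l \<le> r (\<tau> / 2)" using cp by simp
    then obtain t where t: "0 \<le> t" "t \<le> \<tau> / 2" "r t = l"
      using IVT'[of r 0 l "\<tau> / 2"] r_0 l(1) assms continuous_on_subset[OF r_cont, of "{0..\<tau>/2}"] by auto
    then have "t \<noteq> 0" using r_0 l by auto
    then show "\<exists>s\<in>{0..s2}. \<exists>t\<in>{0<..<\<tau>}. w = F (s, t)"
      using t l assms by (intro bexI[of _ s] bexI[of _ t]) (auto simp: F_def)
  qed
qed

end

text \<open>The part \<open>h\<close> of a surface that only involves functions \<open>b j\<close> of \<open>t\<close> with value and derivative 0 at the
pole. It does not contribute to the tangent plane.\<close>
locale polar_remainder = polar_parametrization s2 t2 \<gamma> \<gamma>' r r'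
  for s2 t2 :: real and \<gamma> \<gamma>' :: "real \<Rightarrow> real \<times> real" and r r' :: "real \<Rightarrow> real" +
  fixes A :: "nat set" and b b' :: "nat \<Rightarrow> real \<Rightarrow> real" and g g' :: "nat \<Rightarrow> real \<Rightarrow> real ^ 'd::finite"
  assumes b_C1: "\<And>j. j \<in> A \<Longrightarrow> C1_on 0 t2 (b j) (b' j)"
    and b_0: "\<And>j. j \<in> A \<Longrightarrow> b j 0 = 0" and b'_0: "\<And>j. j \<in> A \<Longrightarrow> b' j 0 = 0"
    and g_deriv: "\<And>j s. j \<in> A \<Longrightarrow> (g j has_vector_derivative g' j s) (at s)"
    and g'_cont: "\<And>j. j \<in> A \<Longrightarrow> continuous_on UNIV (g' j)"
    and g_periodic: "\<And>j s n. j \<in> A \<Longrightarrow> g j (s + of_int n * s2) = g j s"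
begin

definition h :: "real \<times> real \<Rightarrow> real ^ 'd" where
  "h z = (\<Sum>j\<in>A. b j (snd z) *\<^sub>R g j (fst z))"

text \<open>The derivative of \<open>h\<close> at \<open>(s, t)\<close>.\<close>
definition Dh :: "real \<Rightarrow> real \<Rightarrow> real \<times> real \<Rightarrow> real ^ 'd" where
  "Dh s t w = (\<Sum>j\<in>A. b j t *\<^sub>R fst w *\<^sub>R g' j s + (b' j t * snd w) *\<^sub>R g j s)"

lemma h_has_derivative:
  assumes t: "t \<in> {0<..<t2}"
  shows "(h has_derivative Dh s t) (at (s, t))"
  unfolding h_def[abs_def] Dh_def[abs_def]
proof (rule has_derivative_sum)
  fix j assume j: "j \<in> A"
  have "(b j has_real_derivative b' j t) (at t)"
    using C1_on_interior[OF b_C1[OF j]] t by auto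
  then have db: "((\<lambda>z. b j (snd z)) has_derivative (\<lambda>h. b' j t * snd h)) (at (s, t))"
    by (intro has_derivative_compose[of snd snd "(s,t)" UNIV "b j" "\<lambda>h. b' j t * h"])
      (auto simp: has_field_derivative_def intro: has_derivative_snd)
  have dg: "((\<lambda>z. g j (fst z)) has_derivative (\<lambda>h. fst h *\<^sub>R g' j s)) (at (s, t))"
    by (rule has_derivative_compose[of fst fst "(s,t)" UNIV "g j" "\<lambda>h. h *\<^sub>R g' j s"])
      (use g_deriv[OF j, of s] in \<open>auto simp: has_vector_derivative_def intro: has_derivative_fst\<close>)
  show "((\<lambda>z. b j (snd z) *\<^sub>R g j (fst z)) has_derivative
      (\<lambda>w. b j t *\<^sub>R fst w *\<^sub>R g' j s + (b' j t * snd w) *\<^sub>R g j s)) (at (s, t))"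
    using has_derivative_scaleR[OF db dg] by simp
qed

text \<open>\<open>h\<close> as a function on the plane. Different preimages of \<open>w\<close> differ by a period, on which \<open>h\<close> does not
depend, so the choice is immaterial.\<close>
definition H :: "real \<times> real \<Rightarrow> real ^ 'd" where
  "H w = (if w = 0 then 0 else h (SOME z. snd z \<in> {0<..<t2} \<and> F z = w))"

lemma H_F:
  assumes "t \<in> {0..<t2}"
  shows "H (F (s, t)) = h (s, t)"
proof (cases "t = 0")
  case True
  then show ?thesis by (simp add: H_def F_def r_0 h_def b_0)
next
  case False
  then have t: "t \<in> {0<..<t2}" using assms by auto
  define z where "z = (SOME z. snd z \<in> {0<..<t2} \<and> F z = F (s, t))"
  have "\<exists>z. snd z \<in> {0<..<t2} \<and> F z = F (s, t)" using t by (intro exI[of _ "(s, t)"]) auto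
  from someI_ex[OF this] have z: "snd z \<in> {0<..<t2}" "F z = F (s, t)" by (auto simp: z_def)
  then obtain n where n: "snd z = t" "fst z = s + of_int n * s2"
    using F_inj[of t "snd z" s "fst z"] t by (auto simp: F_def)
  have "F (s, t) \<noteq> 0" using r_pos[OF t] \<gamma>_nz by (simp add: F_def)
  then have "H (F (s, t)) = h z" by (simp add: H_def z_def)
  also have "\<dots> = h (s, t)" using n by (simp add: h_def g_periodic)
  finally show ?thesis .
qed

text \<open>Near \<open>F (s, t)\<close> the function \<open>H\<close> is \<open>h\<close> composed with the inverse of \<open>F\<close> on a patch.\<close>
lemma H_has_derivative:
  assumes t: "t \<in> {0<..<t2}"
  shows "(H has_derivative (\<lambda>w. Dh s t (DF_inv s t w))) (at (F (s, t)))"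
proof -
  define G where "G = inv_into (patch s) F"
  have st: "(s, t) \<in> patch s" using t s2_pos by (auto simp: patch_def)
  have GF: "G (F z) = z" if "z \<in> patch s" for z
    using that F_inj_patch by (simp add: G_def)
  have "(G has_derivative DF_inv s t) (at (F (s, t)))"
    by (rule has_derivative_inverse_strong[OF open_patch st F_cont_patch GF F_has_derivative[OF t] DF_DF_inv[OF t]])
  moreover have "(h has_derivative Dh s t) (at (G (F (s, t))))"
    unfolding GF[OF st] by (rule h_has_derivative[OF t])
  ultimately have "((\<lambda>w. h (G w)) has_derivative (\<lambda>w. Dh s t (DF_inv s t w))) (at (F (s, t)))"
    by (rule has_derivative_compose)
  then show ?thesis
  proof (rule has_derivative_transform_within_open[OF _ open_F_patch])
    fix w assume "w \<in> F ` patch s"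
    then obtain z where z: "z \<in> patch s" "w = F z" by auto
    then show "h (G w) = H w" using GF H_F[of "snd z" "fst z"] by (auto simp: patch_def)
  qed (use st in auto)
qed

lemma uniform_limit_h: "uniform_limit {0..s2} (\<lambda>t s. h (s, t)) (\<lambda>_. 0) (at_right 0)"
proof -
  have "uniform_limit {0..s2} (\<lambda>t s. \<Sum>j\<in>A. b j t *\<^sub>R g j s) (\<lambda>_. 0) (at_right 0)"
  proof (rule uniform_limit_sum_0)
    fix j assume j: "j \<in> A"
    have "continuous_on {0..s2} (g j)"
      using g_deriv[OF j] by (meson continuous_at_imp_continuous_on has_vector_derivative_continuous)
    then show "uniform_limit {0..s2} (\<lambda>t s. b j t *\<^sub>R g j s) (\<lambda>_. 0) (at_right 0)"
      by (intro uniform_limit_scaleR_0 C1_on_quotient_at_0(3)[OF t2_pos b_C1[OF j] b_0[OF j] b'_0[OF j] r_C1 r_0])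
        (use r'_0 in auto)
  qed
  then show ?thesis by (simp add: h_def)
qed

text \<open>By Cramer's rule the first component of \<open>DF_inv\<close> carries the factor \<open>1 / r t\<close> and the second the factor
\<open>1 / r' t\<close>. They meet \<open>b j t\<close> and \<open>b' j t\<close>, and all other factors are continuous functions of \<open>s\<close>.\<close>
lemma uniform_limit_Dh: "uniform_limit {0..s2} (\<lambda>t s. Dh s t (DF_inv s t w)) (\<lambda>_. 0) (at_right 0)"
proof -
  have cont: "continuous_on {0..s2} \<gamma>" "continuous_on {0..s2} \<gamma>'"
    using \<gamma>_cont \<gamma>'_cont continuous_on_subset by blast+
  have cr: "cross (\<gamma> s) (\<gamma>' s) \<noteq> 0" for s using cross_nz[of s] cross_swap[of "\<gamma> s" "\<gamma>' s"] by simp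
  have "uniform_limit {0..s2} (\<lambda>t s. \<Sum>j\<in>A. (b j t / r t) *\<^sub>R (cross w (\<gamma> s) / cross (\<gamma>' s) (\<gamma> s)) *\<^sub>R g' j s +
      (b' j t / r' t) *\<^sub>R (cross w (\<gamma>' s) / cross (\<gamma> s) (\<gamma>' s)) *\<^sub>R g j s) (\<lambda>_. 0) (at_right 0)"
  proof (rule uniform_limit_sum_0)
    fix j assume j: "j \<in> A"
    have "continuous_on {0..s2} (g j)"
      using g_deriv[OF j] by (meson continuous_at_imp_continuous_on has_vector_derivative_continuous)
    then have c1: "continuous_on {0..s2} (\<lambda>s. (cross w (\<gamma>' s) / cross (\<gamma> s) (\<gamma>' s)) *\<^sub>R g j s)"
      using cr cont unfolding cross_def by (intro continuous_intros) auto
    have "continuous_on {0..s2} (g' j)" using g'_cont[OF j] continuous_on_subset by blast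
    then have c2: "continuous_on {0..s2} (\<lambda>s. (cross w (\<gamma> s) / cross (\<gamma>' s) (\<gamma> s)) *\<^sub>R g' j s)"
      using cross_nz cont unfolding cross_def by (intro continuous_intros) auto
    have l: "((\<lambda>t. b j t / r t) \<longlongrightarrow> 0) (at_right 0)" "((\<lambda>t. b' j t / r' t) \<longlongrightarrow> 0) (at_right 0)"
      using C1_on_quotient_at_0[OF t2_pos b_C1[OF j] b_0[OF j] b'_0[OF j] r_C1 r_0] r'_0 by auto
    show "uniform_limit {0..s2} (\<lambda>t s. (b j t / r t) *\<^sub>R (cross w (\<gamma> s) / cross (\<gamma>' s) (\<gamma> s)) *\<^sub>R g' j s +
      (b' j t / r' t) *\<^sub>R (cross w (\<gamma>' s) / cross (\<gamma> s) (\<gamma>' s)) *\<^sub>R g j s) (\<lambda>_. 0) (at_right 0)"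
      using uniform_limit_add[OF uniform_limit_scaleR_0[OF l(1) c2] uniform_limit_scaleR_0[OF l(2) c1]] by simp
  qed
  then show ?thesis by (simp add: Dh_def DF_inv_def field_simps)
qed

lemma H_small:
  assumes "0 < e"
  shows "\<forall>\<^sub>F w in at 0. norm (H w) < e \<and>
    (\<exists>D. (H has_derivative D) (at w) \<and> norm (D (1, 0)) < e \<and> norm (D (0, 1)) < e)"
proof -
  define P where "P t \<longleftrightarrow> (\<forall>s\<in>{0..s2}. norm (h (s, t)) < e) \<and>
     (\<forall>s\<in>{0..s2}. norm (Dh s t (DF_inv s t (1, 0))) < e) \<and> (\<forall>s\<in>{0..s2}. norm (Dh s t (DF_inv s t (0, 1))) < e)" for t
  have "eventually P (at_right 0)"
    using uniform_limitD[OF uniform_limit_h assms] uniform_limitD[OF uniform_limit_Dh assms, of "(1, 0)"]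
      uniform_limitD[OF uniform_limit_Dh assms, of "(0, 1)"]
    by eventually_elim (simp add: P_def)
  then have "\<exists>b>0. \<forall>t>0. t < b \<longrightarrow> P t"
    using eventually_at_right[of "0::real" 1 P] by simp
  then obtain \<tau>' where \<tau>': "0 < \<tau>'" and P: "\<forall>t>0. t < \<tau>' \<longrightarrow> P t"
    by (elim exE conjE)
  have small: "norm (h (s, t)) < e \<and> norm (Dh s t (DF_inv s t (1, 0))) < e \<and> norm (Dh s t (DF_inv s t (0, 1))) < e"
    if "0 < t" "t < \<tau>'" "s \<in> {0..s2}" for s t
    using P that by (simp add: P_def)
  define \<tau> where "\<tau> = min \<tau>' t2"
  have "\<tau> \<in> {0<..t2}" using \<tau>' t2_pos by (auto simp: \<tau>_def)
  from F_covers_neighbourhood[OF this] obtain \<delta> where \<delta>: "0 < \<delta>"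
    "\<And>w :: real \<times> real. w \<noteq> 0 \<Longrightarrow> norm w < \<delta> \<Longrightarrow> \<exists>s\<in>{0..s2}. \<exists>t\<in>{0<..<\<tau>}. w = F (s, t)" by blast
  show ?thesis
    unfolding eventually_at
  proof (intro exI[of _ \<delta>] conjI ballI impI)
    fix w :: "real \<times> real" assume "w \<noteq> 0 \<and> dist w 0 < \<delta>"
    then have w: "w \<noteq> 0" "norm w < \<delta>" by (auto simp: dist_norm)
    obtain s t where st: "s \<in> {0..s2}" "t \<in> {0<..<\<tau>}" "w = F (s, t)" using \<delta>(2)[OF w] by (elim bexE)
    then have t: "t \<in> {0<..<t2}" "0 < t" "t < \<tau>'" by (auto simp: \<tau>_def)
    show "norm (H w) < e" using small[OF t(2,3) st(1)] H_F[of t s] t st by auto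
    show "\<exists>D. (H has_derivative D) (at w) \<and> norm (D (1, 0)) < e \<and> norm (D (0, 1)) < e"
      using small[OF t(2,3) st(1)] H_has_derivative[OF t(1), of s] st(3) by blast
  qed (rule \<delta>(1))
qed

end

lemma partial_derivatives:
  fixes f :: "real \<times> real \<Rightarrow> 'a::real_normed_vector"
  assumes "(f has_derivative D) (at (u, v))"
  shows "((\<lambda>x. f (x, v)) has_vector_derivative D (1, 0)) (at u)"
    and "((\<lambda>y. f (u, y)) has_vector_derivative D (0, 1)) (at v)"
proof -
  interpret D: bounded_linear D using assms by (rule has_derivative_bounded_linear)
  have "D (x, 0) = x *\<^sub>R D (1, 0)" "D (0, x) = x *\<^sub>R D (0, 1)" for x
    using D.scaleR[of x "(1, 0)"] D.scaleR[of x "(0, 1)"] by simp_all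
  note lin = this
  have "((\<lambda>x. (x, v)) has_derivative (\<lambda>x. (x, 0))) (at u)"
    by (auto intro!: derivative_eq_intros)
  from has_derivative_compose[OF this assms]
  show "((\<lambda>x. f (x, v)) has_vector_derivative D (1, 0)) (at u)"
    unfolding has_vector_derivative_def lin(1)[symmetric] .
  have "((\<lambda>y. (u, y)) has_derivative (\<lambda>y. (0, y))) (at v)"
    by (auto intro!: derivative_eq_intros)
  from has_derivative_compose[OF this assms]
  show "((\<lambda>y. f (u, y)) has_vector_derivative D (0, 1)) (at v)"
    unfolding has_vector_derivative_def lin(2)[symmetric] .
qed

text \<open>The linear term in \<open>F\<close> becomes a linear function on the plane, and the remainder has limit 0 together
with its first derivatives.\<close>
lemma (in polar_remainder) tangent_plane_at_0:
  assumes F0: "\<And>s t. s \<in> {0..s2} \<Longrightarrow> t \<in> {0..t2} \<Longrightarrow> F0 (s, t) = F (s, t)"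
    and f: "\<And>s t. s \<in> {0..s2} \<Longrightarrow> t \<in> {0..t2} \<Longrightarrow>
        f (s, t) = q + fst (F (s, t)) *\<^sub>R a + snd (F (s, t)) *\<^sub>R c + h (s, t)"
    and ind: "a \<noteq> c" "independent {a, c}"
  shows "well_defined_tangent_plane s2 t2 0 F0 f"
proof -
  have h0: "h (s, 0) = 0" and F_0: "F (s, 0) = 0" for s by (simp_all add: h_def b_0 F_def r_0)
  define fpol where "fpol w = q + fst w *\<^sub>R a + snd w *\<^sub>R c + H w" for w
  define fu where "fu w = vector_derivative (\<lambda>x. fpol (x, snd w)) (at (fst w))" for w
  define fv where "fv w = vector_derivative (\<lambda>y. fpol (fst w, y)) (at (snd w))" for w
  define R where "R = {0..s2} \<times> {t\<in>{0..t2}. \<bar>t - 0\<bar> < t2}"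
  have zero: "(0, 0) = (0 :: real \<times> real)" by (simp add: zero_prod_def)
  have const: "\<forall>s\<in>{0..s2}. f (s, 0) = q" using f[of _ 0] t2_pos by (simp add: h0 F_0)
  have nhd: "\<forall>\<^sub>F w in nhds 0. w \<in> F0 ` R"
  proof -
    obtain \<delta> where \<delta>: "0 < \<delta>" "\<And>w :: real \<times> real. w \<noteq> 0 \<Longrightarrow> norm w < \<delta> \<Longrightarrow> \<exists>s\<in>{0..s2}. \<exists>t\<in>{0<..<t2}. w = F (s, t)"
      using F_covers_neighbourhood[of t2] t2_pos by auto
    have img: "w \<in> F0 ` R" if lt: "norm w < \<delta>" for w
    proof (cases "w = 0")
      case True
      then have "w = F0 (0, 0)" using F0[of 0 0] F_0[of 0] s2_pos t2_pos by simp
      then show ?thesis using s2_pos t2_pos by (intro image_eqI[of _ _ "(0, 0)"]) (auto simp: R_def)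
    next
      case False
      then obtain s t where st: "s \<in> {0..s2}" "t \<in> {0<..<t2}" "w = F (s, t)"
        using \<delta>(2)[OF False lt] by (elim bexE)
      then show ?thesis using F0[of s t] by (intro image_eqI[of _ _ "(s, t)"]) (auto simp: R_def)
    qed
    show ?thesis unfolding eventually_nhds_metric
    proof (intro exI[of _ \<delta>] conjI allI impI \<delta>(1))
      fix w :: "real \<times> real" assume "dist w 0 < \<delta>"
      then show "w \<in> F0 ` R" by (intro img) (simp add: dist_norm)
    qed
  qed
  have repar: "\<forall>z\<in>R. fpol (F0 z) = f z"
  proof
    fix z assume "z \<in> R"
    then have z: "fst z \<in> {0..s2}" "snd z \<in> {0..<t2}" by (auto simp: R_def)
    then show "fpol (F0 z) = f z"
      using F0[of "fst z" "snd z"] f[of "fst z" "snd z"] H_F[of "snd z" "fst z"] by (simp add: fpol_def)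
  qed
  have small: "\<forall>\<^sub>F w in at 0. norm (H w) < e \<and>
     (\<lambda>x. fpol (x, snd w)) differentiable at (fst w) \<and> dist (fu w) a < e \<and>
     (\<lambda>y. fpol (fst w, y)) differentiable at (snd w) \<and> dist (fv w) c < e" if e: "0 < e" for e
    using H_small[OF e]
  proof eventually_elim
    case (elim w)
    obtain u v where w: "w = (u, v)" by (cases w)
    obtain D where D: "(H has_derivative D) (at (u, v))" "norm (D (1, 0)) < e" "norm (D (0, 1)) < e"
      using elim unfolding w by blast
    have "(fpol has_derivative (\<lambda>w. fst w *\<^sub>R a + snd w *\<^sub>R c + D w)) (at (u, v))"
      unfolding fpol_def[abs_def] by (auto intro!: derivative_eq_intros D(1))
    note d = partial_derivatives[OF this]
    have "fu w = a + D (1, 0)" "fv w = c + D (0, 1)"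
      using vector_derivative_at[OF d(1)] vector_derivative_at[OF d(2)] by (simp_all add: fu_def fv_def w)
    then show ?case
      using elim D(2,3) differentiableI_vector[OF d(1)] differentiableI_vector[OF d(2)] by (simp add: w dist_norm)
  qed
  have diff: "\<forall>\<^sub>F w in at 0. (\<lambda>x. fpol (x, snd w)) differentiable at (fst w) \<and> (\<lambda>y. fpol (fst w, y)) differentiable at (snd w)"
    using small[of 1] by (auto elim: eventually_mono)
  have lim_u: "(fu \<longlongrightarrow> a) (at 0)" and lim_v: "(fv \<longlongrightarrow> c) (at 0)"
    by (rule tendstoI, use small in \<open>force elim: eventually_mono\<close>)+
  have "(H \<longlongrightarrow> 0) (at 0)" by (rule tendstoI, use small in \<open>force elim: eventually_mono\<close>)
  then have "(fpol \<longlongrightarrow> q + fst (0 :: real \<times> real) *\<^sub>R a + snd (0 :: real \<times> real) *\<^sub>R c + 0) (at 0)"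
    unfolding fpol_def[abs_def] by (intro tendsto_intros)
  then have lim: "(fpol \<longlongrightarrow> q) (at 0)" by simp
  show ?thesis
    unfolding well_defined_tangent_plane_def Let_def zero case_prod_unfold
    using const t2_pos nhd repar diff lim lim_u[unfolded fu_def[abs_def]] lim_v[unfolded fv_def[abs_def]] ind
    unfolding R_def by blast
qed

section \<open>Tensor product surfaces at a pole\<close>

text \<open>The partial derivatives of \<open>r(t) \<gamma>(s)\<close> are \<open>r(t) \<gamma>'(s)\<close> and \<open>r'(t) \<gamma>(s)\<close>.\<close>
lemma jacobian_det_product:
  assumes s2: "0 < s2" and t2: "0 < t2" and s: "s \<in> {0..s2}" and t: "t \<in> {0..t2}"
    and F: "\<And>s t. s \<in> {0..s2} \<Longrightarrow> t \<in> {0..t2} \<Longrightarrow> F (s, t) = r t *\<^sub>R \<gamma> s"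
    and r: "(r has_real_derivative r' t) (at t within {0..t2})"
    and \<gamma>: "(\<gamma> has_vector_derivative \<gamma>' s) (at s)"
  shows "jacobian_det s2 t2 F s t = r t * r' t * cross (\<gamma>' s) (\<gamma> s)"
proof -
  have "((\<lambda>x. r t *\<^sub>R \<gamma> x) has_vector_derivative r t *\<^sub>R \<gamma>' s) (at s within {0..s2})"
    using has_vector_derivative_at_within[OF \<gamma>] by (auto intro!: derivative_eq_intros)
  then have "((\<lambda>x. F (x, t)) has_vector_derivative r t *\<^sub>R \<gamma>' s) (at s within {0..s2})"
    by (rule has_vector_derivative_transform[OF s, rotated]) (use F t in auto)
  then have 1: "vector_derivative (\<lambda>x. F (x, t)) (at s within {0..s2}) = r t *\<^sub>R \<gamma>' s"
    using vector_derivative_within_cbox[of 0 s2 s] s s2 by simp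
  have "((\<lambda>y. r y *\<^sub>R \<gamma> s) has_vector_derivative r' t *\<^sub>R \<gamma> s) (at t within {0..t2})"
    using has_vector_derivative_scaleR[OF r has_vector_derivative_const[of "\<gamma> s"]] by simp
  then have "((\<lambda>y. F (s, y)) has_vector_derivative r' t *\<^sub>R \<gamma> s) (at t within {0..t2})"
    by (rule has_vector_derivative_transform[OF t, rotated]) (use F s in auto)
  then have 2: "vector_derivative (\<lambda>y. F (s, y)) (at t within {0..t2}) = r' t *\<^sub>R \<gamma> s"
    using vector_derivative_within_cbox[of 0 t2 t] t t2 by simp
  show ?thesis unfolding jacobian_det_def Let_def 1 2 by (simp add: cross_def algebra_simps)
qed

lemma polar_map_tensor:
  "polar_map ns nt \<rho> \<phi> (tensor Bs Bt) (s, t) =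
     (\<Sum>j=1..nt. \<rho> j * Bt j t) *\<^sub>R (\<Sum>i=1..ns. Bs i s *\<^sub>R (cos (\<phi> i), sin (\<phi> i)))"
proof -
  have "polar_map ns nt \<rho> \<phi> (tensor Bs Bt) (s, t) =
     (\<Sum>i=1..ns. \<Sum>j=1..nt. (\<rho> j * Bt j t) *\<^sub>R Bs i s *\<^sub>R (cos (\<phi> i), sin (\<phi> i)))"
    unfolding polar_map_def tensor_def by (intro sum.cong refl) (simp add: mult.commute mult.left_commute)
  also have "\<dots> = (\<Sum>i=1..ns. (\<Sum>j=1..nt. \<rho> j * Bt j t) *\<^sub>R Bs i s *\<^sub>R (cos (\<phi> i), sin (\<phi> i)))"
    by (simp only: scaleR_sum_left)
  finally show ?thesis by (simp only: scaleR_sum_right)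
qed

lemma independent_pair_scaled:
  fixes a c :: "'a::real_vector"
  assumes ind: "\<And>x y. x *\<^sub>R a + y *\<^sub>R c = 0 \<Longrightarrow> x = 0 \<and> y = 0" and k: "k \<noteq> 0"
  shows "k *\<^sub>R a \<noteq> k *\<^sub>R c" "independent {k *\<^sub>R a, k *\<^sub>R c}"
proof -
  show ne: "k *\<^sub>R a \<noteq> k *\<^sub>R c" using ind[of k "- k"] k by auto
  have "c \<noteq> 0" using ind[of 0 1] by auto
  moreover have "k *\<^sub>R a \<notin> span {k *\<^sub>R c}"
  proof
    assume "k *\<^sub>R a \<in> span {k *\<^sub>R c}"
    then obtain d where "k *\<^sub>R a = d *\<^sub>R k *\<^sub>R c" unfolding span_singleton by auto
    then have "k *\<^sub>R a + (- (d * k)) *\<^sub>R c = 0" by simp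
    then show False using ind k by blast
  qed
  ultimately show "independent {k *\<^sub>R a, k *\<^sub>R c}" using k ne by (simp add: independent_insert)
qed

text \<open>A second basis with the behaviour of the non-periodic one at \<open>t = 0\<close>: only the first two functions
have a non-zero value or derivative there.\<close>
locale tensor_pole = periodic_family ns s2 Bs Bs'
  for ns :: nat and s2 :: real and Bs Bs' :: "nat \<Rightarrow> real \<Rightarrow> real" +
  fixes nt :: nat and t2 :: real and Bt Bt' :: "nat \<Rightarrow> real \<Rightarrow> real" and c0 :: real
  assumes nt: "4 \<le> nt" and t2_pos: "0 < t2"
    and Bt_C1: "\<And>j. j \<in> {1..nt} \<Longrightarrow> C1_on 0 t2 (Bt j) (Bt' j)"
    and Bt_nonneg: "\<And>j t. j \<in> {1..nt} \<Longrightarrow> t \<in> {0..t2} \<Longrightarrow> 0 \<le> Bt j t"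
    and Bt_sum: "\<And>t. t \<in> {0..t2} \<Longrightarrow> (\<Sum>j=1..nt. Bt j t) = 1"
    and Bt_0: "\<And>j. j \<in> {1..nt} \<Longrightarrow> Bt j 0 = of_bool (j = 1)"
    and Bt'_0: "\<And>j. j \<in> {1..nt} \<Longrightarrow> Bt' j 0 = c0 * (of_bool (j = 2) - of_bool (j = 1))"
    and c0: "0 < c0"
begin

text \<open>The coefficient curves of \<open>Bt 1\<close> and \<open>Bt 2\<close> are \<open>q\<close> and \<open>q + Lv (\<gamma> s)\<close>. Subtracting
\<open>q + (j - 1) Lv (\<gamma> s)\<close> from the coefficient curve of every \<open>Bt j\<close> removes these two, and the subtracted
part sums to \<open>q + (nt - 1) Lv (F (s, t))\<close>, as \<open>j - 1 = (nt - 1) * rho nt j\<close>.\<close>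
lemma tangent_plane:
  fixes f :: "real \<times> real \<Rightarrow> real ^ 'd::finite"
  assumes reg: "regular_off_pole s2 t2 {0<..t2} F0"
    and F0: "\<And>z. F0 z = polar_map ns nt (rho nt) \<phi> (tensor Bs Bt) z"
    and f: "\<And>z. f z = (\<Sum>j=1..nt. \<Sum>i=1..ns. tensor Bs Bt i j z *\<^sub>R P i j)"
    and P1: "\<And>i. i \<in> {1..ns} \<Longrightarrow> P i 1 = q"
    and P2: "\<And>i. i \<in> {1..ns} \<Longrightarrow> P i 2 = q + (cos (\<phi> i) *\<^sub>R a + sin (\<phi> i) *\<^sub>R c)"
    and ind: "\<And>x y. x *\<^sub>R a + y *\<^sub>R c = 0 \<Longrightarrow> x = 0 \<and> y = 0"
  shows "well_defined_tangent_plane s2 t2 0 F0 f"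
proof -
  define v where "v i = (cos (\<phi> i), sin (\<phi> i))" for i
  define \<gamma> where "\<gamma> = curve v"
  define \<gamma>' where "\<gamma>' = curve' v"
  define r where "r t = (\<Sum>j=1..nt. rho nt j * Bt j t)" for t
  define r' where "r' t = (\<Sum>j=1..nt. rho nt j * Bt' j t)" for t
  define Lv where "Lv w = fst w *\<^sub>R a + snd w *\<^sub>R c" for w :: "real \<times> real"
  \<comment> \<open>Control points of the coefficient curve of \<open>Bt j\<close> minus \<open>q + (j - 1) Lv (\<gamma> s)\<close>; the constant \<open>q\<close> is
    itself a curve of this kind, because the \<open>Bs i\<close> sum to 1.\<close>
  define V where "V j i = P i j + ((- 1) *\<^sub>R q + (- (real j - 1)) *\<^sub>R Lv (v i))" for j i
  have F_eq: "F0 (s, t) = r t *\<^sub>R \<gamma> s" if "s \<in> {0..s2}" for s t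
    unfolding F0 polar_map_tensor r_def \<gamma>_def curve_eq[OF that] v_def ..
  have \<gamma>_deriv: "(\<gamma> has_vector_derivative \<gamma>' s) (at s)" for s unfolding \<gamma>_def \<gamma>'_def by (rule curve_deriv)
  have r_C1: "C1_on 0 t2 r r'"
    unfolding r_def[abs_def] r'_def[abs_def] by (intro C1_on_sum Bt_C1)
  have jac: "r t * r' t * cross (\<gamma>' s) (\<gamma> s) \<noteq> 0" if s: "s \<in> {0..s2}" and t: "t \<in> {0<..t2}" for s t
  proof -
    have "jacobian_det s2 t2 F0 s t = r t * r' t * cross (\<gamma>' s) (\<gamma> s)"
      by (rule jacobian_det_product[where r = r and r' = r' and \<gamma> = \<gamma> and \<gamma>' = \<gamma>'])
        (use s2_pos t2_pos s t F_eq \<gamma>_deriv r_C1 in \<open>auto simp: C1_on_def\<close>)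
    then show ?thesis using reg s t unfolding regular_off_pole_def by metis
  qed
  have per: "\<gamma> (s + of_int n * s2) = \<gamma> s" "\<gamma>' (s + of_int n * s2) = \<gamma>' s" for s n
    unfolding \<gamma>_def \<gamma>'_def by (rule curve_periodic)+
  have rho1: "rho nt 1 = 0" and rho2: "0 < rho nt 2" using nt by (auto simp: rho_def)
  have rho_nn: "0 \<le> rho nt j" if "1 \<le> j" for j using nt that by (auto simp: rho_def)
  have L_curve: "Lv (curve W s) = curve (\<lambda>i. Lv (W i)) s" for W s
    unfolding Lv_def curve_def by (simp add: fst_sum snd_sum scaleR_sum_left scaleR_add_right sum.distrib)
  interpret polar_remainder s2 t2 \<gamma> \<gamma>' r r' "{3..nt}" Bt Bt' "\<lambda>j. curve (V j)" "\<lambda>j. curve' (V j)"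
  proof unfold_locales
    show "0 < s2" "0 < t2" by (rule s2_pos t2_pos)+
    show "(\<gamma> has_vector_derivative \<gamma>' s) (at s)" for s by (rule \<gamma>_deriv)
    show "continuous_on UNIV \<gamma>'" unfolding \<gamma>'_def by (rule curve'_cont)
    show "\<gamma> (s + of_int n * s2) = \<gamma> s" for s n by (rule per)
    show "cross (\<gamma>' s) (\<gamma> s) \<noteq> 0" for s
    proof -
      obtain n where "s + of_int n * s2 \<in> {0..s2}" using shift_into_period[OF s2_pos] by blast
      from jac[OF this, of t2] show ?thesis using per t2_pos by auto
    qed
    have "r 0 = (\<Sum>j=1..nt. rho nt j * of_bool (j = 1))" unfolding r_def by (intro sum.cong refl) (simp add: Bt_0)
    also have "\<dots> = 0" using nt rho1 by (subst sum_of_bool_mult) auto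
    finally show "r 0 = 0" .
    show "C1_on 0 t2 r r'" by (rule r_C1)
    have "r' 0 = c0 * ((\<Sum>j=1..nt. rho nt j * of_bool (j = 2)) - (\<Sum>j=1..nt. rho nt j * of_bool (j = 1)))"
      unfolding r'_def sum_distrib_left sum_subtractf[symmetric]
      by (intro sum.cong refl) (simp add: Bt'_0 algebra_simps)
    also have "\<dots> = c0 * rho nt 2" using nt rho1 by (subst (1 2) sum_of_bool_mult) auto
    finally show "0 < r' 0" using c0 rho2 by simp
    show "0 < r t" if "t \<in> {0<..<t2}" for t
    proof -
      have "0 \<le> r t" unfolding r_def using that by (intro sum_nonneg mult_nonneg_nonneg rho_nn Bt_nonneg) auto
      moreover have "r t \<noteq> 0" using jac[of 0 t] that s2_pos by auto
      ultimately show ?thesis by simp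
    qed
    show "r' t \<noteq> 0" if "t \<in> {0<..<t2}" for t
      using jac[of 0 t] that s2_pos by auto
    show "t = u \<and> (\<exists>n::int. s' = s + of_int n * s2)"
      if t: "t \<in> {0<..<t2}" and u: "u \<in> {0<..<t2}" and eq: "r t *\<^sub>R \<gamma> s = r u *\<^sub>R \<gamma> s'" for s t u s'
    proof -
      obtain n where n: "s + of_int n * s2 \<in> {0..s2}" using shift_into_period[OF s2_pos] by blast
      obtain k where k: "s' + of_int k * s2 \<in> {0..s2}" using shift_into_period[OF s2_pos] by blast
      have eqF: "F0 (s + of_int n * s2, t) = F0 (s' + of_int k * s2, u)"
        unfolding F_eq[OF n] F_eq[OF k] per by (rule eq)
      have tu': "t \<in> {0<..t2}" "u \<in> {0<..t2}" using t u by auto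
      have tu: "t = u" and ss: "s + of_int n * s2 = s' + of_int k * s2 \<or> {s + of_int n * s2, s' + of_int k * s2} = {0, s2}"
        using conjunct1[OF reg[unfolded regular_off_pole_def], rule_format, OF n tu'(1) k tu'(2) eqF] by blast+
      from ss consider "s + of_int n * s2 = s' + of_int k * s2" | "s + of_int n * s2 = 0" "s' + of_int k * s2 = s2"
        | "s + of_int n * s2 = s2" "s' + of_int k * s2 = 0"
        by (auto simp: doubleton_eq_iff)
      then have "\<exists>n::int. s' = s + of_int n * s2"
      proof cases
        case 1
        then show ?thesis by (intro exI[of _ "n - k"]) (simp add: algebra_simps)
      next
        case 2
        then show ?thesis by (intro exI[of _ "n - k + 1"]) (simp add: algebra_simps)
      next
        case 3
        then show ?thesis by (intro exI[of _ "n - k - 1"]) (simp add: algebra_simps)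
      qed
      then show ?thesis using tu by blast
    qed
    show "C1_on 0 t2 (Bt j) (Bt' j)" "Bt j 0 = 0" "Bt' j 0 = 0" if "j \<in> {3..nt}" for j
      using Bt_C1[of j] Bt_0[of j] Bt'_0[of j] that by auto
    show "(curve (V j) has_vector_derivative curve' (V j) s) (at s)" for j s by (rule curve_deriv)
    show "continuous_on UNIV (curve' (V j))" for j by (rule curve'_cont)
    show "curve (V j) (s + of_int n * s2) = curve (V j) s" for j s n by (rule curve_periodic)
  qed
  define k where "k = real nt - 1"
  have k: "k \<noteq> 0" using nt by (simp add: k_def)
  have F0': "F0 (s, t) = F (s, t)" if "s \<in> {0..s2}" "t \<in> {0..t2}" for s t
    using F_eq[OF that(1)] by (simp add: F_def)
  have cP: "curve (\<lambda>i. P i j) s = (q + (real j - 1) *\<^sub>R Lv (\<gamma> s)) + (if 3 \<le> j then curve (V j) s else 0)"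
    if j: "j \<in> {1..nt}" for j s
  proof -
    have "curve (V j) s = curve (\<lambda>i. P i j) s + ((- 1) *\<^sub>R q + (- (real j - 1)) *\<^sub>R Lv (\<gamma> s))"
      unfolding V_def[abs_def] curve_linear curve_const \<gamma>_def L_curve ..
    moreover have "curve (V j) s = 0" if "\<not> 3 \<le> j"
    proof -
      have "j = 1 \<or> j = 2" using j that by auto
      then have "V j i = 0" if "i \<in> {1..ns}" for i
        using P1[OF that] P2[OF that] by (auto simp: V_def Lv_def v_def)
      then show ?thesis unfolding curve_def by simp
    qed
    ultimately show ?thesis by (cases "3 \<le> j") (simp_all add: algebra_simps)
  qed
  have f': "f (s, t) = q + fst (F (s, t)) *\<^sub>R (k *\<^sub>R a) + snd (F (s, t)) *\<^sub>R (k *\<^sub>R c) + h (s, t)"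
    if s: "s \<in> {0..s2}" and t: "t \<in> {0..t2}" for s t
  proof -
    have "f (s, t) = (\<Sum>j=1..nt. Bt j t *\<^sub>R curve (\<lambda>i. P i j) s)"
      unfolding f curve_eq[OF s] tensor_def by (simp add: scaleR_sum_right mult.commute)
    also have "\<dots> = (\<Sum>j=1..nt. Bt j t *\<^sub>R q + (Bt j t * (real j - 1)) *\<^sub>R Lv (\<gamma> s)
        + (if 3 \<le> j then Bt j t *\<^sub>R curve (V j) s else 0))"
      by (intro sum.cong refl) (simp add: cP scaleR_add_right)
    also have "\<dots> = (\<Sum>j=1..nt. Bt j t) *\<^sub>R q + (\<Sum>j=1..nt. Bt j t * (real j - 1)) *\<^sub>R Lv (\<gamma> s)
        + (\<Sum>j=1..nt. if 3 \<le> j then Bt j t *\<^sub>R curve (V j) s else 0)"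
      by (simp only: sum.distrib scaleR_sum_left)
    also have "(\<Sum>j=1..nt. if 3 \<le> j then Bt j t *\<^sub>R curve (V j) s else 0) = h (s, t)"
      unfolding h_def by (rule sum.mono_neutral_cong_right) auto
    also have "(\<Sum>j=1..nt. Bt j t * (real j - 1)) = k * r t"
      unfolding r_def sum_distrib_left using k by (intro sum.cong refl) (simp add: rho_def k_def)
    also have "(k * r t) *\<^sub>R Lv (\<gamma> s) = fst (F (s, t)) *\<^sub>R (k *\<^sub>R a) + snd (F (s, t)) *\<^sub>R (k *\<^sub>R c)"
      by (simp add: Lv_def F_def algebra_simps)
    finally show ?thesis unfolding Bt_sum[OF t] by (simp add: add.assoc)
  qed
  from tangent_plane_at_0[OF F0' f' independent_pair_scaled[OF ind k]] show ?thesis .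
qed

end

section \<open>Reflection between the two poles\<close>

lemma well_defined_tangent_plane_reflect:
  assumes "well_defined_tangent_plane s2 t2 0 (\<lambda>(s,t). F (s, t2 - t)) (\<lambda>(s,t). f (s, t2 - t))"
  shows "well_defined_tangent_plane s2 t2 t2 F f"
proof -
  let ?F = "\<lambda>(s,t). F (s, t2 - t)" and ?f = "\<lambda>(s,t). f (s, t2 - t)"
  have img: "?F ` ({0..s2} \<times> {t\<in>{0..t2}. \<bar>t - 0\<bar> < \<epsilon>}) = F ` ({0..s2} \<times> {t\<in>{0..t2}. \<bar>t - t2\<bar> < \<epsilon>})" for \<epsilon>
  proof (intro equalityI subsetI)
    fix w assume "w \<in> ?F ` ({0..s2} \<times> {t\<in>{0..t2}. \<bar>t - 0\<bar> < \<epsilon>})"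
    then obtain s t where "s \<in> {0..s2}" "t \<in> {0..t2}" "\<bar>t - 0\<bar> < \<epsilon>" "w = F (s, t2 - t)" by auto
    then show "w \<in> F ` ({0..s2} \<times> {t\<in>{0..t2}. \<bar>t - t2\<bar> < \<epsilon>})"
      by (intro image_eqI[of _ _ "(s, t2 - t)"]) auto
  next
    fix w assume "w \<in> F ` ({0..s2} \<times> {t\<in>{0..t2}. \<bar>t - t2\<bar> < \<epsilon>})"
    then obtain s t where "s \<in> {0..s2}" "t \<in> {0..t2}" "\<bar>t - t2\<bar> < \<epsilon>" "w = F (s, t)" by auto
    then show "w \<in> ?F ` ({0..s2} \<times> {t\<in>{0..t2}. \<bar>t - 0\<bar> < \<epsilon>})"
      by (intro image_eqI[of _ _ "(s, t2 - t)"]) auto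
  qed
  have all: "(\<forall>z\<in>{0..s2} \<times> {t\<in>{0..t2}. \<bar>t - t2\<bar> < \<epsilon>}. fpol (F z) = f z)"
    if *: "\<forall>z\<in>{0..s2} \<times> {t\<in>{0..t2}. \<bar>t - 0\<bar> < \<epsilon>}. fpol (?F z) = ?f z" for \<epsilon> fpol
  proof
    fix z assume z: "z \<in> {0..s2} \<times> {t\<in>{0..t2}. \<bar>t - t2\<bar> < \<epsilon>}"
    then show "fpol (F z) = f z" using bspec[OF *, of "(fst z, t2 - snd z)"] by (cases z) auto
  qed
  have const: "\<exists>q. \<forall>s\<in>{0..s2}. f (s, t2) = q"
    using assms unfolding well_defined_tangent_plane_def by simp
  obtain \<epsilon> fpol where *: "0 < \<epsilon>" "\<forall>\<^sub>F w in nhds (0,0). w \<in> ?F ` ({0..s2} \<times> {t\<in>{0..t2}. \<bar>t - 0\<bar> < \<epsilon>})"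
    "\<forall>z\<in>{0..s2} \<times> {t\<in>{0..t2}. \<bar>t - 0\<bar> < \<epsilon>}. fpol (?F z) = ?f z"
    "\<forall>\<^sub>F (u,v) in at (0,0).
           (\<lambda>x. fpol (x,v)) differentiable at u \<and> (\<lambda>y. fpol (u,y)) differentiable at v"
    "\<exists>L Du Dv.
           (fpol \<longlongrightarrow> L) (at (0,0)) \<and>
           ((\<lambda>(u,v). vector_derivative (\<lambda>x. fpol (x,v)) (at u)) \<longlongrightarrow> Du) (at (0,0)) \<and>
           ((\<lambda>(u,v). vector_derivative (\<lambda>y. fpol (u,y)) (at v)) \<longlongrightarrow> Dv) (at (0,0)) \<and>
           Du \<noteq> Dv \<and> independent {Du, Dv}"
    using assms unfolding well_defined_tangent_plane_def Let_def by blast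
  show ?thesis
    unfolding well_defined_tangent_plane_def Let_def
    using const *(1) *(2)[unfolded img] all[OF *(3)] *(4,5) by blast
qed

lemma regular_off_pole_reflect:
  assumes s2: "0 < s2" and t2: "0 < t2"
    and F: "\<And>s t. s \<in> {0..s2} \<Longrightarrow> t \<in> {0..t2} \<Longrightarrow> F (s, t) = r t *\<^sub>R \<gamma> s"
    and r: "C1_on 0 t2 r r'"
    and \<gamma>: "\<And>s. (\<gamma> has_vector_derivative \<gamma>' s) (at s)"
    and reg: "regular_off_pole s2 t2 {0..<t2} F"
  shows "regular_off_pole s2 t2 {0<..t2} (\<lambda>(s, t). F (s, t2 - t))"
proof -
  note reg' = reg[unfolded regular_off_pole_def]
  show ?thesis
    unfolding regular_off_pole_def prod.case
  proof (intro conjI ballI impI)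
    fix s t s' t' assume *: "s \<in> {0..s2}" "t \<in> {0<..t2}" "s' \<in> {0..s2}" "t' \<in> {0<..t2}"
      and eq: "F (s, t2 - t) = F (s', t2 - t')"
    have t: "t2 - t \<in> {0..<t2}" "t2 - t' \<in> {0..<t2}" using * by auto
    have "t2 - t = t2 - t' \<and> (s = s' \<or> {s, s'} = {0, s2})"
      by (rule conjunct1[OF reg', rule_format, OF *(1) t(1) *(3) t(2) eq])
    then show "t = t'" "s = s' \<or> {s, s'} = {0, s2}" by auto
  next
    fix s t assume *: "s \<in> {0..s2}" "t \<in> {0<..t2}"
    then have t: "t2 - t \<in> {0..<t2}" by auto
    show "F (s, t2 - t) \<noteq> (0, 0)"
      by (rule conjunct1[OF conjunct2[OF reg'], rule_format, OF *(1) t])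
    have 1: "jacobian_det s2 t2 F s (t2 - t) = r (t2 - t) * r' (t2 - t) * cross (\<gamma>' s) (\<gamma> s)"
      by (rule jacobian_det_product[where r = r and r' = r' and \<gamma> = \<gamma> and \<gamma>' = \<gamma>'])
        (use s2 t2 * F \<gamma> r in \<open>auto simp: C1_on_def\<close>)
    have 2: "jacobian_det s2 t2 (\<lambda>(s, t). F (s, t2 - t)) s t
        = r (t2 - t) * (- r' (t2 - t)) * cross (\<gamma>' s) (\<gamma> s)"
      by (rule jacobian_det_product[where r = "\<lambda>t. r (t2 - t)" and r' = "\<lambda>t. - r' (t2 - t)" and \<gamma> = \<gamma> and \<gamma>' = \<gamma>'])
        (use s2 t2 * F \<gamma> C1_on_reflect[OF r] in \<open>auto simp: C1_on_def\<close>)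
    have "jacobian_det s2 t2 F s (t2 - t) \<noteq> 0"
      by (rule conjunct2[OF conjunct2[OF reg'], rule_format, OF *(1) t])
    then show "jacobian_det s2 t2 (\<lambda>(s, t). F (s, t2 - t)) s t \<noteq> 0" unfolding 1 2 by simp
  qed
qed

lemma sum_reverse:
  fixes h :: "nat \<Rightarrow> 'a::comm_monoid_add"
  shows "(\<Sum>j=1..n. h j) = (\<Sum>j=1..n. h (n + 1 - j))"
  by (rule sum.reindex_bij_witness[of _ "\<lambda>j. n + 1 - j" "\<lambda>j. n + 1 - j"]) auto

lemma rho_reverse:
  assumes "4 \<le> nt" "j \<in> {1..nt}"
  shows "rho_hat nt (nt + 1 - j) = rho nt j"
proof -
  have "real (nt + 1 - j) = real nt + 1 - real j" using assms by (simp add: of_nat_diff)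
  then show ?thesis using assms by (simp add: rho_hat_def rho_def field_simps)
qed

section \<open>Polar splines with two poles\<close>

text \<open>In addition the second basis behaves at \<open>t = t2\<close> as it does at \<open>t = 0\<close> with the order of the
functions reversed.\<close>
locale double_pole = tensor_pole ns s2 Bs Bs' nt t2 Bt Bt' c0
  for ns :: nat and s2 :: real and Bs Bs' :: "nat \<Rightarrow> real \<Rightarrow> real"
    and nt :: nat and t2 :: real and Bt Bt' :: "nat \<Rightarrow> real \<Rightarrow> real" and c0 :: real +
  fixes c1 :: real
  assumes ns: "3 \<le> ns" and c1: "0 < c1"
    and Bs_nonneg: "\<And>i s. i \<in> {1..ns} \<Longrightarrow> s \<in> {0..s2} \<Longrightarrow> 0 \<le> Bs i s"
    and Bs_independent: "\<And>c i. (\<And>s. s \<in> {0..s2} \<Longrightarrow> (\<Sum>i=1..ns. c i * Bs i s) = 0) \<Longrightarrow> i \<in> {1..ns} \<Longrightarrow> c i = 0"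
    and Bt_independent: "\<And>c j. (\<And>t. t \<in> {0..t2} \<Longrightarrow> (\<Sum>j=1..nt. c j * Bt j t) = 0) \<Longrightarrow> j \<in> {1..nt} \<Longrightarrow> c j = 0"
    and Bt_end: "\<And>j. j \<in> {1..nt} \<Longrightarrow> Bt j t2 = of_bool (j = nt)"
    and Bt'_end: "\<And>j. j \<in> {1..nt} \<Longrightarrow> Bt' j t2 = c1 * (of_bool (j = nt) - of_bool (j = nt - 1))"
begin

abbreviation "B \<equiv> tensor Bs Bt"
abbreviation "N \<equiv> polar_spline ns nt B"
abbreviation "n \<equiv> ns * (nt - 4) + 6"
abbreviation "rect \<equiv> {0..s2} \<times> {0..t2}"

lemma N_sum: "l \<in> {1..n} \<Longrightarrow> N l z = (\<Sum>j=1..nt. \<Sum>i=1..ns. E_coef ns nt l i j * B i j z)"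
  using ns by (intro polar_spline_sum nt) auto

lemma surface:
  "(\<Sum>l=1..n. N l z *\<^sub>R f l) = (\<Sum>j=1..nt. \<Sum>i=1..ns. B i j z *\<^sub>R tensor_control_point ns nt f i j)"
  using ns by (intro polar_surface_sum nt) auto

text \<open>The coefficients of a vanishing combination of polar splines in the independent functions \<open>B i j\<close> are the
tensor product control points, and the rows of the extraction matrix are independent.\<close>
lemma splines_independent: "lin_indep_funs rect n N"
  unfolding lin_indep_funs_def
proof (intro allI impI ballI)
  fix c l assume c: "\<forall>z\<in>rect. (\<Sum>l=1..n. c l * N l z) = 0" and l: "l \<in> {1..n}"
  have "tensor_control_point ns nt c i j = 0" if i: "i \<in> {1..ns}" and j: "j \<in> {1..nt}" for i j
  proof (rule Bs_independent[of "\<lambda>i. tensor_control_point ns nt c i j", OF _ i])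
    fix s assume s: "s \<in> {0..s2}"
    show "(\<Sum>i=1..ns. tensor_control_point ns nt c i j * Bs i s) = 0"
    proof (rule Bt_independent[of "\<lambda>j. \<Sum>i=1..ns. tensor_control_point ns nt c i j * Bs i s", OF _ j])
      fix t assume t: "t \<in> {0..t2}"
      have "0 = (\<Sum>l=1..n. N l (s, t) *\<^sub>R c l)" using c s t by (simp add: mult.commute)
      also have "\<dots> = (\<Sum>j=1..nt. (\<Sum>i=1..ns. tensor_control_point ns nt c i j * Bs i s) * Bt j t)"
        unfolding surface sum_distrib_right tensor_def by (simp add: ac_simps)
      finally show "(\<Sum>j=1..nt. (\<Sum>i=1..ns. tensor_control_point ns nt c i j * Bs i s) * Bt j t) = 0" ..
    qed
  qed
  then show "c l = 0" using polar_spline_rows_independent[OF ns nt _ l] by blast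
qed

lemma splines_locally_supported: "locally_supported rect ns nt n B N"
  unfolding locally_supported_def
proof (intro ballI impI)
  fix l z assume l: "l \<in> {1..n}" and z: "z \<in> rect"
    and out: "z \<notin> \<Union> {closure (support_on rect (B i j)) | i j. i \<in> {1..ns} \<and> j \<in> {1..nt} \<and>
                E_mat ns nt $$ (l-1, (i-1) + (j-1) * ns) \<noteq> 0}"
  have "E_coef ns nt l i j * B i j z = 0" if "i \<in> {1..ns}" "j \<in> {1..nt}" for i j
  proof (rule ccontr)
    assume "E_coef ns nt l i j * B i j z \<noteq> 0"
    then have "E_mat ns nt $$ (l-1, (i-1) + (j-1) * ns) \<noteq> 0" "z \<in> support_on rect (B i j)"
      using z by (auto simp: E_coef_def support_on_def)
    then show False using out that closure_subset by blast
  qed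
  then show "N l z = 0" unfolding N_sum[OF l] by (intro sum.neutral ballI)
qed

lemma splines_partition_of_unity: "convex_partition_of_unity rect n N"
  unfolding convex_partition_of_unity_def
proof (intro ballI conjI)
  fix z assume z: "z \<in> rect"
  show "0 \<le> N l z" if "l \<in> {1..n}" for l
    unfolding N_sum[OF that]
    using z Bs_nonneg Bt_nonneg
    by (intro sum_nonneg mult_nonneg_nonneg E_coef_nonneg[OF nt that]) (auto simp: tensor_def)
  have "(\<Sum>l=1..n. N l z) = (\<Sum>l=1..n. N l z *\<^sub>R 1)" by simp
  also have "\<dots> = (\<Sum>j=1..nt. \<Sum>i=1..ns. B i j z)"
    unfolding surface using E_coef_column_sum[OF nt] by (intro sum.cong refl) (simp add: tensor_control_point_def)
  also have "\<dots> = (\<Sum>j=1..nt. (\<Sum>i=1..ns. Bs i (fst z)) * Bt j (snd z))"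
    unfolding sum_distrib_right tensor_def by (simp add: split_beta)
  also have "\<dots> = 1" using z Bs_sum[of "fst z"] Bt_sum[of "snd z"] by auto
  finally show "(\<Sum>l=1..n. N l z) = 1" .
qed

lemma tangent_plane_first_pole:
  fixes f :: "nat \<Rightarrow> real ^ 'd::finite"
  assumes reg: "regular_off_pole s2 t2 {0<..t2} (polar_map ns nt (rho nt) (theta ns) B)"
    and nc: "\<not> collinear {f 1, f 2, f 3}"
  shows "well_defined_tangent_plane s2 t2 0 (polar_map ns nt (rho nt) (theta ns) B) (\<lambda>z. \<Sum>l=1..n. N l z *\<^sub>R f l)"
proof -
  define g where "g a = f (a + 1)" for a
  have "\<not> collinear {g 0, g 1, g 2}" using nc by (simp add: g_def numeral_eq_Suc)
  note ind = pole_map_injective[OF this]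
  show ?thesis
  proof (rule tangent_plane[OF reg refl surface, where q = "pole_center g", OF _ _ ind])
    fix i assume i: "i \<in> {1..ns}"
    show "tensor_control_point ns nt f i 1 = pole_center g"
      using control_point_first_pole(1)[OF nt i, of f] by (simp add: g_def[abs_def])
    show "tensor_control_point ns nt f i 2 = pole_center g + (cos (theta ns i) *\<^sub>R ((1/3) *\<^sub>R g 0 - (1/6) *\<^sub>R g 1 - (1/6) *\<^sub>R g 2)
        + sin (theta ns i) *\<^sub>R ((sqrt 3 / 6) *\<^sub>R (g 1 - g 2)))"
      using control_point_first_pole(2)[OF nt i, of f] unfolding pole_map_eq fst_conv snd_conv g_def[symmetric] .
  qed
qed

definition Bt_refl :: "nat \<Rightarrow> real \<Rightarrow> real" where
  "Bt_refl j t = Bt (nt + 1 - j) (t2 - t)"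

definition Bt'_refl :: "nat \<Rightarrow> real \<Rightarrow> real" where
  "Bt'_refl j t = - Bt' (nt + 1 - j) (t2 - t)"

text \<open>The substitution of \<open>t2 - t\<close> for \<open>t\<close> and of \<open>nt + 1 - j\<close> for \<open>j\<close> turns the second pole into a first pole.\<close>
lemma reflected: "tensor_pole ns s2 Bs Bs' nt t2 Bt_refl Bt'_refl c1"
proof unfold_locales
  show "4 \<le> nt" "0 < t2" "0 < c1" by (rule nt t2_pos c1)+
  show "(\<Sum>j=1..nt. Bt_refl j t) = 1" if "t \<in> {0..t2}" for t
    unfolding Bt_refl_def using sum_reverse[of "\<lambda>j. Bt j (t2 - t)" nt] Bt_sum[of "t2 - t"] that by simp
  fix j assume j: "j \<in> {1..nt}"
  then have j': "nt + 1 - j \<in> {1..nt}" by auto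
  show "C1_on 0 t2 (Bt_refl j) (Bt'_refl j)"
    unfolding Bt_refl_def[abs_def] Bt'_refl_def[abs_def] by (rule C1_on_reflect[OF Bt_C1[OF j']])
  show "0 \<le> Bt_refl j t" if "t \<in> {0..t2}" for t unfolding Bt_refl_def using that by (intro Bt_nonneg j') auto
  have "nt + 1 - j = nt \<longleftrightarrow> j = 1" "nt + 1 - j = nt - 1 \<longleftrightarrow> j = 2" using j nt by auto
  then show "Bt_refl j 0 = of_bool (j = 1)" "Bt'_refl j 0 = c1 * (of_bool (j = 2) - of_bool (j = 1))"
    using Bt_end[OF j'] Bt'_end[OF j'] unfolding Bt_refl_def Bt'_refl_def by (simp_all add: algebra_simps)
qed

text \<open>Under this substitution \<open>rho_hat\<close> becomes \<open>rho\<close>, and the last two rows of control points become the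
first two.\<close>
lemma tangent_plane_last_pole:
  fixes f :: "nat \<Rightarrow> real ^ 'd::finite"
  assumes reg: "regular_off_pole s2 t2 {0..<t2} (polar_map ns nt (rho_hat nt) (theta_hat ns) B)"
    and nc: "\<not> collinear {f (n - 2), f (n - 1), f n}"
  shows "well_defined_tangent_plane s2 t2 t2 (polar_map ns nt (rho_hat nt) (theta_hat ns) B) (\<lambda>z. \<Sum>l=1..n. N l z *\<^sub>R f l)"
proof (rule well_defined_tangent_plane_reflect)
  define Fhat where "Fhat = polar_map ns nt (rho_hat nt) (theta_hat ns) B"
  define v where "v i = (cos (theta_hat ns i), sin (theta_hat ns i))" for i
  have Fhat: "Fhat (s, t) = (\<Sum>j=1..nt. rho_hat nt j * Bt j t) *\<^sub>R curve v s" if "s \<in> {0..s2}" for s t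
    unfolding Fhat_def polar_map_tensor curve_eq[OF that] v_def ..
  have C1: "C1_on 0 t2 (\<lambda>t. \<Sum>j=1..nt. rho_hat nt j * Bt j t) (\<lambda>t. \<Sum>j=1..nt. rho_hat nt j * Bt' j t)"
    by (intro C1_on_sum Bt_C1)
  have reg': "regular_off_pole s2 t2 {0<..t2} (\<lambda>(s, t). Fhat (s, t2 - t))"
    by (rule regular_off_pole_reflect[OF s2_pos t2_pos Fhat C1 curve_deriv reg[folded Fhat_def]])
  define g where "g a = f (n - a)" for a
  have "\<not> collinear {g 0, g 1, g 2}" using nc unfolding g_def by (simp add: insert_commute)
  note ind = pole_map_injective[OF this]
  show "well_defined_tangent_plane s2 t2 0 (\<lambda>(s, t). polar_map ns nt (rho_hat nt) (theta_hat ns) B (s, t2 - t))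
      (\<lambda>(s, t). \<Sum>l=1..n. N l (s, t2 - t) *\<^sub>R f l)"
    unfolding Fhat_def[symmetric]
  proof (rule tensor_pole.tangent_plane[OF reflected reg', where P = "\<lambda>i j. tensor_control_point ns nt f i (nt + 1 - j)"
        and q = "pole_center g", OF _ _ _ _ ind])
    fix z :: "real \<times> real"
    obtain s t where z: "z = (s, t)" by (cases z)
    have "(\<Sum>j=1..nt. rho_hat nt j * Bt j (t2 - t)) = (\<Sum>j=1..nt. rho nt j * Bt_refl j t)"
      by (subst sum_reverse) (intro sum.cong refl, simp only: Bt_refl_def rho_reverse[OF nt])
    then show "(case z of (s, t) \<Rightarrow> Fhat (s, t2 - t)) = polar_map ns nt (rho nt) (theta_hat ns) (tensor Bs Bt_refl) z"
      unfolding z prod.case Fhat_def polar_map_tensor by simp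
    show "(case z of (s, t) \<Rightarrow> \<Sum>l=1..n. N l (s, t2 - t) *\<^sub>R f l)
      = (\<Sum>j=1..nt. \<Sum>i=1..ns. tensor Bs Bt_refl i j z *\<^sub>R tensor_control_point ns nt f i (nt + 1 - j))"
      unfolding z prod.case surface
      by (subst sum_reverse) (intro sum.cong refl, simp add: tensor_def Bt_refl_def)
  next
    fix i assume i: "i \<in> {1..ns}"
    have e: "nt + 1 - 1 = nt" "nt + 1 - 2 = nt - 1" using nt by auto
    show "tensor_control_point ns nt f i (nt + 1 - 1) = pole_center g"
      unfolding e using control_point_last_pole(1)[OF nt i, of f] by (simp add: g_def[abs_def])
    show "tensor_control_point ns nt f i (nt + 1 - 2) = pole_center g + (cos (theta_hat ns i) *\<^sub>R ((1/3) *\<^sub>R g 0 - (1/6) *\<^sub>R g 1 - (1/6) *\<^sub>R g 2)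
        + sin (theta_hat ns i) *\<^sub>R ((sqrt 3 / 6) *\<^sub>R (g 1 - g 2)))"
      unfolding e using control_point_last_pole(2)[OF nt i, of f]
      unfolding pole_map_eq fst_conv snd_conv g_def[symmetric] .
  qed
qed

end

theorem corollary3p6:
  fixes ms mt ns nt n :: nat
    and S T :: "nat \<Rightarrow> segment"
    and s2 t2 :: real
    and \<Omega> :: "(real \<times> real) set"
    and B :: "nat \<Rightarrow> nat \<Rightarrow> real \<times> real \<Rightarrow> real"
    and F Fhat :: "real \<times> real \<Rightarrow> real \<times> real"
    and N :: "nat \<Rightarrow> real \<times> real \<Rightarrow> real"
  assumes "1 \<le> ms" and "\<forall>i\<in>{1..ms}. valid_segment (S i)"
    and "1 \<le> mt" and "\<forall>i\<in>{1..mt}. valid_segment (T i)"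
    and "s2 = offset S (ms+1)" and "t2 = offset T (mt+1)" and "\<Omega> = {0..s2} \<times> {0..t2}"
    and "ns = eta S ms" and "3 \<le> ns"
    and "nt = eta T mt + 2" and "4 \<le> nt"
    and "B = tensor (periodic_basis ms S) (nonperiodic_basis mt T)"
    and "F = polar_map ns nt (rho nt) (theta ns) B"
    and "Fhat = polar_map ns nt (rho_hat nt) (theta_hat ns) B"
    and "regular_off_pole s2 t2 {0<..t2} F"
    and "regular_off_pole s2 t2 {0..<t2} Fhat"
    and "n = ns * (nt - 4) + 6"
    and "N = polar_spline ns nt B"
  shows "lin_indep_funs \<Omega> n N \<and>
    locally_supported \<Omega> ns nt n B N \<and>
    convex_partition_of_unity \<Omega> n N \<and>
    (3 \<le> CARD('d::finite) \<longrightarrow>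
      (\<forall>f :: nat \<Rightarrow> real ^ 'd.
         \<not> collinear {f 1, f 2, f 3} \<and> \<not> collinear {f (n-2), f (n-1), f n} \<longrightarrow>
         well_defined_tangent_plane s2 t2 0 F (\<lambda>z. \<Sum>l=1..n. N l z *\<^sub>R f l) \<and>
         well_defined_tangent_plane s2 t2 t2 Fhat (\<lambda>z. \<Sum>l=1..n. N l z *\<^sub>R f l)))"
proof -
  interpret S: segment_chain ms S using assms(1,2) by unfold_locales auto
  interpret T: segment_chain mt T using assms(3,4) by unfold_locales auto
  have s2: "s2 = offset S (Suc ms)" and t2: "t2 = offset T (Suc mt)" and eta: "2 \<le> eta S ms"
    using assms(5,6,8,9) by simp_all
  interpret periodic_family ns s2 "periodic_basis ms S" S.periodic_deriv
    unfolding s2 assms(8) by (rule S.periodic_basis_family[OF eta])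
  interpret double_pole ns s2 "periodic_basis ms S" S.periodic_deriv nt t2 "nonperiodic_basis mt T" T.nonperiodic_deriv
    "start_slope (T 1)" "end_slope (T mt)"
  proof unfold_locales
    show "3 \<le> ns" "4 \<le> nt" by (rule assms(9,11))+
    show "0 < t2" unfolding t2 by (rule T.length_pos)
    show "0 < start_slope (T 1)" "0 < end_slope (T mt)" using T.start_slope_pos T.end_slope_pos assms(3) by simp_all
    show "(\<Sum>j=1..nt. nonperiodic_basis mt T j t) = 1" if "t \<in> {0..t2}" for t
      using T.nonperiodic_basis_sum that unfolding t2 assms(10) by blast
    show "c i = 0" if "\<And>s. s \<in> {0..s2} \<Longrightarrow> (\<Sum>i=1..ns. c i * periodic_basis ms S i s) = 0" "i \<in> {1..ns}" for c i
      using S.periodic_basis_independent[OF eta] that unfolding s2 assms(8) by blast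
    show "c j = 0" if "\<And>t. t \<in> {0..t2} \<Longrightarrow> (\<Sum>j=1..nt. c j * nonperiodic_basis mt T j t) = 0" "j \<in> {1..nt}" for c j
      using T.nonperiodic_basis_independent that unfolding t2 assms(10) by blast
    show "0 \<le> periodic_basis ms S i s" if "i \<in> {1..ns}" "s \<in> {0..s2}" for i s
      using S.periodic_basis_nonneg[OF eta] that unfolding s2 assms(8) by blast
    fix j assume "j \<in> {1..nt}"
    then have j: "j \<in> {1..eta T mt + 2}" unfolding assms(10) .
    have nt1: "nt - 1 = eta T mt + 1" using assms(10) by simp
    show "C1_on 0 t2 (nonperiodic_basis mt T j) (T.nonperiodic_deriv j)"
      unfolding t2 by (rule T.nonperiodic_basis_C1[OF j])
    show "0 \<le> nonperiodic_basis mt T j t" if "t \<in> {0..t2}" for t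
      using T.nonperiodic_basis_nonneg[OF j] that unfolding t2 .
    show "nonperiodic_basis mt T j 0 = of_bool (j = 1)"
      "T.nonperiodic_deriv j 0 = start_slope (T 1) * (of_bool (j = 2) - of_bool (j = 1))"
      by (rule T.nonperiodic_basis_at_0[OF j])+
    show "nonperiodic_basis mt T j t2 = of_bool (j = nt)"
      "T.nonperiodic_deriv j t2 = end_slope (T mt) * (of_bool (j = nt) - of_bool (j = nt - 1))"
      unfolding nt1 unfolding t2 assms(10) by (rule T.nonperiodic_basis_at_length[OF j])+
  qed
  show ?thesis
    using splines_independent splines_locally_supported splines_partition_of_unity
      tangent_plane_first_pole[OF assms(15)[unfolded assms(12,13)]]
      tangent_plane_last_pole[OF assms(16)[unfolded assms(12,14)]]
    unfolding assms(7,12,13,14,17,18) by blast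
qed

end
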